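(* Let $\Delta$ be a pure simplicial complex of dimension $m-1\ge2$ whose clique decomposition $\Delta=\Delta_1\cup\cdots\cup\Delta_r$ satisfies conditions (i) and (ii), and suppose that $G_\Delta$ is a cycle. Then $J_\Delta$ is a prime ideal.
   Context: Let $K$ be a field, $X=(x_{ij})$ an $m\times n$ matrix of indeterminates, $S=K[X]$, and $\Delta$ a pure $(m-1)$-dimensional simplicial complex on $[n]$. For $1\le a_1<\dots<a_m\le n$, $[a_1\ldots a_m]$ is the maximal minor with columns $a_1,\dots,a_m$; $J_\Delta=(\mu_F : F\in\mathcal{F}(\Delta))$ with $\mu_F=[a_1\ldots a_m]$ for a facet $F=\{a_1<\dots<a_m\}$ (primality is independent of the labeling). Clique decomposition: let $\mathcal{S}$ be the set of simplices $\Gamma$ with vertices in $[n]$, $\dim\Gamma\ge m-1$, whose $(m-1)$-skeleton is contained in $\Delta$; the maximal elements $\Gamma_1,\dots,\Gamma_r$ of $\mathcal{S}$ give the cliques $\Delta_i=\Gamma_i^{(m-1)}$, $\Delta=\Delta_1\cup\cdots\cup\Delta_r$; $V(\Delta_i)$ is the vertex set of $\Delta_i$. Conditions: (i) $|V(\Delta_i)\cap V(\Delta_j)|\le1$ for all $i<j$; (ii) $V(\Delta_i)\cap V(\Delta_j)\cap V(\Delta_k)=\emptyset$ for all $i<j<k$. $G_\Delta$ is the simple graph on vertices $v_1,\dots,v_r$ with an edge $\{v_i,v_j\}$ ($i\ne j$) iff $V(\Delta_i)\cap V(\Delta_j)\ne\emptyset$; a cycle means a cycle graph on $r\ge3$ vertices.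 *)

theory Defs
  imports Main "HOL-Library.Poly_Mapping" "HOL-Combinatorics.Permutations"
begin

type_synonym 'a mpoly = "((nat \<times> nat) \<Rightarrow>\<^sub>0 nat) \<Rightarrow>\<^sub>0 'a"

definition Var :: "nat \<Rightarrow> nat \<Rightarrow> 'a::comm_ring_1 mpoly" where
  "Var i j = Poly_Mapping.single (Poly_Mapping.single (i, j) 1) 1"

text \<open>S = K[X], X = (x_ij), rows i in {0..<m}, columns j in {1..n}: polynomials
  only involving these variables.\<close>
definition polyring :: "nat \<Rightarrow> nat \<Rightarrow> 'a::comm_ring_1 mpoly set" where
  "polyring m n = {p. \<forall>mono \<in> Poly_Mapping.keys p. Poly_Mapping.keys mono \<subseteq> {0..<m} \<times> {1..n}}"

definition minor :: "nat \<Rightarrow> nat set \<Rightarrow> 'a::comm_ring_1 mpoly" where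
  "minor m F = (let a = sorted_list_of_set F in
     \<Sum>p | p permutes {0..<m}. of_int (sign p) * (\<Prod>i<m. Var i (a ! (p i))))"

definition ideal_gen :: "'a::comm_ring_1 set \<Rightarrow> 'a set \<Rightarrow> 'a set" where
  "ideal_gen R G = {p. \<exists>G' c. finite G' \<and> G' \<subseteq> G \<and> (\<forall>g\<in>G'. c g \<in> R) \<and>
                          p = (\<Sum>g\<in>G'. c g * g)}"

definition prime_ideal_in :: "'a::comm_ring_1 set \<Rightarrow> 'a set \<Rightarrow> bool" where
  "prime_ideal_in R I \<longleftrightarrow> I \<subseteq> R \<and> I \<noteq> R \<and>
     (\<forall>a\<in>R. \<forall>b\<in>R. a * b \<in> I \<longrightarrow> a \<in> I \<or> b \<in> I)"

text \<open>J_Delta, Delta given by its set of facets.\<close>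
definition J_Delta :: "nat \<Rightarrow> nat \<Rightarrow> nat set set \<Rightarrow> 'a::comm_ring_1 mpoly set" where
  "J_Delta m n Fs = ideal_gen (polyring m n) (minor m ` Fs)"

text \<open>Pure (m-1)-dimensional simplicial complex on [n] given by its facets.\<close>
definition pure_complex :: "nat \<Rightarrow> nat \<Rightarrow> nat set set \<Rightarrow> bool" where
  "pure_complex m n Fs \<longleftrightarrow> Fs \<noteq> {} \<and> (\<forall>F\<in>Fs. F \<subseteq> {1..n} \<and> card F = m)"

definition faces :: "nat set set \<Rightarrow> nat set set" where
  "faces Fs = {G. \<exists>F\<in>Fs. G \<subseteq> F}"

text \<open>The set \<S>, represented by vertex sets W of simplices Gamma: dim Gamma \<ge> m-1 and
  the (m-1)-skeleton of Gamma (all subsets of W of size \<le> m) is contained in Delta.\<close>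
definition clique_simplices :: "nat \<Rightarrow> nat \<Rightarrow> nat set set \<Rightarrow> nat set set" where
  "clique_simplices m n Fs = {W. W \<subseteq> {1..n} \<and> card W \<ge> m \<and>
      (\<forall>G. G \<subseteq> W \<and> card G \<le> m \<longrightarrow> G \<in> faces Fs)}"

definition cliques :: "nat \<Rightarrow> nat \<Rightarrow> nat set set \<Rightarrow> nat set set" where
  "cliques m n Fs = {W \<in> clique_simplices m n Fs.
      \<forall>W' \<in> clique_simplices m n Fs. W \<subseteq> W' \<longrightarrow> W' = W}"

definition cond_i :: "nat set set \<Rightarrow> bool" where
  "cond_i C \<longleftrightarrow> (\<forall>V\<in>C. \<forall>W\<in>C. V \<noteq> W \<longrightarrow> card (V \<inter> W) \<le> 1)"

definition cond_ii :: "nat set set \<Rightarrow> bool" where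
  "cond_ii C \<longleftrightarrow> (\<forall>U\<in>C. \<forall>V\<in>C. \<forall>W\<in>C. U \<noteq> V \<and> V \<noteq> W \<and> U \<noteq> W \<longrightarrow> U \<inter> V \<inter> W = {})"

definition G_edge :: "nat set set \<Rightarrow> nat set \<Rightarrow> nat set \<Rightarrow> bool" where
  "G_edge C V W \<longleftrightarrow> V \<in> C \<and> W \<in> C \<and> V \<noteq> W \<and> V \<inter> W \<noteq> {}"

definition is_cycle_graph :: "'v set \<Rightarrow> ('v \<Rightarrow> 'v \<Rightarrow> bool) \<Rightarrow> bool" where
  "is_cycle_graph Vs E \<longleftrightarrow> finite Vs \<and> card Vs \<ge> 3 \<and>
     (\<exists>f. bij_betw f {0..<card Vs} Vs \<and>
        (\<forall>i<card Vs. \<forall>j<card Vs. E (f i) (f j) \<longleftrightarrow>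
            (j = Suc i mod card Vs \<or> i = Suc j mod card Vs)))"

end

theory Submission
  imports Defs "Jordan_Normal_Form.Determinant" "HOL-Computational_Algebra.Polynomial_Factorial"
    "HOL-Number_Theory.Cong" "HOL-Library.Product_Lexorder" "HOL-Library.Nat_Bijection"
begin

text \<open>
  Only the case of large cliques matters: giving every clique new private columns and
  setting them to zero at the end is a retraction between the two ideals.

  For suitable column orders the leading terms of the maximal minors are their diagonal terms
  (up to reordering the columns), and around a cycle the order can be chosen such that
  diagonals from different cliques have disjoint supports. So the Groebner bases of the single
  cliques combine, and for a given clique one can moreover arrange that some \<open>(m - 1)\<close>-minor
  in rows \<open>1, \<dots>, m - 1\<close> on private columns has a leading term free of all diagonals; it is then
  a nonzerodivisor modulo the ideal \<open>J\<close>. After inverting these minors, row \<open>0\<close> of the columns of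
  clique \<open>i\<close> is a linear form with coefficients \<open>\<lambda>\<^sub>i\<close> in the other rows, and \<open>J\<close> becomes the ideal
  of the quadrics \<open>(\<lambda>\<^sub>i - \<lambda>\<^sub>i\<^sub>+\<^sub>1) \<cdot> x = 0\<close>, one for each shared column \<open>x\<close>. As \<open>m - 1 \<ge> 2\<close>, these
  quadrics have pairwise coprime leading terms for another order, and after inverting some
  further nonzerodivisors they can be solved rationally for some of the \<open>\<lambda>\<close>. Hence \<open>J\<close> is the
  kernel of a homomorphism to a field.
\<close>

text \<open>The quadrics arise because at a generic point the columns of clique i lie on a
  hyperplane that expresses their row 0 by the other rows with coefficients \<lambda>(i). A column
  shared by two neighbours lies on both hyperplanes, so the difference of the two coefficient
  vectors is orthogonal to it.

  The obstacle is the cycle itself. Along a path the quadrics could be solved one after the other,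
  but here the last one leads back to \<lambda>(0). Likewise no order can make coefficient k of
  \<lambda>(i) larger than that of its successor all the way round. A second coefficient index
  breaks both circles, which is the use of m - 1 \<ge> 2. The column orders meet the same circle and
  get past it because a diagonal of length at least 3 leaves room for a displaced shared column.

  New columns are added because a clique with m vertices, two of them shared, has m - 2 private
  columns, one too few for an (m - 1)-minor.

  No single order serves all cliques. Each basis minor gets an order of its own, with the cycle
  started at its clique. Being a nonzerodivisor does not depend on the order, so the results can be
  multiplied together.\<close>

abbreviation lookup where "lookup \<equiv> Poly_Mapping.lookup"
abbreviation keys where "keys \<equiv> Poly_Mapping.keys"
abbreviation single where "single \<equiv> Poly_Mapping.single"

subsection \<open>Substitution into polynomials\<close>

definition mono_val :: "('v \<Rightarrow> 'b::comm_monoid_mult) \<Rightarrow> ('v \<Rightarrow>\<^sub>0 nat) \<Rightarrow> 'b" where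
  "mono_val f u = (\<Prod>c\<in>keys u. f c ^ lookup u c)"

lemma mono_val_superset:
  assumes "finite S" "keys u \<subseteq> S"
  shows "mono_val f u = (\<Prod>c\<in>S. f c ^ lookup u c)"
  unfolding mono_val_def by (rule prod.mono_neutral_left) (use assms in \<open>auto simp: in_keys_iff\<close>)

lemma mono_val_add: "mono_val f (u + v) = mono_val f u * mono_val f v"
proof -
  let ?S = "keys u \<union> keys v"
  have "mono_val f (u + v) = (\<Prod>c\<in>?S. f c ^ lookup (u + v) c)"
    by (rule mono_val_superset) (auto simp: Poly_Mapping.keys_add)
  also have "\<dots> = (\<Prod>c\<in>?S. f c ^ lookup u c) * (\<Prod>c\<in>?S. f c ^ lookup v c)"
    by (simp add: lookup_add power_add prod.distrib)
  also have "(\<Prod>c\<in>?S. f c ^ lookup u c) = mono_val f u" by (rule mono_val_superset[symmetric]) auto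
  also have "(\<Prod>c\<in>?S. f c ^ lookup v c) = mono_val f v" by (rule mono_val_superset[symmetric]) auto
  finally show ?thesis .
qed

lemma mono_val_0 [simp]: "mono_val f 0 = 1"
  by (simp add: mono_val_def)

lemma mono_val_single [simp]: "mono_val f (single c k) = f c ^ k"
  by (cases "k = 0") (auto simp: mono_val_def)

lemma mono_val_sum: "finite A \<Longrightarrow> mono_val f (sum g A) = (\<Prod>i\<in>A. mono_val f (g i))"
  by (induction A rule: finite_induct) (auto simp: mono_val_add)

lemma sum_single_lookup: "(\<Sum>u\<in>keys p. single u (lookup p u)) = p"
proof (rule poly_mapping_eqI)
  fix k
  have "lookup (\<Sum>u\<in>keys p. single u (lookup p u)) k = (\<Sum>u\<in>keys p. if u = k then lookup p u else 0)"
    by (auto simp: lookup_sum lookup_single when_def intro!: sum.cong)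
  also have "\<dots> = lookup p k" by (auto simp: in_keys_iff)
  finally show "lookup (\<Sum>u\<in>keys p. single u (lookup p u)) k = lookup p k" .
qed

text \<open>The coefficient map \<open>h\<close> is a parameter because the targets differ: among
  them are the polynomial ring itself, its fraction field and a group algebra.\<close>

definition subst_poly ::
  "('a::comm_ring_1 \<Rightarrow> 'b::comm_ring_1) \<Rightarrow> ('v \<Rightarrow> 'b) \<Rightarrow> (('v \<Rightarrow>\<^sub>0 nat) \<Rightarrow>\<^sub>0 'a) \<Rightarrow> 'b" where
  "subst_poly h f p = (\<Sum>u\<in>keys p. h (lookup p u) * mono_val f u)"

context comm_ring_hom
begin

lemma subst_poly_superset:
  assumes "finite S" "keys p \<subseteq> S"
  shows "subst_poly hom f p = (\<Sum>u\<in>S. hom (lookup p u) * mono_val f u)"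
  unfolding subst_poly_def
  by (rule sum.mono_neutral_left) (use assms in \<open>auto simp: in_keys_iff\<close>)

lemma subst_poly_add: "subst_poly hom f (p + q) = subst_poly hom f p + subst_poly hom f q"
proof -
  let ?S = "keys p \<union> keys q"
  have "subst_poly hom f (p + q) = (\<Sum>u\<in>?S. hom (lookup (p + q) u) * mono_val f u)"
    by (rule subst_poly_superset) (auto simp: Poly_Mapping.keys_add)
  also have "\<dots> = (\<Sum>u\<in>?S. hom (lookup p u) * mono_val f u) + (\<Sum>u\<in>?S. hom (lookup q u) * mono_val f u)"
    by (simp add: lookup_add hom_add distrib_right sum.distrib)
  also have "(\<Sum>u\<in>?S. hom (lookup p u) * mono_val f u) = subst_poly hom f p"
    by (rule subst_poly_superset[symmetric]) auto
  also have "(\<Sum>u\<in>?S. hom (lookup q u) * mono_val f u) = subst_poly hom f q"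
    by (rule subst_poly_superset[symmetric]) auto
  finally show ?thesis .
qed

lemma subst_poly_single [simp]: "subst_poly hom f (single u a) = hom a * mono_val f u"
  by (cases "a = 0") (auto simp: subst_poly_def)

lemma subst_poly_0 [simp]: "subst_poly hom f 0 = 0"
  by (simp add: subst_poly_def)

lemma subst_poly_sum: "subst_poly hom f (sum g A) = (\<Sum>i\<in>A. subst_poly hom f (g i))"
  by (induction A rule: infinite_finite_induct) (auto simp: subst_poly_add)

lemma subst_poly_mult: "subst_poly hom f (p * q) = subst_poly hom f p * subst_poly hom f q"
proof -
  have "p * q = (\<Sum>u\<in>keys p. single u (lookup p u)) * (\<Sum>v\<in>keys q. single v (lookup q v))"
    by (simp add: sum_single_lookup)
  also have "\<dots> = (\<Sum>u\<in>keys p. \<Sum>v\<in>keys q. single (u + v) (lookup p u * lookup q v))"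
    by (simp add: sum_product mult_single)
  also have "subst_poly hom f \<dots> = (\<Sum>u\<in>keys p. \<Sum>v\<in>keys q.
       (hom (lookup p u) * mono_val f u) * (hom (lookup q v) * mono_val f v))"
    by (simp add: subst_poly_sum hom_mult mono_val_add mult_ac)
  also have "\<dots> = subst_poly hom f p * subst_poly hom f q"
    by (simp add: sum_product subst_poly_def)
  finally show ?thesis .
qed

lemma comm_ring_hom_subst_poly: "comm_ring_hom (subst_poly hom f)"
proof
  show "subst_poly hom f 1 = 1"
    using subst_poly_single[of f 0 1] by (simp add: hom_one)
qed (simp_all add: subst_poly_add subst_poly_mult)

end

abbreviation (input) X :: "'v \<Rightarrow> ('v \<Rightarrow>\<^sub>0 nat) \<Rightarrow>\<^sub>0 'a::comm_ring_1" where
  "X c \<equiv> single (single c 1) 1"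

lemma prod_single:
  "finite A \<Longrightarrow> (\<Prod>i\<in>A. single (f i) (g i)) = single (sum f A) (prod g A :: 'a::comm_ring_1)"
  by (induction A rule: finite_induct) (auto simp: mult_single)

lemma power_single: "single u a ^ k = single ((\<Sum>i<k. u)) (a ^ k :: 'a::comm_ring_1)"
  by (induction k) (auto simp: mult_single add.commute mult.commute)

lemma single_eq_mono_val: "single u (1::'a::comm_ring_1) = mono_val X u"
proof -
  have s: "(\<Sum>i<k. single c (1::nat)) = single c k" for c :: 'b and k :: nat
    by (induction k) (auto simp: single_add[symmetric])
  have "mono_val X u = (\<Prod>c\<in>keys u. single (single c (lookup u c)) (1::'a))"
    unfolding mono_val_def power_single s by simp
  also have "\<dots> = single (\<Sum>c\<in>keys u. single c (lookup u c)) 1"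
    by (simp add: prod_single)
  also have "\<dots> = single u 1" by (simp only: sum_single_lookup)
  finally show ?thesis ..
qed

lemma poly_vars_induct [consumes 1, case_names const var add mult]:
  fixes p :: "('v \<Rightarrow>\<^sub>0 nat) \<Rightarrow>\<^sub>0 'a::comm_ring_1"
  assumes vars: "\<forall>u\<in>keys p. keys u \<subseteq> S"
    and const: "\<And>a. P (single 0 a)" and var: "\<And>c. c \<in> S \<Longrightarrow> P (X c)"
    and add: "\<And>p q. P p \<Longrightarrow> P q \<Longrightarrow> P (p + q)" and mult: "\<And>p q. P p \<Longrightarrow> P q \<Longrightarrow> P (p * q)"
  shows "P p"
proof -
  have P1: "P 1" using const[of 1] by simp
  have P0: "P 0" using const[of 0] by simp
  have pw: "P (q ^ k)" if "P q" for q k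
    by (induction k) (auto intro: P1 mult that)
  have pr: "P (prod g A)" if "finite A" "\<And>c. c \<in> A \<Longrightarrow> P (g c)" for g :: "'v \<Rightarrow> _" and A
    using that by (induction A rule: finite_induct) (auto intro: P1 mult)
  have sm: "P (sum g A)" if "finite A" "\<And>c. c \<in> A \<Longrightarrow> P (g c)" for g :: "('v \<Rightarrow>\<^sub>0 nat) \<Rightarrow> _" and A
    using that by (induction A rule: finite_induct) (auto intro: P0 add)
  have "P (single u (lookup p u))" if "u \<in> keys p" for u
  proof -
    have "single u (lookup p u) = single 0 (lookup p u) * mono_val X u"
      unfolding single_eq_mono_val[symmetric] mult_single by simp
    moreover have "P (mono_val X u)"
      unfolding mono_val_def
    proof (rule pr)
      fix c assume "c \<in> keys u"
      then have "c \<in> S" using vars that by blast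
      from pw[OF var[OF this]] show "P (X c ^ lookup u c)" .
    qed simp
    ultimately show ?thesis using mult const by metis
  qed
  then have "P (\<Sum>u\<in>keys p. single u (lookup p u))" by (intro sm) auto
  then show ?thesis by (simp only: sum_single_lookup)
qed

subsection \<open>Ideals\<close>

definition is_ideal :: "'a::comm_ring_1 set \<Rightarrow> bool" where
  "is_ideal I \<longleftrightarrow> 0 \<in> I \<and> (\<forall>a\<in>I. \<forall>b\<in>I. a + b \<in> I) \<and> (\<forall>r. \<forall>a\<in>I. r * a \<in> I)"

lemma is_idealD:
  assumes "is_ideal I"
  shows "0 \<in> I" "a \<in> I \<Longrightarrow> b \<in> I \<Longrightarrow> a + b \<in> I" "a \<in> I \<Longrightarrow> r * a \<in> I" "a \<in> I \<Longrightarrow> a * r \<in> I"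
    "a \<in> I \<Longrightarrow> - a \<in> I" "a \<in> I \<Longrightarrow> b \<in> I \<Longrightarrow> a - b \<in> I"
proof -
  show *: "0 \<in> I" "\<And>a b. a \<in> I \<Longrightarrow> b \<in> I \<Longrightarrow> a + b \<in> I" "\<And>a r. a \<in> I \<Longrightarrow> r * a \<in> I"
    using assms by (auto simp: is_ideal_def)
  show "a \<in> I \<Longrightarrow> a * r \<in> I" using *(3)[of a r] by (simp add: mult.commute)
  show m: "\<And>a. a \<in> I \<Longrightarrow> - a \<in> I" using *(3)[of _ "- 1"] by simp
  show "a \<in> I \<Longrightarrow> b \<in> I \<Longrightarrow> a - b \<in> I" using *(2)[of a "- b"] m by simp
qed

lemma is_ideal_sum: "is_ideal I \<Longrightarrow> (\<And>i. i \<in> A \<Longrightarrow> f i \<in> I) \<Longrightarrow> sum f A \<in> I"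
  by (induction A rule: infinite_finite_induct) (auto intro: is_idealD)

text \<open>Coefficients range over the whole ring and one multiple is added per step, which gives a
  structural induction. The link to \<open>ideal_gen\<close> over \<open>polyring m n\<close> is
  made in \<open>J_Delta_eq\<close>.\<close>

inductive_set idl :: "'a::comm_ring_1 set \<Rightarrow> 'a set" for G where
  zero: "0 \<in> idl G"
| step: "a \<in> idl G \<Longrightarrow> g \<in> G \<Longrightarrow> a + c * g \<in> idl G"

lemma idl_gen: "g \<in> G \<Longrightarrow> g \<in> idl G"
  using idl.step[OF idl.zero, of g G 1] by simp

lemma idl_add: "b \<in> idl G \<Longrightarrow> a \<in> idl G \<Longrightarrow> a + b \<in> idl G"
  by (induction rule: idl.induct) (auto simp: add.assoc[symmetric] intro: idl.step)

lemma is_ideal_idl: "is_ideal (idl G)"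
proof -
  have "r * a \<in> idl G" if "a \<in> idl G" for r a
    using that by induction (auto simp: distrib_left mult.assoc[symmetric] intro: idl.intros)
  then show ?thesis by (auto simp: is_ideal_def idl.zero idl_add)
qed

lemma idl_least: "is_ideal I \<Longrightarrow> G \<subseteq> I \<Longrightarrow> idl G \<subseteq> I"
proof
  fix a assume I: "is_ideal I" "G \<subseteq> I" and "a \<in> idl G"
  from this(3) show "a \<in> I" by induction (use I in \<open>auto intro: is_idealD\<close>)
qed

lemma idl_mono: "G \<subseteq> H \<Longrightarrow> idl G \<subseteq> idl H"
  by (rule idl_least[OF is_ideal_idl]) (auto intro: idl_gen)

lemma idl_UN_sum:
  assumes "finite I" "p \<in> idl (\<Union>i\<in>I. G i)"
  shows "\<exists>f. (\<forall>i\<in>I. f i \<in> idl (G i)) \<and> p = sum f I"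
  using assms(2)
proof induction
  case zero
  show ?case by (rule exI[of _ "\<lambda>_. 0"]) (auto intro: idl.zero)
next
  case (step a g c)
  then obtain f i where f: "\<forall>i\<in>I. f i \<in> idl (G i)" "a = sum f I" and i: "i \<in> I" "g \<in> G i" by blast
  let ?f = "f(i := f i + c * g)"
  have "sum ?f I = a + c * g"
  proof -
    have "sum ?f I = ?f i + sum ?f (I - {i})" by (rule sum.remove[OF assms(1) i(1)])
    moreover have "sum ?f (I - {i}) = sum f (I - {i})" by (rule sum.cong) auto
    moreover have "a = f i + sum f (I - {i})" unfolding f(2) by (rule sum.remove[OF assms(1) i(1)])
    ultimately show ?thesis by (simp add: add_ac)
  qed
  moreover have "\<forall>k\<in>I. ?f k \<in> idl (G k)" using f(1) i by (simp add: idl.step)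
  ultimately show ?case by (intro exI[of _ ?f]) auto
qed

definition nonzerodiv_mod :: "'a::comm_ring_1 \<Rightarrow> 'a set \<Rightarrow> bool" where
  "nonzerodiv_mod h I \<longleftrightarrow> (\<forall>f. h * f \<in> I \<longrightarrow> f \<in> I)"

lemma nonzerodiv_mod_1: "nonzerodiv_mod 1 I"
  by (simp add: nonzerodiv_mod_def)

lemma nonzerodiv_mod_mult:
  "nonzerodiv_mod g I \<Longrightarrow> nonzerodiv_mod h I \<Longrightarrow> nonzerodiv_mod (g * h) I"
  unfolding nonzerodiv_mod_def mult.assoc by blast

lemma nonzerodiv_mod_prod:
  "(\<And>i. i \<in> A \<Longrightarrow> nonzerodiv_mod (g i) I) \<Longrightarrow> nonzerodiv_mod (prod g A) I"
  by (induction A rule: infinite_finite_induct) (auto intro: nonzerodiv_mod_1 nonzerodiv_mod_mult)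

lemma nonzerodiv_mod_power: "nonzerodiv_mod g I \<Longrightarrow> nonzerodiv_mod (g ^ k) I"
  by (induction k) (auto intro: nonzerodiv_mod_1 nonzerodiv_mod_mult)

subsection \<open>Monomial orders\<close>

text \<open>Weighting the variables by distinct primes makes the integer value of a monomial an
  injective weight, so comparing values is a well-founded total monomial order.\<close>

locale prime_weights =
  fixes bb :: "'v \<Rightarrow> nat"
  assumes inj_bb: "inj bb" and prime_bb: "prime (bb c)"
begin

abbreviation N :: "('v \<Rightarrow>\<^sub>0 nat) \<Rightarrow> nat" where "N \<equiv> mono_val bb"

lemma bb_ge2: "bb c \<ge> 2" using prime_ge_2_nat[OF prime_bb] .

lemma bb_pos [simp]: "bb c > 0" using bb_ge2[of c] by linarith

lemma N_pos [simp]: "N u > 0"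
  by (auto simp: mono_val_def intro!: prod_pos)

lemma multiplicity_N: "multiplicity (bb c) (N u) = lookup u c"
proof -
  let ?e = "\<lambda>p. lookup u (inv_into UNIV bb p)"
  have "N u = (\<Prod>p\<in>bb ` keys u. p ^ ?e p)"
    unfolding mono_val_def
    by (subst prod.reindex) (auto simp: inj_bb inv_f_f intro: inj_on_subset[OF inj_bb])
  moreover have "multiplicity (bb c) (\<Prod>p\<in>bb ` keys u. p ^ ?e p)
      = (if bb c \<in> bb ` keys u then ?e (bb c) else 0)"
    by (rule multiplicity_prod_prime_powers) (auto simp: prime_bb)
  moreover have "bb c \<in> bb ` keys u \<longleftrightarrow> c \<in> keys u" using inj_bb by (auto simp: inj_def)
  ultimately show ?thesis by (auto simp: inj_bb in_keys_iff)
qed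

lemma N_inj: "N u = N v \<Longrightarrow> u = v"
  by (rule poly_mapping_eqI) (metis multiplicity_N)

definition Lead :: "(('v \<Rightarrow>\<^sub>0 nat) \<Rightarrow>\<^sub>0 'a::zero) \<Rightarrow> ('v \<Rightarrow>\<^sub>0 nat) \<Rightarrow> bool" where
  "Lead p u \<longleftrightarrow> lookup p u \<noteq> 0 \<and> (\<forall>v\<in>keys p. v \<noteq> u \<longrightarrow> N v < N u)"

lemma Lead_exists: "p \<noteq> 0 \<Longrightarrow> \<exists>u. Lead p u"
proof -
  assume "p \<noteq> 0"
  then have "keys p \<noteq> {}" by auto
  then have "Max (N ` keys p) \<in> N ` keys p" by (intro Max_in) auto
  then obtain u where u: "u \<in> keys p" "N u = Max (N ` keys p)" by auto
  have "N v < N u" if "v \<in> keys p" "v \<noteq> u" for v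
  proof -
    have "N v \<le> N u" using that u by simp
    moreover have "N v \<noteq> N u" using that N_inj by blast
    ultimately show ?thesis by simp
  qed
  with u show ?thesis unfolding Lead_def by (auto simp: in_keys_iff)
qed

lemma Lead_le: "Lead p u \<Longrightarrow> v \<in> keys p \<Longrightarrow> N v \<le> N u"
  unfolding Lead_def by (cases "v = u") (auto simp: less_imp_le)

lemma Lead_unique: "Lead p u \<Longrightarrow> Lead p v \<Longrightarrow> u = v"
  unfolding Lead_def by (metis in_keys_iff less_asym)

text \<open>Only the term \<open>t0\<close> has to dominate strictly; the remaining exponents may
  coincide and their coefficients may cancel.\<close>

lemma Lead_sum_single:
  assumes "finite T" "t0 \<in> T" "a t0 \<noteq> 0" "\<And>t. t \<in> T \<Longrightarrow> t \<noteq> t0 \<Longrightarrow> N (u t) < N (u t0)"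
    and p: "p = (\<Sum>t\<in>T. single (u t) (a t))"
  shows "Lead p (u t0)" "lookup p (u t0) = a t0"
proof -
  have lk: "lookup p v = (\<Sum>t\<in>T. if u t = v then a t else 0)" for v
    by (auto simp: p lookup_sum lookup_single when_def intro!: sum.cong)
  have "lookup p (u t0) = (\<Sum>t\<in>{t0}. if u t = u t0 then a t else 0)"
    unfolding lk by (rule sum.mono_neutral_right) (use assms in \<open>auto, (metis less_irrefl)+\<close>)
  then show *: "lookup p (u t0) = a t0" by simp
  have "N v < N (u t0)" if v: "v \<in> keys p" "v \<noteq> u t0" for v
  proof -
    have "\<exists>t\<in>T. u t = v"
    proof (rule ccontr)
      assume "\<not> ?thesis"
      then have "lookup p v = 0" unfolding lk by (intro sum.neutral) auto
      with v show False by (simp add: in_keys_iff)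
    qed
    with v assms show ?thesis by metis
  qed
  with * assms show "Lead p (u t0)" unfolding Lead_def by auto
qed

lemma Lead_mult:
  fixes p q :: "('v \<Rightarrow>\<^sub>0 nat) \<Rightarrow>\<^sub>0 'a::idom"
  assumes "Lead p u" "Lead q v"
  shows "Lead (p * q) (u + v)" "lookup (p * q) (u + v) = lookup p u * lookup q v"
proof -
  let ?T = "keys p \<times> keys q"
  have pq: "p * q = (\<Sum>t\<in>?T. single (fst t + snd t) (lookup p (fst t) * lookup q (snd t)))"
    by (subst (1 2) sum_single_lookup[symmetric])
      (simp add: sum_product mult_single sum.cartesian_product case_prod_unfold)
  have uv: "(u, v) \<in> ?T" using assms by (auto simp: Lead_def in_keys_iff)
  have nz: "lookup p u * lookup q v \<noteq> 0" using assms by (auto simp: Lead_def)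
  have less: "N (a + b) < N (u + v)" if "a \<in> keys p" "b \<in> keys q" "(a, b) \<noteq> (u, v)" for a b
  proof -
    have le: "N a \<le> N u" "N b \<le> N v" using that assms Lead_le by blast+
    have "a \<noteq> u \<or> b \<noteq> v" using that by auto
    then show ?thesis
    proof
      assume "a \<noteq> u"
      then have "N a < N u" using that assms by (auto simp: Lead_def)
      then have "N a * N b < N u * N v" using le by (intro mult_less_le_imp_less) auto
      then show ?thesis by (simp add: mono_val_add)
    next
      assume "b \<noteq> v"
      then have "N b < N v" using that assms by (auto simp: Lead_def)
      then have "N a * N b < N u * N v" using le by (intro mult_le_less_imp_less) auto
      then show ?thesis by (simp add: mono_val_add)
    qed
  qed
  show "Lead (p * q) (u + v)" "lookup (p * q) (u + v) = lookup p u * lookup q v"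
    using Lead_sum_single[OF _ uv _ _ pq] nz less by auto
qed

lemma Lead_single [simp]: "a \<noteq> 0 \<Longrightarrow> Lead (single u a) u"
  by (auto simp: Lead_def)

text \<open>A coincidence of leading terms between two ideals whose leading monomials have disjoint
  supports is removed by a multiple of the product of the two generators, which lies in both
  ideals; so Groebner bases with pairwise coprime leading terms can be put together.\<close>

lemma Lead_sum_ideals_aux:
  fixes f :: "'i \<Rightarrow> ('v \<Rightarrow>\<^sub>0 nat) \<Rightarrow>\<^sub>0 'a::field"
  assumes fin: "finite I" and ideal: "\<And>i. i \<in> I \<Longrightarrow> is_ideal (K i)"
    and gb: "\<And>i p u. i \<in> I \<Longrightarrow> p \<in> K i \<Longrightarrow> Lead p u \<Longrightarrow> \<exists>v\<in>M i. \<exists>w. u = v + w"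
    and gen: "\<And>i v. i \<in> I \<Longrightarrow> v \<in> M i \<Longrightarrow> \<exists>g\<in>K i. Lead g v \<and> lookup g v = 1"
    and cop: "\<And>i j v w. i \<in> I \<Longrightarrow> j \<in> I \<Longrightarrow> i \<noteq> j \<Longrightarrow> v \<in> M i \<Longrightarrow> w \<in> M j \<Longrightarrow> keys v \<inter> keys w = {}"
    and f: "\<And>i. i \<in> I \<Longrightarrow> f i \<in> K i" and bound: "\<And>i v. i \<in> I \<Longrightarrow> v \<in> keys (f i) \<Longrightarrow> N v \<le> B"
    and lead: "Lead (sum f I) u"
  shows "\<exists>i\<in>I. \<exists>v\<in>M i. \<exists>w. u = v + w"
  using f bound lead
proof (induction B arbitrary: f rule: less_induct)
  case (less B)
  note IH_B = less.IH
  \<comment> \<open>The inner induction is on the number of components that attain the bound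
    \<open>B\<close>. When none attains it, the bound itself drops.\<close>
  show ?case using less.prems
  proof (induction "card {i\<in>I. \<exists>v\<in>keys (f i). N v = B}" arbitrary: f rule: less_induct)
  case less
  note IH = less.hyps and f = less.prems(1) and bound = less.prems(2) and lead = less.prems(3)
  let ?S = "{i\<in>I. \<exists>v\<in>keys (f i). N v = B}"
  have keysum: "\<exists>i\<in>I. v \<in> keys (f i)" if "v \<in> keys (sum f I)" for v
  proof (rule ccontr)
    assume "\<not> ?thesis"
    then have "lookup (sum f I) v = 0" unfolding lookup_sum by (intro sum.neutral) (auto simp: in_keys_iff)
    with that show False by (simp add: in_keys_iff)
  qed
  show ?case
  proof (cases "?S = {}")
    case True
    have "u \<in> keys (sum f I)" using lead by (simp add: Lead_def in_keys_iff)
    then obtain i where i: "i \<in> I" "u \<in> keys (f i)" using keysum by blast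
    have "B > 0" using bound[OF i] N_pos[of u] by linarith
    moreover have "N v \<le> B - 1" if "i \<in> I" "v \<in> keys (f i)" for i v
      using bound[OF that] True that by fastforce
    ultimately show ?thesis by (intro IH_B[of "B - 1" f]) (use f lead in auto)
  next
    case False
    then obtain i mu where i: "i \<in> I" "mu \<in> keys (f i)" "N mu = B" by blast
    have SE: "?S = {i\<in>I. lookup (f i) mu \<noteq> 0}"
      using i N_inj by (auto simp: in_keys_iff)
    have lead_i: "Lead (f j) mu" if "j \<in> ?S" for j
    proof -
      have "lookup (f j) mu \<noteq> 0" using that unfolding SE by simp
      moreover have "N v < N mu" if "v \<in> keys (f j)" "v \<noteq> mu" for v
        using bound[of j v] that \<open>j \<in> ?S\<close> i N_inj[of v mu] by fastforce
      ultimately show ?thesis by (simp add: Lead_def)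
    qed
    have iS: "i \<in> ?S" using i by auto
    show ?thesis
    proof (cases "lookup (sum f I) mu = 0")
      case False
      have "u = mu"
      proof (rule ccontr)
        assume "u \<noteq> mu"
        then have "N mu < N u" using lead False by (auto simp: Lead_def in_keys_iff)
        moreover have "u \<in> keys (sum f I)" using lead by (simp add: Lead_def in_keys_iff)
        then obtain i where "i \<in> I" "u \<in> keys (f i)" using keysum by blast
        then have "N u \<le> B" using bound by blast
        ultimately show False using i by simp
      qed
      then show ?thesis using gb[OF i(1) f[OF i(1)] lead_i[OF iS]] i(1) by blast
    next
      case True
      have "\<exists>j\<in>I. j \<noteq> i \<and> lookup (f j) mu \<noteq> 0"
      proof (rule ccontr)
        assume "\<not> ?thesis"
        then have "lookup (sum f I) mu = lookup (f i) mu"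
          unfolding lookup_sum using i(1) fin by (subst sum.remove[of I i]) (auto intro!: sum.neutral)
        then show False using True i by (simp add: in_keys_iff)
      qed
      then obtain j where j: "j \<in> I" "j \<noteq> i" "lookup (f j) mu \<noteq> 0" by blast
      then have jS: "j \<in> ?S" unfolding SE by simp
      obtain v w where v: "v \<in> M i" "mu = v + w" using gb[OF i(1) f[OF i(1)] lead_i[OF iS]] by blast
      obtain v' w' where v': "v' \<in> M j" "mu = v' + w'" using gb[OF j(1) f[OF j(1)] lead_i[OF jS]] by blast
      have disj: "keys v \<inter> keys v' = {}" using cop[of i j v v'] i j v v' by auto
      \<comment> \<open>Both \<open>v\<close> and \<open>v'\<close> divide \<open>mu\<close> and
        have disjoint supports, so their product divides \<open>mu\<close> and the truncated
        subtraction is exact.\<close>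
      define x where "x = mu - (v + v')"
      have mu: "mu = v + v' + x"
      proof (rule poly_mapping_eqI)
        fix k
        have "lookup v k = 0 \<or> lookup v' k = 0" using disj by (auto simp: in_keys_iff)
        moreover have "lookup mu k = lookup v k + lookup w k" "lookup mu k = lookup v' k + lookup w' k"
          using v v' by (metis lookup_add)+
        ultimately show "lookup mu k = lookup (v + v' + x) k"
          by (auto simp: x_def lookup_add lookup_minus)
      qed
      obtain g where g: "g \<in> K i" "Lead g v" "lookup g v = 1" using gen[OF i(1) v(1)] by blast
      obtain g' where g': "g' \<in> K j" "Lead g' v'" "lookup g' v' = 1" using gen[OF j(1) v'(1)] by blast
      define c where "c = lookup (f i) mu"
      have c: "c \<noteq> 0" using i by (simp add: c_def in_keys_iff)
      define h where "h = single x c * (g * g')"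
      have gg: "Lead (g * g') (v + v')" "lookup (g * g') (v + v') = 1"
        using Lead_mult[OF g(2) g'(2)] g g' by auto
      have h: "Lead h mu" "lookup h mu = c"
        using Lead_mult[OF Lead_single[OF c, of x] gg(1)] gg(2) mu
        by (auto simp: h_def add.commute)
      have hi: "h \<in> K i" "h \<in> K j" unfolding h_def
        using g(1) g'(1) is_idealD[OF ideal[OF i(1)]] is_idealD[OF ideal[OF j(1)]]
        by (simp_all add: mult.assoc[symmetric])
      \<comment> \<open>Moving \<open>h\<close> from component \<open>i\<close> to component
        \<open>j\<close> keeps the sum and cancels \<open>mu\<close> in component \<open>i\<close>.
        Component \<open>j\<close> contained \<open>mu\<close> already, so fewer components attain
        the bound.\<close>
      define f' where "f' = f(i := f i - h, j := f j + h)"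
      have sum': "sum f' I = sum f I"
      proof -
        have fj: "finite (I - {i})" "j \<in> I - {i}" using fin j by auto
        show ?thesis
          using i(1) j fin unfolding f'_def
          by (simp add: sum.remove[OF fin i(1)] sum.remove[OF fj])
      qed
      have f'K: "f' k \<in> K k" if "k \<in> I" for k
        using f[OF that] hi is_idealD[OF ideal[OF that]] by (auto simp: f'_def)
      have keysh: "N y \<le> B" if "y \<in> keys h" for y using Lead_le[OF h(1) that] i by simp
      have bound': "N y \<le> B" if "k \<in> I" "y \<in> keys (f' k)" for k y
      proof -
        have "y \<in> keys (f k) \<or> y \<in> keys h" using that
          by (auto simp: f'_def in_keys_iff lookup_add lookup_minus split: if_splits)
        then show ?thesis using keysh bound that by auto
      qed
      have "{k\<in>I. \<exists>v\<in>keys (f' k). N v = B} \<subseteq> {k\<in>I. lookup (f' k) mu \<noteq> 0}"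
        using i N_inj by (auto simp: in_keys_iff)
      also have "\<dots> \<subseteq> ?S - {i}"
        unfolding SE using j h(2) by (auto simp: f'_def lookup_add lookup_minus c_def)
      finally have "card {k\<in>I. \<exists>v\<in>keys (f' k). N v = B} \<le> card (?S - {i})"
        by (intro card_mono) (use fin in auto)
      also have "\<dots> < card ?S" using iS fin by (intro card_Diff1_less) auto
      finally have "card {k\<in>I. \<exists>v\<in>keys (f' k). N v = B} < card ?S" .
      then show ?thesis by (rule IH) (use f'K bound' lead sum' in auto)
    qed
  qed
  qed
qed

lemma Lead_sum_ideals:
  fixes G :: "'i \<Rightarrow> (('v \<Rightarrow>\<^sub>0 nat) \<Rightarrow>\<^sub>0 'a::field) set"
  assumes fin: "finite I"
    and gb: "\<And>i p u. i \<in> I \<Longrightarrow> p \<in> idl (G i) \<Longrightarrow> Lead p u \<Longrightarrow> \<exists>v\<in>M i. \<exists>w. u = v + w"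
    and gen: "\<And>i v. i \<in> I \<Longrightarrow> v \<in> M i \<Longrightarrow> \<exists>g\<in>idl (G i). Lead g v \<and> lookup g v = 1"
    and cop: "\<And>i j v w. i \<in> I \<Longrightarrow> j \<in> I \<Longrightarrow> i \<noteq> j \<Longrightarrow> v \<in> M i \<Longrightarrow> w \<in> M j \<Longrightarrow> keys v \<inter> keys w = {}"
    and p: "p \<in> idl (\<Union>i\<in>I. G i)" "Lead p u"
  shows "\<exists>i\<in>I. \<exists>v\<in>M i. \<exists>w. u = v + w"
proof -
  obtain f where f: "\<forall>i\<in>I. f i \<in> idl (G i)" "p = sum f I" using idl_UN_sum[OF fin p(1)] by blast
  let ?A = "N ` (\<Union>i\<in>I. keys (f i))"
  have bound: "N v \<le> Max (insert 0 ?A)" if "i \<in> I" "v \<in> keys (f i)" for i v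
    by (rule Max_ge) (use fin that in auto)
  show ?thesis
    by (rule Lead_sum_ideals_aux[where K = "\<lambda>i. idl (G i)" and M = M and f = f, OF fin is_ideal_idl gb gen cop _ bound])
      (use f p in auto)
qed

text \<open>Division algorithm: the leading monomial \<open>w + u\<close> of \<open>h * f\<close> is
  divisible by some \<open>v\<close> in \<open>M\<close> prime to \<open>w\<close>. Hence
  \<open>v\<close> divides \<open>u\<close>, and a multiple of an element of \<open>I\<close>
  cancels the leading term of \<open>f\<close> while \<open>h * f\<close> stays in
  \<open>I\<close>.\<close>

lemma nonzerodiv_mod_of_Lead:
  fixes h :: "('v \<Rightarrow>\<^sub>0 nat) \<Rightarrow>\<^sub>0 'a::field"
  assumes I: "is_ideal I"
    and gb: "\<And>p u. p \<in> I \<Longrightarrow> Lead p u \<Longrightarrow> \<exists>v\<in>M. \<exists>w. u = v + w"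
    and gen: "\<And>v. v \<in> M \<Longrightarrow> \<exists>g\<in>I. Lead g v \<and> lookup g v = 1"
    and h: "Lead h w" and cop: "\<And>v. v \<in> M \<Longrightarrow> keys v \<inter> keys w = {}"
  shows "nonzerodiv_mod h I"
proof -
  have "f \<in> I" if "h * f \<in> I" "\<forall>v\<in>keys f. N v < B" for f B
    using that
  proof (induction B arbitrary: f rule: less_induct)
    case (less B)
    show ?case
    proof (cases "f = 0")
      case True
      then show ?thesis using is_idealD[OF I] by simp
    next
      case False
      then obtain u where u: "Lead f u" using Lead_exists by blast
      obtain v x where v: "v \<in> M" "w + u = v + x" using gb[OF less.prems(1) Lead_mult(1)[OF h u]] by blast
      define y where "y = u - v"
      have y: "u = y + v"
      proof (rule poly_mapping_eqI)
        fix k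
        have "lookup w k + lookup u k = lookup v k + lookup x k" using v(2) by (metis lookup_add)
        moreover have "lookup v k = 0 \<or> lookup w k = 0" using cop[OF v(1)] by (auto simp: in_keys_iff)
        ultimately show "lookup u k = lookup (y + v) k" by (auto simp: y_def lookup_add lookup_minus)
      qed
      obtain g where g: "g \<in> I" "Lead g v" "lookup g v = 1" using gen[OF v(1)] by blast
      let ?c = "lookup f u"
      have c: "?c \<noteq> 0" using u by (simp add: Lead_def)
      let ?q = "single y ?c * g"
      have q: "Lead ?q u" "lookup ?q u = ?c"
        using Lead_mult[OF Lead_single[OF c, of y] g(2)] g(3) y by auto
      have qI: "?q \<in> I" by (rule is_idealD(3)[OF I g(1)])
      have less_u: "N z < N u" if "z \<in> keys (f - ?q)" for z
      proof -
        have "z \<noteq> u" using that q by (auto simp: in_keys_iff lookup_minus)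
        moreover have "z \<in> keys f \<or> z \<in> keys ?q" using that by (auto simp: in_keys_iff lookup_minus)
        ultimately show ?thesis using u q by (auto simp: Lead_def)
      qed
      have "N u < B" using less.prems u by (auto simp: Lead_def in_keys_iff)
      moreover have "h * (f - ?q) \<in> I"
        unfolding right_diff_distrib
        by (rule is_idealD(6)[OF I less.prems(1) is_idealD(3)[OF I qI]])
      ultimately have "f - ?q \<in> I" by (rule less.IH) (use less_u in auto)
      then have "(f - ?q) + ?q \<in> I" by (rule is_idealD(2)[OF I _ qI])
      then show ?thesis by simp
    qed
  qed
  moreover have "\<exists>B. \<forall>v\<in>keys f. N v < B" for f :: "('v \<Rightarrow>\<^sub>0 nat) \<Rightarrow>\<^sub>0 'a"
    by (rule exI[of _ "Suc (Max (N ` keys f))"]) (auto simp: less_Suc_eq_le)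
  ultimately show ?thesis unfolding nonzerodiv_mod_def by blast
qed

end

text \<open>Gaps beyond the square make a product of two variables of lower order smaller than a
  single variable of higher order, so quadratic monomials compare by their largest variable. Ties of
  \<open>ord\<close> are broken by the injection \<open>e\<close>.\<close>

lemma exists_prime_weights:
  fixes ord e :: "'v \<Rightarrow> nat"
  assumes "finite C" and e: "inj e"
  shows "\<exists>bb. prime_weights bb \<and> (\<forall>c\<in>C. \<forall>d\<in>C. ord c < ord d \<longrightarrow> bb c * bb c < bb d)"
proof -
  define b where "b = rec_nat (2::nat) (\<lambda>_ x. SOME p. prime p \<and> x * x < p)"
  have b0: "b 0 = 2" by (simp add: b_def)
  have bS: "prime (b (Suc n)) \<and> b n * b n < b (Suc n)" for n
    using someI_ex[OF bigger_prime[of "b n * b n"]] by (simp add: b_def)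
  have pr: "prime (b n)" for n using b0 bS by (cases n) auto
  have step: "b n < b (Suc n)" for n
  proof -
    have "b n \<le> b n * b n" using prime_gt_0_nat[OF pr[of n]] by (simp add: Suc_le_eq)
    then show ?thesis using bS[of n] by linarith
  qed
  then have sm: "strict_mono b" by (simp add: strict_mono_Suc_iff)
  have sq: "b i * b i < b j" if "i < j" for i j
  proof -
    have "b (Suc i) \<le> b j" using sm that by (simp add: strict_mono_less_eq)
    then show ?thesis using bS[of i] by linarith
  qed
  define k where "k = Suc (Max (insert 0 (e ` C)))"
  have k: "e c < k" if "c \<in> C" for c
    unfolding k_def less_Suc_eq_le by (rule Max_ge) (use assms that in auto)
  \<comment> \<open>Block \<open>ord c\<close>, position \<open>e c < k\<close> inside the block.
    Variables outside \<open>C\<close> start in a later block, which keeps \<open>rk\<close>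
    injective.\<close>
  define rk where "rk c = (if c \<in> C then ord c * k + e c
     else Suc (Max (insert 0 (ord ` C))) * k + e c)" for c
  have ordC: "ord c \<le> Max (insert 0 (ord ` C))" if "c \<in> C" for c
    by (rule Max_ge) (use assms that in auto)
  have divk: "(a * k + x) div k = a \<and> (a * k + x) mod k = x" if "x < k" for a x using that by auto
  have outer: "rk c < rk d" if "c \<in> C" "d \<notin> C" for c d
  proof -
    have "Suc (ord c) * k \<le> Suc (Max (insert 0 (ord ` C))) * k"
      by (rule mult_right_mono) (use ordC[OF that(1)] in simp_all)
    then have "ord c * k + k \<le> Suc (Max (insert 0 (ord ` C))) * k" by (simp add: add.commute)
    moreover have "rk c = ord c * k + e c" "rk d = Suc (Max (insert 0 (ord ` C))) * k + e d"
      using that by (auto simp: rk_def)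
    ultimately show ?thesis using k[OF that(1)] by linarith
  qed
  have inj: "inj rk"
  proof (rule injI)
    fix c d assume eq: "rk c = rk d"
    show "c = d"
    proof (cases "c \<in> C"; cases "d \<in> C")
      assume cd: "c \<in> C" "d \<in> C"
      have "e c = e d"
        using divk[OF k[OF cd(1)], of "ord c"] divk[OF k[OF cd(2)], of "ord d"] eq cd
        by (simp add: rk_def)
      then show ?thesis using e by (simp add: inj_eq)
    next
      assume "c \<in> C" "d \<notin> C" then show ?thesis using outer[of c d] eq by simp
    next
      assume "c \<notin> C" "d \<in> C" then show ?thesis using outer[of d c] eq by simp
    next
      assume "c \<notin> C" "d \<notin> C" then show ?thesis using eq e by (simp add: rk_def inj_eq)
    qed
  qed
  have "prime_weights (b \<circ> rk)"
    by standard (use inj sm pr in \<open>auto intro!: inj_compose simp: strict_mono_imp_inj_on\<close>)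
  moreover have "(b \<circ> rk) c * (b \<circ> rk) c < (b \<circ> rk) d" if "c \<in> C" "d \<in> C" "ord c < ord d" for c d
  proof -
    have "Suc (ord c) * k \<le> ord d * k" using that by (intro mult_right_mono) auto
    then have "rk c < rk d" using k[OF that(1)] that by (simp add: rk_def)
    then show ?thesis using sq by simp
  qed
  ultimately show ?thesis by blast
qed

subsection \<open>Determinants of generic matrices\<close>

text \<open>Rows and columns are given by arbitrary functions, so that columns can follow the order
  belonging to a monomial order instead of their numbering. Repeated columns are allowed and give
  zero.\<close>

definition gen_det :: "nat \<Rightarrow> (nat \<Rightarrow> nat) \<Rightarrow> (nat \<Rightarrow> nat) \<Rightarrow> 'a::comm_ring_1 mpoly" where
  "gen_det m r c = det (mat m m (\<lambda>(i, j). X (r i, c j)))"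

lemma gen_det_cong:
  assumes "\<And>i. i < m \<Longrightarrow> r i = r' i" "\<And>i. i < m \<Longrightarrow> c i = c' i"
  shows "(gen_det m r c :: 'a::comm_ring_1 mpoly) = gen_det m r' c'"
proof -
  have "mat m m (\<lambda>(i, j). X (r i, c j) :: 'a mpoly) = mat m m (\<lambda>(i, j). X (r' i, c' j))"
    using assms by (intro eq_matI) auto
  then show ?thesis by (simp only: gen_det_def)
qed

lemma gen_det_sum:
  "gen_det m r c = (\<Sum>p | p permutes {0..<m}.
     single (\<Sum>i<m. single (r i, c (p i)) 1) (of_int (sign p) :: 'a::comm_ring_1))"
proof -
  have "gen_det m r c = (\<Sum>p | p permutes {0..<m}. of_int (sign p) *
      (\<Prod>i<m. X (r i, c (p i)) :: 'a mpoly))"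
    unfolding gen_det_def det_def
    by (auto intro!: sum.cong prod.cong simp: permutes_in_image lessThan_atLeast0)
  also have "\<dots> = (\<Sum>p | p permutes {0..<m}.
     single (\<Sum>i<m. single (r i, c (p i)) 1) (of_int (sign p)))"
  proof (rule sum.cong[OF refl])
    fix p
    have "(\<Prod>i<m. X (r i, c (p i)) :: 'a mpoly) = single (\<Sum>i<m. single (r i, c (p i)) 1) 1"
      by (subst prod_single) auto
    moreover have "of_int (sign p) = (single 0 (of_int (sign p)) :: 'a mpoly)" by simp
    ultimately show "of_int (sign p) * (\<Prod>i<m. X (r i, c (p i)) :: 'a mpoly) =
        single (\<Sum>i<m. single (r i, c (p i)) 1) (of_int (sign p))"
      by (simp only: mult_single) simp
  qed
  finally show ?thesis .
qed

lemma gen_det_permute: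
  assumes "q permutes {0..<m}"
  shows "gen_det m r (c \<circ> q) = of_int (sign q) * gen_det m r c"
proof -
  let ?A = "mat m m (\<lambda>(i, j). X (r j, c i)) :: 'a::comm_ring_1 mpoly mat"
  have q: "q i < m" if "i < m" for i using assms that permutes_in_image[of q "{0..<m}" i] by auto
  have "gen_det m r (c \<circ> q) = det (transpose_mat (mat m m (\<lambda>(i, j). ?A $$ (q i, j))))"
    unfolding gen_det_def by (rule arg_cong[of _ _ det], rule eq_matI) (auto simp: q)
  also have "\<dots> = det (mat m m (\<lambda>(i, j). ?A $$ (q i, j)))"
    by (rule det_transpose[of _ m]) auto
  also have "\<dots> = of_int (sign q) * det ?A"
    by (rule det_permute_rows) (use assms in auto)
  also have "det ?A = det (transpose_mat ?A)"
    by (rule det_transpose[symmetric, of _ m]) auto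
  also have "transpose_mat ?A = mat m m (\<lambda>(i, j). X (r i, c j))"
    by (rule eq_matI) auto
  finally show ?thesis by (simp only: gen_det_def)
qed

lemma gen_det_enum_unique:
  assumes c: "bij_betw c {0..<m} F" and c': "bij_betw c' {0..<m} F"
  shows "gen_det m r c' = (gen_det m r c :: 'a::comm_ring_1 mpoly) \<or>
    gen_det m r c' = - (gen_det m r c :: 'a mpoly)"
proof -
  define q where "q j = (if j < m then inv_into {0..<m} c (c' j) else j)" for j
  have "bij_betw (inv_into {0..<m} c \<circ> c') {0..<m} {0..<m}"
    using c' bij_betw_inv_into[OF c] by (rule bij_betw_trans)
  then have "bij_betw q {0..<m} {0..<m}"
    by (rule iffD1[OF bij_betw_cong, rotated]) (auto simp: q_def)
  then have q: "q permutes {0..<m}" by (rule bij_imp_permutes) (auto simp: q_def)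
  have "c' i = (c \<circ> q) i" if "i < m" for i
  proof -
    have "c' i \<in> c ` {0..<m}" using c c' that by (auto simp: bij_betw_def)
    then show ?thesis using that by (simp add: q_def f_inv_into_f)
  qed
  then have "(gen_det m r c' :: 'a mpoly) = gen_det m r (c \<circ> q)" by (intro gen_det_cong) auto
  also have "\<dots> = of_int (sign q) * gen_det m r c" by (rule gen_det_permute[OF q])
  finally show ?thesis by (cases "evenperm q") (simp_all add: sign_def)
qed

lemma minor_eq_gen_det: "minor m F = gen_det m id (\<lambda>j. sorted_list_of_set F ! j)"
  unfolding minor_def Let_def gen_det_def det_def Var_def
  by (auto intro!: sum.cong prod.cong simp: permutes_in_image lessThan_atLeast0)

lemma gen_det_eq_minor:
  assumes "bij_betw c {0..<m} F"
  shows "gen_det m id c = (minor m F :: 'a::comm_ring_1 mpoly) \<or> gen_det m id c = - (minor m F :: 'a mpoly)"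
proof -
  have card: "card F = m" "finite F"
    using bij_betw_same_card[OF assms] bij_betw_finite[OF assms] by auto
  have "bij_betw (\<lambda>j. sorted_list_of_set F ! j) {0..<m} F"
    using bij_betw_nth[of "sorted_list_of_set F" "{0..<m}" F] card by (simp add: atLeast0LessThan)
  from gen_det_enum_unique[OF this assms] show ?thesis by (simp only: minor_eq_gen_det)
qed

lemma gen_det_not_inj:
  assumes "\<not> inj_on c {0..<m}"
  shows "gen_det m r c = 0"
proof -
  obtain i j where ij: "i < m" "j < m" "i \<noteq> j" "c i = c j" using assms by (auto simp: inj_on_def)
  show ?thesis unfolding gen_det_def
    by (rule det_identical_columns[of _ m i j]) (use ij in \<open>auto intro!: eq_vecI\<close>)
qed

definition minors :: "nat \<Rightarrow> nat set \<Rightarrow> 'a::comm_ring_1 mpoly set" where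
  "minors m W = minor m ` {F. F \<subseteq> W \<and> card F = m}"

lemma gen_det_in_minors:
  assumes "\<And>i. i < m \<Longrightarrow> c i \<in> W"
  shows "gen_det m id c \<in> idl (minors m W)"
proof (cases "inj_on c {0..<m}")
  case False
  then show ?thesis by (simp add: gen_det_not_inj idl.zero)
next
  case True
  let ?F = "c ` {0..<m}"
  have "card ?F = m" using True by (simp add: card_image)
  moreover have "?F \<subseteq> W" using assms by auto
  ultimately have "minor m ?F \<in> idl (minors m W)" by (intro idl_gen) (auto simp: minors_def)
  moreover have "bij_betw c {0..<m} ?F" using True by (simp add: bij_betw_def)
  ultimately show ?thesis using gen_det_eq_minor[of c m ?F] is_idealD(5)[OF is_ideal_idl] by metis
qed

text \<open>The matrix factors through dimension \<open>m - 1\<close>; padding the left factor with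
  a zero column makes both factors square.\<close>

lemma det_low_rank:
  fixes Y Z :: "nat \<Rightarrow> nat \<Rightarrow> 'b::comm_ring_1"
  assumes "m > 0"
  shows "det (mat m m (\<lambda>(i, j). \<Sum>q<m - 1. Y i q * Z q j)) = 0"
proof -
  let ?Y = "mat m m (\<lambda>(i, q). if q < m - 1 then Y i q else 0)"
  let ?Z = "mat m m (\<lambda>(q, j). Z q j)"
  have "mat m m (\<lambda>(i, j). \<Sum>q<m - 1. Y i q * Z q j) = ?Y * ?Z"
  proof (rule eq_matI)
    fix i j assume "i < dim_row (?Y * ?Z)" "j < dim_col (?Y * ?Z)"
    then have ij: "i < m" "j < m" by auto
    have "(?Y * ?Z) $$ (i, j) = (\<Sum>q = 0..<m. (if q < m - 1 then Y i q else 0) * Z q j)"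
      using ij by (auto simp: scalar_prod_def intro!: sum.cong)
    also have "\<dots> = (\<Sum>q<m - 1. (if q < m - 1 then Y i q else 0) * Z q j)"
      by (rule sum.mono_neutral_right) auto
    finally show "mat m m (\<lambda>(i, j). \<Sum>q<m - 1. Y i q * Z q j) $$ (i, j) = (?Y * ?Z) $$ (i, j)"
      using ij by simp
  qed auto
  moreover have "det ?Y = 0"
    by (subst laplace_expansion_column[of _ m "m - 1"]) (use assms in auto)
  moreover have "det (?Y * ?Z) = det ?Y * det ?Z" by (rule det_mult) auto
  ultimately show ?thesis by (simp only: mult_zero_left)
qed

subsection \<open>Diagonal leading terms\<close>

text \<open>The least point that is not fixed is moved upwards, and its preimage lies to the right
  of it.\<close>

lemma permutes_inversion:
  fixes p :: "nat \<Rightarrow> nat"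
  assumes p: "p permutes {0..<m}" "p \<noteq> id"
  shows "\<exists>i i'. i < i' \<and> i' < m \<and> p i' < p i"
proof -
  have "\<exists>i. p i \<noteq> i" using p(2) by auto
  then obtain i where i: "p i \<noteq> i" "\<And>l. l < i \<Longrightarrow> p l = l"
    using exists_least_iff[of "\<lambda>i. p i \<noteq> i"] by auto
  obtain i' where i': "p i' = i" using permutes_surj[OF p(1)] by (metis surjD)
  have inj: "inj p" using permutes_inj[OF p(1)] .
  have ne: "i' \<noteq> i" using i i' by auto
  have "\<not> i' < i" using i(2)[of i'] i' ne by auto
  then have "i' > i" using ne by simp
  moreover have "i' < m"
  proof (rule ccontr)
    assume "\<not> i' < m"
    then have "p i' = i'" using p(1) by (simp add: permutes_def)
    then show False using i' ne by simp
  qed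
  moreover have "p i > i"
  proof (rule ccontr)
    assume "\<not> p i > i"
    then have "p i < i" using i(1) by simp
    then have "p (p i) = p i" using i(2) by blast
    then show False using i(1) injD[OF inj] by blast
  qed
  ultimately show ?thesis using i' by blast
qed

text \<open>By the strict Monge inequality, undoing an inversion increases the product. So a
  maximizing permutation has no inversion and is the identity.\<close>

lemma permutes_prod_less_diag:
  fixes w :: "nat \<Rightarrow> nat \<Rightarrow> nat"
  assumes pos: "\<And>i j. w i j > 0"
    and monge: "\<And>i i' j j'. i < i' \<Longrightarrow> i' < m \<Longrightarrow> j < j' \<Longrightarrow> j' < m \<Longrightarrow> w i j' * w i' j < w i j * w i' j'"
    and p: "p permutes {0..<m}" "p \<noteq> id"
  shows "(\<Prod>i<m. w i (p i)) < (\<Prod>i<m. w i i)"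
proof -
  let ?P = "{p. p permutes {0..<m}}"
  define f where "f p = (\<Prod>i<m. w i (p i))" for p
  have incr: "\<exists>p'\<in>?P. f p < f p'" if p: "p \<in> ?P" "p \<noteq> id" for p
  proof -
    obtain i i' where i: "i < i'" "i' < m" "p i' < p i" using permutes_inversion p by blast
    have pim: "p i < m" using permutes_in_image[of p "{0..<m}" i] p i by auto
    let ?p = "p \<circ> transpose i i'"
    have "?p permutes {0..<m}"
      by (rule permutes_compose[OF permutes_swap_id]) (use p i in auto)
    moreover have "f p < f ?p"
    proof -
      let ?S = "{..<m} - {i} - {i'}"
      have split: "f g = w i (g i) * (w i' (g i') * (\<Prod>k\<in>?S. w k (g k)))" for g
      proof -
        have "f g = w i (g i) * (\<Prod>k\<in>{..<m} - {i}. w k (g k))"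
          unfolding f_def by (rule prod.remove) (use i in auto)
        also have "(\<Prod>k\<in>{..<m} - {i}. w k (g k)) = w i' (g i') * (\<Prod>k\<in>?S. w k (g k))"
          by (rule prod.remove) (use i in auto)
        finally show ?thesis .
      qed
      have eq: "(\<Prod>k\<in>?S. w k (?p k)) = (\<Prod>k\<in>?S. w k (p k))"
        by (rule prod.cong) (auto simp: transpose_def)
      have "(\<Prod>k\<in>?S. w k (p k)) > 0" by (rule prod_pos) (use pos in auto)
      then have "(w i (p i) * w i' (p i')) * (\<Prod>k\<in>?S. w k (p k)) < (w i (p i') * w i' (p i)) * (\<Prod>k\<in>?S. w k (p k))"
        using monge[OF i(1,2,3) pim] by (intro mult_strict_right_mono) auto
      moreover have "f p = (w i (p i) * w i' (p i')) * (\<Prod>k\<in>?S. w k (p k))"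
        unfolding split[of p] by simp
      moreover have "f ?p = (w i (p i') * w i' (p i)) * (\<Prod>k\<in>?S. w k (p k))"
        unfolding split[of ?p] eq by simp
      ultimately show ?thesis by simp
    qed
    ultimately show ?thesis by blast
  qed
  have fin: "finite ?P" by (simp add: finite_permutations)
  have "id \<in> ?P" by (simp add: permutes_id)
  then have "f ` ?P \<noteq> {}" by blast
  then have "Max (f ` ?P) \<in> f ` ?P" using fin by (intro Max_in) auto
  then obtain p0 where p0: "p0 \<in> ?P" "f p0 = Max (f ` ?P)" by auto
  have max: "f p' \<le> f p0" if "p' \<in> ?P" for p' using p0 fin that by auto
  have "p0 = id" using incr[OF p0(1)] max by (meson leD)
  moreover obtain p' where "p' \<in> ?P" "f p < f p'" using incr p by blast
  ultimately show ?thesis using max[of p'] by (simp add: f_def)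
qed

definition diag :: "nat \<Rightarrow> (nat \<Rightarrow> nat) \<Rightarrow> (nat \<Rightarrow> nat) \<Rightarrow> (nat \<times> nat \<Rightarrow>\<^sub>0 nat)" where
  "diag m r c = (\<Sum>i<m. single (r i, c i) 1)"

lemma keys_sum_single: "finite A \<Longrightarrow> keys (\<Sum>i\<in>A. single (f i) (1::nat)) = f ` A"
proof (induction A rule: finite_induct)
  case (insert a A)
  have "keys (single (f a) 1 + g) = insert (f a) (keys g)" for g :: "'b \<Rightarrow>\<^sub>0 nat"
    by (auto simp: in_keys_iff lookup_add lookup_single when_def split: if_splits)
  then show ?case using insert by simp
qed simp

lemma keys_diag: "keys (diag m r c) = (\<lambda>i. (r i, c i)) ` {..<m}"
  by (simp add: diag_def keys_sum_single del: One_nat_def)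

lemma Lead_gen_det:
  fixes bb' :: "nat \<times> nat \<Rightarrow> nat"
  assumes bb': "prime_weights bb'"
    and monge: "\<And>i i' j j'. i < i' \<Longrightarrow> i' < m \<Longrightarrow> j < j' \<Longrightarrow> j' < m \<Longrightarrow>
       bb' (r i, c j') * bb' (r i', c j) < bb' (r i, c j) * bb' (r i', c j')"
  shows "prime_weights.Lead bb' (gen_det m r c :: 'a::comm_ring_1 mpoly) (diag m r c)"
    and "lookup (gen_det m r c :: 'a::comm_ring_1 mpoly) (diag m r c) = 1"
proof -
  interpret w: prime_weights bb' by (rule bb')
  let ?u = "\<lambda>p. \<Sum>i<m. single (r i, c (p i)) (1::nat)"
  have Nu: "w.N (?u p) = (\<Prod>i<m. bb' (r i, c (p i)))" for p
    by (simp add: mono_val_sum)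
  have less: "w.N (?u p) < w.N (?u id)" if "p \<in> {p. p permutes {0..<m}}" "p \<noteq> id" for p
    unfolding Nu using permutes_prod_less_diag[of "\<lambda>i j. bb' (r i, c j)" m p] monge that by simp
  note lead = w.Lead_sum_single[where ?t0.0 = id and u = ?u and T = "{p. p permutes {0..<m}}"
      and a = "\<lambda>p. of_int (sign p)", OF _ _ _ less gen_det_sum]
  have sign: "(of_int (sign (id :: nat \<Rightarrow> nat)) :: 'a) = 1" by (simp add: sign_id)
  have "w.Lead (gen_det m r c :: 'a mpoly) (?u id)"
    by (rule lead(1)) (simp_all add: finite_permutations permutes_id sign)
  then show "w.Lead (gen_det m r c :: 'a mpoly) (diag m r c)"
    unfolding diag_def by simp
  have "lookup (gen_det m r c :: 'a mpoly) (?u id) = of_int (sign (id :: nat \<Rightarrow> nat))"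
    by (rule lead(2)) (simp_all add: finite_permutations permutes_id sign)
  then show "lookup (gen_det m r c :: 'a mpoly) (diag m r c) = 1"
    unfolding diag_def sign by (simp only: id_apply)
qed

subsection \<open>Antichain decompositions and potentials\<close>

text \<open>Mirsky's theorem: the minimal elements form one colour class, and removing them shortens
  every maximal chain length by one.\<close>

lemma antichain_coloring:
  assumes trans: "\<And>x y z. lt x y \<Longrightarrow> lt y z \<Longrightarrow> lt x z"
    and no_chain: "\<not> (\<exists>xs. set xs \<subseteq> P \<and> sorted_wrt lt xs \<and> length xs = Suc q)"
  shows "\<exists>f :: 'a \<Rightarrow> nat. (\<forall>x\<in>P. f x < q) \<and> (\<forall>x\<in>P. \<forall>y\<in>P. lt x y \<longrightarrow> f x \<noteq> f y)"
  using no_chain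
proof (induction q arbitrary: P)
  case 0
  have "P = {}"
  proof (rule ccontr)
    assume "P \<noteq> {}"
    then obtain x where "x \<in> P" by blast
    then have "set [x] \<subseteq> P \<and> sorted_wrt lt [x] \<and> length [x] = Suc 0" by simp
    then show False using 0 by blast
  qed
  then show ?case by simp
next
  case (Suc q)
  let ?P = "{x\<in>P. \<exists>y\<in>P. lt y x}"
  have "\<not> (\<exists>xs. set xs \<subseteq> ?P \<and> sorted_wrt lt xs \<and> length xs = Suc q)"
  proof
    assume "\<exists>xs. set xs \<subseteq> ?P \<and> sorted_wrt lt xs \<and> length xs = Suc q"
    then obtain xs where xs: "set xs \<subseteq> ?P" "sorted_wrt lt xs" "length xs = Suc q" by blast
    then obtain x ys where x: "xs = x # ys" by (cases xs) auto
    then obtain y where y: "y \<in> P" "lt y x" using xs by auto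
    have "sorted_wrt lt (y # xs)" using xs x y trans by auto
    moreover have "set (y # xs) \<subseteq> P" "length (y # xs) = Suc (Suc q)" using xs y by auto
    ultimately show False using Suc.prems by blast
  qed
  from Suc.IH[OF this] obtain f
    where f: "\<forall>x\<in>?P. f x < q" "\<forall>x\<in>?P. \<forall>y\<in>?P. lt x y \<longrightarrow> f x \<noteq> f y" by blast
  let ?f = "\<lambda>x. if x \<in> ?P then f x else q"
  have "?f x < Suc q" if "x \<in> P" for x using f(1) by (cases "x \<in> ?P") (auto simp: less_Suc_eq)
  moreover have "?f x \<noteq> ?f y" if xy: "x \<in> P" "y \<in> P" "lt x y" for x y
  proof -
    have y: "y \<in> ?P" using xy by blast
    then have "f y < q" using f(1) by blast
    then show ?thesis using f(2) xy y by (cases "x \<in> ?P") auto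
  qed
  ultimately show ?case by (intro exI[of _ ?f]) blast
qed

lemma finite_sets_separated:
  fixes L U :: "real set"
  assumes "finite L" "finite U" "\<And>l u. l \<in> L \<Longrightarrow> u \<in> U \<Longrightarrow> l \<le> u"
  shows "\<exists>x. (\<forall>l\<in>L. l \<le> x) \<and> (\<forall>u\<in>U. x \<le> u)"
proof (cases "L = {}")
  case True
  then show ?thesis using assms by (intro exI[of _ "Min U"]) auto
next
  case False
  then show ?thesis using assms by (intro exI[of _ "Max L"]) auto
qed

text \<open>The potentials of the dual transportation problem whose optimal support contains the
  antichain; the row differences of a Monge array increase along the columns.\<close>

lemma monge_potentials:
  fixes w :: "nat \<Rightarrow> nat \<Rightarrow> real" and rho :: "nat \<Rightarrow> nat"
  assumes "m > 0"
    and monge: "\<And>k j j'. Suc k < m \<Longrightarrow> j \<in> W \<Longrightarrow> j' \<in> W \<Longrightarrow> rho j \<le> rho j' \<Longrightarrow>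
      w (Suc k) j - w k j \<le> w (Suc k) j' - w k j'"
    and fin: "finite A" and A: "A \<subseteq> {..<m} \<times> W"
    and anti: "\<And>k j k' j'. (k, j) \<in> A \<Longrightarrow> (k', j') \<in> A \<Longrightarrow> k < k' \<Longrightarrow> rho j' \<le> rho j"
  shows "\<exists>al be. (\<forall>k<m. \<forall>j. al k + be j \<le> w k j) \<and> (\<forall>(k, j)\<in>A. al k + be j = w k j)"
proof -
  define d where "d k j = w (Suc k) j - w k j" for k j
  \<comment> \<open>The increment \<open>de k\<close> of the row potential has to separate the
    slopes at antichain columns from rows after \<open>k\<close> (below) from those from rows up to
    \<open>k\<close> (above). Along the antichain \<open>rho\<close> does not increase with the row,
    so the Monge condition leaves room between the two sets.\<close>
  let ?L = "\<lambda>k. {d k j | i j. (i, j) \<in> A \<and> k < i}" and ?U = "\<lambda>k. {d k j | i j. (i, j) \<in> A \<and> i \<le> k}"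
  have sep: "\<exists>x. (\<forall>l\<in>?L k. l \<le> x) \<and> (\<forall>u\<in>?U k. x \<le> u)" if k: "Suc k < m" for k
  proof (rule finite_sets_separated)
    have "?L k \<subseteq> (\<lambda>(i, j). d k j) ` A" "?U k \<subseteq> (\<lambda>(i, j). d k j) ` A" by force+
    then show "finite (?L k)" "finite (?U k)" using fin finite_surj by blast+
    fix l u assume "l \<in> ?L k" "u \<in> ?U k"
    then obtain i j i' j' where ij: "(i, j) \<in> A" "k < i" "l = d k j" "(i', j') \<in> A" "i' \<le> k" "u = d k j'"
      by blast
    then have "rho j \<le> rho j'" using anti[of i' j' i j] by auto
    then show "l \<le> u" using monge[OF k, of j j'] ij A by (auto simp: d_def)
  qed
  have "\<exists>de. \<forall>k. Suc k < m \<longrightarrow> (\<forall>l\<in>?L k. l \<le> de k) \<and> (\<forall>u\<in>?U k. de k \<le> u)"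
    using sep by (intro choice) blast
  then obtain de where de: "\<And>k. Suc k < m \<Longrightarrow> (\<forall>l\<in>?L k. l \<le> de k) \<and> (\<forall>u\<in>?U k. de k \<le> u)"
    by blast
  define al where "al k = (\<Sum>l<k. de l)" for k
  define be where "be j = Min ((\<lambda>k. w k j - al k) ` {..<m})" for j
  have le: "al k + be j \<le> w k j" if "k < m" for k j
  proof -
    have "be j \<le> w k j - al k" unfolding be_def by (rule Min_le) (use that in auto)
    then show ?thesis by simp
  qed
  have eq: "al i + be j = w i j" if ij: "(i, j) \<in> A" for i j
  proof -
    \<comment> \<open>For fixed \<open>j\<close>, \<open>g\<close> is nonincreasing up to row
      \<open>i\<close> and nondecreasing from there on, by the choice of \<open>de\<close>. So the
      minimum that defines \<open>be j\<close> is attained at row \<open>i\<close>, which is the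
      required equality.\<close>
    define g where "g k = w k j - al k" for k
    have g: "g (Suc k) - g k = d k j - de k" for k by (simp add: g_def al_def d_def)
    have im: "i < m" using A ij by auto
    have up: "g i \<le> g k" if "i \<le> k" "k < m" for k
      using that
    proof (induction k rule: dec_induct)
      case (step k)
      have "d k j \<in> ?U k" using ij step by blast
      then have "de k \<le> d k j" using de[of k] step by blast
      then show ?case using g[of k] step by simp
    qed simp
    have down: "g i \<le> g k" if "k \<le> i" for k
      using that
    proof (induction k rule: inc_induct)
      case (step k)
      have "d k j \<in> ?L k" using ij step by blast
      then have "d k j \<le> de k" using de[of k] step im by auto
      then show ?case using g[of k] step by simp
    qed simp
    have "be j = g i" unfolding be_def
    proof (rule Min_eqI)
      fix y assume "y \<in> (\<lambda>k. w k j - al k) ` {..<m}"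
      then obtain k where "k < m" "y = g k" by (auto simp: g_def)
      then show "g i \<le> y" using up down by (cases "i \<le> k") auto
    qed (use im in \<open>auto simp: g_def\<close>)
    then show ?thesis by (simp add: g_def)
  qed
  show ?thesis using le eq by (intro exI[of _ al] exI[of _ be]) auto
qed

subsection \<open>Degrees in a group algebra over the reals\<close>

text \<open>The type \<open>real \<Rightarrow>\<^sub>0 'b\<close> is the ring of polynomials in one
  variable with real exponents. Real exponents are needed because the degree given to a variable is
  the logarithm of its weight.\<close>

definition deg_le :: "(real \<Rightarrow>\<^sub>0 'b::zero) \<Rightarrow> real \<Rightarrow> bool" where
  "deg_le z d \<longleftrightarrow> (\<forall>t\<in>keys z. t \<le> d)"

lemma deg_le_single: "t \<le> d \<Longrightarrow> deg_le (single t a) d"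
  by (auto simp: deg_le_def split: if_splits)

lemma deg_le_add: "deg_le x d \<Longrightarrow> deg_le y d \<Longrightarrow> deg_le (x + y :: real \<Rightarrow>\<^sub>0 'b::comm_ring_1) d"
  using Poly_Mapping.keys_add[of x y] by (auto simp: deg_le_def)

lemma deg_le_sum: "(\<And>i. i \<in> A \<Longrightarrow> deg_le (f i) d) \<Longrightarrow> deg_le (sum f A :: real \<Rightarrow>\<^sub>0 'b::comm_ring_1) d"
  by (induction A rule: infinite_finite_induct) (auto intro: deg_le_add simp: deg_le_def[of 0])

text \<open>The bounds need not be attained: the coefficient at the bound is multiplicative even
  where it vanishes.\<close>

lemma deg_le_mult:
  fixes x y :: "real \<Rightarrow>\<^sub>0 'b::comm_ring_1"
  assumes "deg_le x d" "deg_le y e"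
  shows "deg_le (x * y) (d + e)" "lookup (x * y) (d + e) = lookup x d * lookup y e"
proof -
  show "deg_le (x * y) (d + e)"
    unfolding deg_le_def
  proof
    fix t assume "t \<in> keys (x * y)"
    then obtain a b where "t = a + b" "a \<in> keys x" "b \<in> keys y" using Poly_Mapping.keys_mult[of x y] by blast
    then show "t \<le> d + e" using assms by (auto simp: deg_le_def intro: add_mono)
  qed
  let ?T = "keys x \<times> keys y"
  have xy: "x * y = (\<Sum>t\<in>?T. single (fst t + snd t) (lookup x (fst t) * lookup y (snd t)))"
    by (subst (1 2) sum_single_lookup[symmetric])
      (simp add: sum_product mult_single sum.cartesian_product case_prod_unfold)
  have "lookup (x * y) (d + e) = (\<Sum>t\<in>?T. if fst t + snd t = d + e then lookup x (fst t) * lookup y (snd t) else 0)"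
    by (auto simp: xy lookup_sum lookup_single when_def intro!: sum.cong)
  also have "\<dots> = (\<Sum>t\<in>?T. if t = (d, e) then lookup x (fst t) * lookup y (snd t) else 0)"
  proof (rule sum.cong[OF refl])
    fix t assume "t \<in> ?T"
    then have "fst t \<le> d" "snd t \<le> e" using assms by (auto simp: deg_le_def)
    then have "fst t + snd t = d + e \<longleftrightarrow> t = (d, e)" by (cases t) auto
    then show "(if fst t + snd t = d + e then lookup x (fst t) * lookup y (snd t) else 0) =
      (if t = (d, e) then lookup x (fst t) * lookup y (snd t) else 0)" by simp
  qed
  also have "\<dots> = lookup x d * lookup y e"
    by (subst sum.delta) (auto simp: in_keys_iff)
  finally show "lookup (x * y) (d + e) = lookup x d * lookup y e" .
qed

lemma deg_le_power:
  fixes x :: "real \<Rightarrow>\<^sub>0 'b::comm_ring_1"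
  assumes "deg_le x d"
  shows "deg_le (x ^ k) (real k * d) \<and> lookup (x ^ k) (real k * d) = lookup x d ^ k"
proof (induction k)
  case 0
  show ?case by (simp add: deg_le_def)
next
  case (Suc k)
  have "real (Suc k) * d = d + real k * d" by (simp add: algebra_simps)
  then show ?case using deg_le_mult[OF assms, of "x ^ k" "real k * d"] Suc by simp
qed

lemma deg_le_prod:
  fixes f :: "'i \<Rightarrow> real \<Rightarrow>\<^sub>0 'b::comm_ring_1"
  assumes "finite A" "\<And>i. i \<in> A \<Longrightarrow> deg_le (f i) (d i)"
  shows "deg_le (prod f A) (sum d A) \<and> lookup (prod f A) (sum d A) = (\<Prod>i\<in>A. lookup (f i) (d i))"
  using assms
proof (induction A rule: finite_induct)
  case empty
  show ?case by (simp add: deg_le_def)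
next
  case (insert i A)
  then show ?case using deg_le_mult[of "f i" "d i" "prod f A" "sum d A"] by simp
qed

context prime_weights
begin

lemma ln_N: "ln (real (N u)) = (\<Sum>c\<in>keys u. real (lookup u c) * ln (real (bb c)))"
  unfolding mono_val_def of_nat_prod of_nat_power by (subst ln_prod) (auto simp: ln_realpow)

lemma deg_le_mono_val:
  fixes f :: "'v \<Rightarrow> real \<Rightarrow>\<^sub>0 'b::idom"
  assumes "\<And>c. deg_le (f c) (ln (real (bb c)))"
  shows "deg_le (mono_val f u) (ln (real (N u)))"
    and "(\<And>c. c \<in> keys u \<Longrightarrow> lookup (f c) (ln (real (bb c))) \<noteq> 0) \<Longrightarrow>
      lookup (mono_val f u) (ln (real (N u))) \<noteq> 0"
proof -
  have *: "deg_le (mono_val f u) (ln (real (N u))) \<and> lookup (mono_val f u) (ln (real (N u))) =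
      (\<Prod>c\<in>keys u. lookup (f c ^ lookup u c) (real (lookup u c) * ln (real (bb c))))"
    unfolding ln_N unfolding mono_val_def
    by (rule deg_le_prod) (use deg_le_power[OF assms] in auto)
  then show "deg_le (mono_val f u) (ln (real (N u)))" by simp
  assume "\<And>c. c \<in> keys u \<Longrightarrow> lookup (f c) (ln (real (bb c))) \<noteq> 0"
  then show "lookup (mono_val f u) (ln (real (N u))) \<noteq> 0"
    using * deg_le_power[OF assms] by simp
qed

text \<open>The image of a monomial has degree at most the logarithm of its value, so only the
  leading monomial can reach \<open>ln (N u)\<close>. Its top coefficient is a product of nonzero
  elements of a domain, and nothing cancels it.\<close>

lemma subst_poly_nonzero_by_degree:
  fixes f :: "'v \<Rightarrow> real \<Rightarrow>\<^sub>0 'b::idom" and p :: "('v \<Rightarrow>\<^sub>0 nat) \<Rightarrow>\<^sub>0 'a::comm_ring_1"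
  assumes h: "\<And>a. a \<noteq> 0 \<Longrightarrow> h a \<noteq> 0"
    and deg: "\<And>c. deg_le (f c) (ln (real (bb c)))"
    and lead: "Lead p u" and top: "\<And>c. c \<in> keys u \<Longrightarrow> lookup (f c) (ln (real (bb c))) \<noteq> 0"
  shows "subst_poly (\<lambda>a. single 0 (h a)) f p \<noteq> 0"
proof -
  let ?d = "ln (real (N u))"
  have u: "u \<in> keys p" using lead by (simp add: Lead_def in_keys_iff)
  have coeff: "lookup (single 0 (h a) * mono_val f v) ?d = h a * lookup (mono_val f v) ?d" for a v
  proof -
    have "lookup (single 0 (h a) * z) ?d = h a * lookup z ?d" for z
      unfolding mult_map_scale_conv_mult[symmetric] by (simp add: Poly_Mapping.map.rep_eq when_def)
    then show ?thesis .
  qed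
  have other: "lookup (mono_val f v) ?d = 0" if "v \<in> keys p" "v \<noteq> u" for v
  proof (rule ccontr)
    assume "\<not> ?thesis"
    then have "?d \<in> keys (mono_val f v)" by (simp add: in_keys_iff)
    then have "?d \<le> ln (real (N v))" using deg_le_mono_val(1)[OF deg] by (auto simp: deg_le_def)
    then have "N u \<le> N v" by simp
    moreover have "N v < N u" using lead that by (simp add: Lead_def)
    ultimately show False by simp
  qed
  have "lookup (subst_poly (\<lambda>a. single 0 (h a)) f p) ?d = (\<Sum>v\<in>keys p. h (lookup p v) * lookup (mono_val f v) ?d)"
    by (simp add: subst_poly_def lookup_sum coeff)
  also have "\<dots> = (\<Sum>v\<in>{u}. h (lookup p v) * lookup (mono_val f v) ?d)"
    by (rule sum.mono_neutral_right) (use u other in auto)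
  also have "\<dots> = h (lookup p u) * lookup (mono_val f u) ?d" by simp
  finally have "lookup (subst_poly (\<lambda>a. single 0 (h a)) f p) ?d \<noteq> 0"
    using h lead deg_le_mono_val(2)[OF deg top] by (simp add: Lead_def)
  then show ?thesis by auto
qed

end

subsection \<open>Maximal minors of one generic matrix\<close>

text \<open>If the support of a monomial contains no increasing chain of length \<open>m\<close>, it is covered by
  \<open>m - 1\<close> antichains; a sum of \<open>m - 1\<close> rank one matrices with exponents given by their potentials
  kills all maximal minors, but not a polynomial whose leading monomial is the given one.\<close>

lemma Lead_minors:
  fixes p :: "'a::field mpoly" and rho :: "nat \<Rightarrow> nat" and bb :: "nat \<times> nat \<Rightarrow> nat"
  assumes bb: "prime_weights bb" and m: "m > 0" and inj: "inj_on rho W"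
    and monge: "\<And>k k' j j'. k < k' \<Longrightarrow> k' < m \<Longrightarrow> j \<in> W \<Longrightarrow> j' \<in> W \<Longrightarrow> rho j < rho j' \<Longrightarrow>
      bb (k, j') * bb (k', j) < bb (k, j) * bb (k', j')"
    and p: "p \<in> idl (minors m W)" and lead: "prime_weights.Lead bb p u"
  shows "\<exists>c. (\<forall>i<m. c i \<in> W) \<and> (\<forall>i j. i < j \<longrightarrow> j < m \<longrightarrow> rho (c i) < rho (c j)) \<and>
    (\<exists>v. u = diag m id c + v)"
proof -
  interpret prime_weights bb by (rule bb)
  define P where "P = {x \<in> keys u. fst x < m \<and> snd x \<in> W}"
  define lt where "lt x y \<longleftrightarrow> fst x < fst y \<and> rho (snd x) < rho (snd y)" for x y :: "nat \<times> nat"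
  have finP: "finite P" by (simp add: P_def)
  show ?thesis
  proof (cases "\<exists>xs. set xs \<subseteq> P \<and> sorted_wrt lt xs \<and> length xs = Suc (m - 1)")
    case True
    then obtain xs where xs: "set xs \<subseteq> P" "sorted_wrt lt xs" "length xs = m" using m by auto
    have nth: "xs ! i \<in> P" if "i < m" for i using xs that by (metis nth_mem subsetD)
    have lt: "lt (xs ! i) (xs ! j)" if "i < j" "j < m" for i j
      using sorted_wrt_nth_less[OF xs(2)] xs(3) that by simp
    have ge: "i \<le> fst (xs ! i)" if "i < m" for i
      using that
    proof (induction i)
      case (Suc i)
      then show ?case using lt[of i "Suc i"] by (auto simp: lt_def)
    qed simp
    have le: "fst (xs ! i) + (m - i) \<le> m" if "i < m" for i
    proof -
      have "fst (xs ! (m - Suc k)) + Suc k \<le> m" if "k < m" for k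
        using that
      proof (induction k)
        case 0
        then show ?case using nth[of "m - 1"] by (auto simp: P_def)
      next
        case (Suc k)
        have "lt (xs ! (m - Suc (Suc k))) (xs ! (m - Suc k))" using Suc.prems by (intro lt) auto
        then show ?case using Suc by (auto simp: lt_def)
      qed
      from this[of "m - Suc i"] show ?thesis using that by (simp add: Suc_diff_Suc)
    qed
    \<comment> \<open>A strictly increasing sequence of \<open>m\<close> rows among \<open>m\<close>
      rows runs through all of them, so the chain is a full diagonal.\<close>
    have row: "fst (xs ! i) = i" if "i < m" for i using ge[OF that] le[OF that] that by linarith
    define c where "c i = snd (xs ! i)" for i
    have xs_c: "xs ! i = (i, c i)" if "i < m" for i using row[OF that] by (simp add: c_def prod_eq_iff)
    have c: "\<forall>i<m. c i \<in> W" using nth xs_c by (fastforce simp: P_def)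
    moreover have "\<forall>i j. i < j \<longrightarrow> j < m \<longrightarrow> rho (c i) < rho (c j)" using lt by (auto simp: lt_def c_def)
    moreover have "u = diag m id c + (u - diag m id c)"
    proof (rule poly_mapping_eqI)
      fix x
      have "lookup (diag m id c) x \<le> lookup u x"
      proof -
        have "lookup (diag m id c) x = (\<Sum>i<m. if (i, c i) = x then 1 else 0)"
          by (auto simp: diag_def lookup_sum lookup_single when_def intro!: sum.cong)
        also have "\<dots> = (\<Sum>i\<in>{i. i < m \<and> (i, c i) = x}. 1)"
          by (rule sum.mono_neutral_cong_right) auto
        also have "\<dots> = card {i. i < m \<and> (i, c i) = x}" by simp
        also have "\<dots> \<le> lookup u x"
        proof (cases "\<exists>i<m. (i, c i) = x")
          case True
          then obtain i where i: "i < m" "x = (i, c i)" by blast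
          have "{i. i < m \<and> (i, c i) = x} \<subseteq> {i}" using i by auto
          then have "card {i. i < m \<and> (i, c i) = x} \<le> card {i}" by (intro card_mono) auto
          also have "\<dots> = 1" by simp
          also have "1 \<le> lookup u x"
            using nth[OF i(1)] xs_c[OF i(1)] i by (auto simp: P_def in_keys_iff Suc_le_eq)
          finally show ?thesis .
        next
          case False
          then have "{i. i < m \<and> (i, c i) = x} = {}" by blast
          then show ?thesis by (simp only: card.empty)
        qed
        finally show ?thesis .
      qed
      then show "lookup u x = lookup (diag m id c + (u - diag m id c)) x"
        by (simp add: lookup_add lookup_minus)
    qed
    ultimately show ?thesis by blast
  next
    case False
    have trans: "lt x z" if "lt x y" "lt y z" for x y z using that by (auto simp: lt_def)
    obtain f where f: "\<forall>x\<in>P. f x < m - 1" "\<forall>x\<in>P. \<forall>y\<in>P. lt x y \<longrightarrow> f x \<noteq> f y"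
      using antichain_coloring[of lt P "m - 1"] trans False by blast
    define w where "w k j = ln (real (bb (k, j)))" for k j
    have monge': "w (Suc k) j - w k j \<le> w (Suc k) j' - w k j'"
      if "Suc k < m" "j \<in> W" "j' \<in> W" "rho j \<le> rho j'" for k j j'
    proof (cases "rho j = rho j'")
      case True
      then have "j = j'" using inj that by (auto simp: inj_on_def)
      then show ?thesis by simp
    next
      case neq: False
      then have "bb (k, j') * bb (Suc k, j) < bb (k, j) * bb (Suc k, j')"
        using monge[of k "Suc k" j j'] that by auto
      then have "real (bb (k, j') * bb (Suc k, j)) \<le> real (bb (k, j) * bb (Suc k, j'))"
        by (simp only: of_nat_le_iff)
      then have "ln (real (bb (k, j')) * real (bb (Suc k, j))) \<le> ln (real (bb (k, j)) * real (bb (Suc k, j')))"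
        by simp
      then show ?thesis by (simp add: w_def ln_mult)
    qed
    have "\<exists>al be. (\<forall>k<m. \<forall>j. al k + be j \<le> w k j) \<and> (\<forall>(k, j)\<in>{x\<in>P. f x = q}. al k + be j = w k j)" for q
    proof (rule monge_potentials[where rho = rho and W = W])
      show "0 < m" by (rule m)
      show "finite {x\<in>P. f x = q}" using finP by simp
      show "{x\<in>P. f x = q} \<subseteq> {..<m} \<times> W" by (auto simp: P_def)
      show "w (Suc k) j - w k j \<le> w (Suc k) j' - w k j'"
        if "Suc k < m" "j \<in> W" "j' \<in> W" "rho j \<le> rho j'" for k j j' using monge' that .
      show "rho j' \<le> rho j" if "(k, j) \<in> {x\<in>P. f x = q}" "(k', j') \<in> {x\<in>P. f x = q}" "k < k'" for k j k' j'
      proof (rule ccontr)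
        assume "\<not> ?thesis"
        then have "lt (k, j) (k', j')" using that by (simp add: lt_def)
        then show False using f(2)[rule_format, of "(k, j)" "(k', j')"] that by auto
      qed
    qed
    then have "\<forall>q. \<exists>ab. (\<forall>k<m. \<forall>j. fst ab k + snd ab j \<le> w k j) \<and>
        (\<forall>(k, j)\<in>{x\<in>P. f x = q}. fst ab k + snd ab j = w k j)" by simp
    from choice[OF this] obtain ab where ab: "\<And>q k j. k < m \<Longrightarrow> fst (ab q) k + snd (ab q) j \<le> w k j"
      "\<And>q k j. (k, j) \<in> P \<Longrightarrow> f (k, j) = q \<Longrightarrow> fst (ab q) k + snd (ab q) j = w k j" by fastforce
    define al where "al q = fst (ab q)" for q
    define be where "be q = snd (ab q)" for q
    \<comment> \<open>Colour \<open>q\<close> is marked by the power \<open>q\<close> of the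
      variable of \<open>'a poly\<close>. If several colours reach the degree
      \<open>ln (bb x)\<close> at an entry, their contributions are therefore independent and cannot
      cancel.\<close>
    define Y where "Y k q = single (al q k) (Polynomial.monom (1::'a) q)" for k q
    define Z where "Z q j = single (be q j) (1::'a poly)" for q j
    define phi where "phi x = (if fst x < m \<and> snd x \<in> W then \<Sum>q<m - 1. Y (fst x) q * Z q (snd x)
       else single (ln (real (bb x))) 1)" for x
    have YZ: "Y k q * Z q j = single (al q k + be q j) (Polynomial.monom 1 q)" for k q j
      by (simp add: Y_def Z_def mult_single)
    have deg: "deg_le (phi x) (ln (real (bb x)))" for x
    proof (cases "fst x < m \<and> snd x \<in> W")
      case True
      then have "al q (fst x) + be q (snd x) \<le> ln (real (bb x))" for q
        using ab(1)[of "fst x" q "snd x"] by (simp add: w_def al_def be_def)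
      then show ?thesis using True
        by (auto simp: phi_def YZ intro!: deg_le_sum deg_le_single)
    next
      case False
      then show ?thesis unfolding phi_def by (simp only: if_False deg_le_single)
    qed
    have top: "lookup (phi x) (ln (real (bb x))) \<noteq> 0" if x: "x \<in> keys u" for x
    proof (cases "fst x < m \<and> snd x \<in> W")
      case True
      then have xP: "x \<in> P" using x by (simp add: P_def)
      let ?e = "\<lambda>q. al q (fst x) + be q (snd x) = ln (real (bb x))"
      have fx: "?e (f x)" "f x < m - 1"
        using ab(2)[of "fst x" "snd x" "f x"] xP f(1) by (auto simp: w_def al_def be_def)
      have "lookup (phi x) (ln (real (bb x))) = (\<Sum>q<m - 1. if ?e q then Polynomial.monom 1 q else 0)"
        using True by (auto simp: phi_def YZ lookup_sum lookup_single when_def intro!: sum.cong)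
      then have "coeff (lookup (phi x) (ln (real (bb x)))) (f x) =
          (\<Sum>q<m - 1. if q = f x then (if ?e q then 1 else 0) else 0)"
        by (simp only: coeff_sum) (rule sum.cong, auto)
      also have "\<dots> = 1" using fx by simp
      finally show ?thesis by auto
    next
      case False
      then show ?thesis unfolding phi_def by (simp only: if_False lookup_single_eq) simp
    qed
    interpret h: comm_ring_hom "\<lambda>a::'a. single (0::real) [:a:]"
      by standard (simp_all add: single_add[symmetric] mult_single one_pCons[symmetric] mult.commute)
    let ?psi = "subst_poly (\<lambda>a::'a. single (0::real) [:a:]) phi"
    interpret psi: comm_ring_hom ?psi by (rule h.comm_ring_hom_subst_poly)
    have "is_ideal {q. ?psi q = 0}"
      by (auto simp: is_ideal_def psi.hom_add psi.hom_mult)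
    moreover have "minors m W \<subseteq> {q. ?psi q = 0}"
    proof
      fix q :: "'a mpoly" assume "q \<in> minors m W"
      then obtain F where F: "F \<subseteq> W" "card F = m" "q = minor m F" by (auto simp: minors_def)
      have finF: "finite F" by (rule card_ge_0_finite) (simp add: F m)
      let ?c = "\<lambda>j. sorted_list_of_set F ! j"
      have c: "?c j \<in> W" if "j < m" for j
        using F finF that by (metis length_sorted_list_of_set nth_mem set_sorted_list_of_set subsetD)
      have "?psi q = det (map_mat ?psi (mat m m (\<lambda>(i, j). X (id i, ?c j))))"
        by (simp only: F(3) minor_eq_gen_det gen_det_def psi.hom_det)
      also have "map_mat ?psi (mat m m (\<lambda>(i, j). X (id i, ?c j))) =
          mat m m (\<lambda>(i, j). \<Sum>q<m - 1. Y i q * Z q (?c j))"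
        by (rule eq_matI) (use c in \<open>auto simp: h.subst_poly_single phi_def one_pCons[symmetric]\<close>)
      also have "det \<dots> = 0" by (rule det_low_rank[OF m])
      finally show "q \<in> {q. ?psi q = 0}" by simp
    qed
    ultimately have "?psi p = 0" using idl_least p by blast
    moreover have "?psi p \<noteq> 0"
      by (rule subst_poly_nonzero_by_degree[where h = "\<lambda>a. [:a:]", OF _ deg lead top]) auto
    ultimately show ?thesis by simp
  qed
qed

subsection \<open>Cyclic families\<close>

text \<open>The clause \<open>inj_on s {..<r}\<close> carries condition (ii): for
  \<open>r = 3\<close> all cliques are adjacent, and it alone excludes a column common to the
  three.\<close>

definition cyclic_family :: "nat \<Rightarrow> (nat \<Rightarrow> nat set) \<Rightarrow> (nat \<Rightarrow> nat) \<Rightarrow> bool" where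
  "cyclic_family r W s \<longleftrightarrow> r \<ge> 3 \<and> (\<forall>i<r. finite (W i)) \<and> (\<forall>i<r. W i \<inter> W (Suc i mod r) = {s i}) \<and>
     (\<forall>i<r. \<forall>j<r. i \<noteq> j \<longrightarrow> j \<noteq> Suc i mod r \<longrightarrow> i \<noteq> Suc j mod r \<longrightarrow> W i \<inter> W j = {}) \<and>
     inj_on s {..<r}"

lemma cyclic_family_shared:
  assumes "cyclic_family r W s" "i < r" "j < r" "i \<noteq> j" "v \<in> W i" "v \<in> W j"
  shows "(v = s i \<and> j = Suc i mod r) \<or> (v = s j \<and> i = Suc j mod r)"
proof -
  have adj: "j = Suc i mod r \<or> i = Suc j mod r" and int: "W i \<inter> W (Suc i mod r) = {s i}" "W j \<inter> W (Suc j mod r) = {s j}"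
    using assms unfolding cyclic_family_def by blast+
  show ?thesis using adj
  proof
    assume "j = Suc i mod r"
    then show ?thesis using int(1) assms by auto
  next
    assume "i = Suc j mod r"
    then show ?thesis using int(2) assms by auto
  qed
qed

lemma cyclic_family_s:
  assumes "cyclic_family r W s" "i < r"
  shows "s i \<in> W i" "s i \<in> W (Suc i mod r)"
  using assms unfolding cyclic_family_def by blast+

lemma cyclic_family_s_mem:
  assumes C: "cyclic_family r W s" and ij: "i < r" "j < r" "s i \<in> W j"
  shows "j = i \<or> j = Suc i mod r"
proof (rule ccontr)
  assume *: "\<not> ?thesis"
  then have "s i = s j" using cyclic_family_shared[OF C ij(1,2) _ cyclic_family_s(1)[OF C ij(1)] ij(3)] by auto
  then show False using C ij * by (auto simp: cyclic_family_def inj_on_def)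
qed

lemma cyclic_family_s_eq: "cyclic_family r W s \<Longrightarrow> i < r \<Longrightarrow> j < r \<Longrightarrow> s i = s j \<longleftrightarrow> i = j"
  by (auto simp: cyclic_family_def inj_on_def)

text \<open>Lets any clique take the index 0, the place that the column orders treat
  specially.\<close>

lemma cyclic_family_rotate:
  assumes C: "cyclic_family r W s"
  shows "cyclic_family r (\<lambda>l. W ((a + l) mod r)) (\<lambda>l. s ((a + l) mod r))"
proof -
  have r: "r \<ge> 3" using C by (simp add: cyclic_family_def)
  have inj: "(a + l) mod r = (a + l') mod r \<longleftrightarrow> l = l'" if "l < r" "l' < r" for l l'
  proof -
    have "(a + l) mod r = (a + l') mod r \<longleftrightarrow> [l = l'] (mod r)"
      using cong_add_lcancel_nat[of a l l' r] by (simp add: cong_def)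
    also have "\<dots> \<longleftrightarrow> l = l'" using that by (simp add: cong_def)
    finally show ?thesis .
  qed
  have succ: "(a + Suc l mod r) mod r = Suc ((a + l) mod r) mod r" for l
    by (simp add: mod_simps)
  have lt: "(a + l) mod r < r" for l using r by simp
  show ?thesis
    unfolding cyclic_family_def succ
  proof (intro conjI allI impI)
    fix l l' assume l: "l < r" "l' < r" "l \<noteq> l'" "l' \<noteq> Suc l mod r" "l \<noteq> Suc l' mod r"
    have "Suc l mod r < r" "Suc l' mod r < r" using r by auto
    then have "(a + l') mod r \<noteq> Suc ((a + l) mod r) mod r" "(a + l) mod r \<noteq> Suc ((a + l') mod r) mod r"
      using l unfolding succ[symmetric] by (simp_all add: inj)
    moreover have "(a + l) mod r \<noteq> (a + l') mod r" using l by (simp add: inj)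
    ultimately show "W ((a + l) mod r) \<inter> W ((a + l') mod r) = {}"
      using C lt unfolding cyclic_family_def by blast
  next
    show "inj_on (\<lambda>l. s ((a + l) mod r)) {..<r}"
      by (rule inj_onI) (use cyclic_family_s_eq[OF C lt lt] inj in auto)
  qed (use C r lt in \<open>auto simp: cyclic_family_def\<close>)
qed

text \<open>Going around the cycle from \<open>W 0\<close>, the shared columns descend from \<open>W 1\<close> on; the conflict this
  forces is placed in \<open>W 0\<close>, where they come last, and in \<open>W 1\<close>, where they come first.\<close>

lemma cyclic_column_order:
  assumes C: "cyclic_family r W s"
    and E: "\<And>x. x \<in> E \<Longrightarrow> x \<in> W 0" "\<And>x j. x \<in> E \<Longrightarrow> 0 < j \<Longrightarrow> j < r \<Longrightarrow> x \<notin> W j"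
  obtains rho :: "nat \<Rightarrow> nat" where "inj_on rho (\<Union>i<r. W i)"
    "\<And>e x. e \<in> E \<Longrightarrow> x \<in> W 0 - E \<Longrightarrow> rho e < rho x"
    "\<And>e e'. e \<in> E \<Longrightarrow> e' \<in> E \<Longrightarrow> e < e' \<Longrightarrow> rho e < rho e'"
    "\<And>x. x \<in> W 0 \<Longrightarrow> x \<noteq> s 0 \<Longrightarrow> rho x < rho (s 0)"
    "\<And>x. x \<in> W 0 \<Longrightarrow> x \<noteq> s 0 \<Longrightarrow> x \<noteq> s (r - 1) \<Longrightarrow> rho x < rho (s (r - 1))"
    "\<And>x. x \<in> W 1 \<Longrightarrow> x \<noteq> s 0 \<Longrightarrow> rho (s 0) < rho x"
    "\<And>x. x \<in> W 1 \<Longrightarrow> x \<noteq> s 0 \<Longrightarrow> x \<noteq> s 1 \<Longrightarrow> rho (s 1) < rho x"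
    "\<And>i x. 2 \<le> i \<Longrightarrow> i < r \<Longrightarrow> x \<in> W i \<Longrightarrow> x \<noteq> s i \<Longrightarrow> rho (s i) < rho x"
    "\<And>i x. 2 \<le> i \<Longrightarrow> i < r \<Longrightarrow> x \<in> W i \<Longrightarrow> x \<noteq> s (i - 1) \<Longrightarrow> rho x < rho (s (i - 1))"
proof -
  have r: "r \<ge> 3" using C by (simp add: cyclic_family_def)
  have fin: "finite (\<Union>i<r. W i)" using C by (auto simp: cyclic_family_def)
  note seq = cyclic_family_s_eq[OF C]
  define L where "L v = (LEAST i. v \<in> W i)" for v
  \<comment> \<open>For \<open>0 < i\<close> the column \<open>s i\<close> gets
    \<open>2 * (r - i)\<close> and the private columns of \<open>W i\<close> get one more, so for
    \<open>2 \<le> i\<close> the order in \<open>W i\<close> is \<open>s i\<close>, private columns,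
    \<open>s (i - 1)\<close>. The value 2 of \<open>s (r - 1)\<close> fits this pattern. In
    \<open>W 0\<close> the order is \<open>E\<close>, other private columns,
    \<open>s (r - 1)\<close>, \<open>s 0\<close>. The value 3 of \<open>s 0\<close> is below all
    other values in \<open>W 1\<close>, which are at least
    \<open>2 * (r - 1) \<ge> 4\<close>.\<close>
  define blk where "blk v = (if v \<in> E then 0 else if v = s 0 then 3 else if v = s (r - 1) then 2 else
     if L v = 0 then 1 else if v = s (L v) then 2 * (r - L v) else Suc (2 * (r - L v)))" for v
  have smod: "Suc i mod r = Suc i" if "i < r - 1" for i using that by simp
  have slast: "Suc (r - 1) mod r = 0" using r by simp
  have sE: "s i \<notin> E" if "i < r" for i
  proof
    assume sE: "s i \<in> E"
    show False
    proof (cases "i = 0")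
      case True
      then have "s i \<in> W 1" using cyclic_family_s(2)[OF C, of 0] r by simp
      then show False using E(2)[OF sE, of 1] r by simp
    next
      case False
      then show False using E(2)[OF sE, of i] that cyclic_family_s(1)[OF C that] by simp
    qed
  qed
  have Lle: "L v \<le> i" "v \<in> W (L v)" if "v \<in> W i" for v i
    using that unfolding L_def by (auto intro: Least_le LeastI)
  have L: "L v = i \<or> (v = s (i - 1) \<and> L v = i - 1)" if v: "v \<in> W i" "i < r" "v \<noteq> s (r - 1)" for v i
  proof (rule ccontr)
    assume *: "\<not> ?thesis"
    then have lt: "L v < i" using Lle[OF v(1)] by simp
    from cyclic_family_shared[OF C _ v(2) _ Lle(2)[OF v(1)] v(1)] lt v(2)
    have "(v = s (L v) \<and> i = Suc (L v) mod r) \<or> (v = s i \<and> L v = Suc i mod r)" by auto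
    then show False
    proof
      assume "v = s (L v) \<and> i = Suc (L v) mod r"
      then show False using * lt v(2) by auto
    next
      assume a: "v = s i \<and> L v = Suc i mod r"
      show False
      proof (cases "i < r - 1")
        case True
        then show False using a lt smod by auto
      next
        case False
        then have "i = r - 1" using v(2) by simp
        then show False using a v(3) by simp
      qed
    qed
  qed
  have blkE: "blk e = 0" if "e \<in> E" for e using that by (simp add: blk_def)
  have blk_s0: "blk (s 0) = 3" using sE[of 0] r by (simp add: blk_def)
  have blk_sr: "blk (s (r - 1)) = 2" using sE[of "r - 1"] r seq[of 0 "r - 1"] by (simp add: blk_def)
  have blk_s: "blk (s i) = 2 * (r - i)" if i: "0 < i" "i < r" for i
  proof (cases "i = r - 1")
    case True
    then show ?thesis using blk_sr r by simp
  next
    case False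
    have ne: "s i \<noteq> s 0" "s i \<noteq> s (r - 1)" "s i \<noteq> s (i - 1)" using seq i r False by auto
    then have "L (s i) = i" using L[OF cyclic_family_s(1)[OF C i(2)] i(2)] by blast
    then show ?thesis using ne sE[OF i(2)] i by (simp add: blk_def)
  qed
  have blk0: "blk v \<le> 1" if v: "v \<in> W 0" "v \<noteq> s 0" "v \<noteq> s (r - 1)" for v
  proof -
    have "L v = 0" using Lle(1)[OF v(1)] by simp
    then show ?thesis using v by (simp add: blk_def)
  qed
  have blk0': "blk v \<ge> 1" if v: "v \<in> W 0" "v \<notin> E" for v
  proof -
    have "L v = 0" using Lle(1)[OF v(1)] by simp
    then show ?thesis using v by (simp add: blk_def)
  qed
  have blki: "blk v = Suc (2 * (r - i))" if i: "0 < i" "i < r" and v: "v \<in> W i" "v \<noteq> s i" "v \<noteq> s (i - 1)" for v i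
  proof -
    have vE: "v \<notin> E" using E(2)[of v i] i v by auto
    have "v \<noteq> s 0"
    proof
      assume "v = s 0"
      then have "i = 0 \<or> i = 1" using cyclic_family_s_mem[OF C _ i(2), of 0] v r by auto
      then show False using i v \<open>v = s 0\<close> by auto
    qed
    moreover have "v \<noteq> s (r - 1)"
    proof
      assume "v = s (r - 1)"
      then have "i = r - 1 \<or> i = 0" using cyclic_family_s_mem[OF C _ i(2), of "r - 1"] v r slast by auto
      then show False using i v \<open>v = s (r - 1)\<close> by auto
    qed
    moreover then have "L v = i" using L[OF v(1) i(2)] v by blast
    ultimately show ?thesis using vE v i by (simp add: blk_def)
  qed
  define M where "M = Suc (Max (insert 0 (\<Union>i<r. W i)))"
  have M: "v < M" if "v \<in> (\<Union>i<r. W i)" for v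
    unfolding M_def less_Suc_eq_le by (rule Max_ge) (use fin that in auto)
  define rho where "rho v = blk v * M + v" for v
  have rho: "rho u < rho v" if "blk u < blk v" "u \<in> (\<Union>i<r. W i)" for u v
  proof -
    have "Suc (blk u) * M \<le> blk v * M" by (rule mult_right_mono) (use that in auto)
    then have "blk u * M + M \<le> blk v * M" by (simp add: add.commute)
    then show ?thesis using M[OF that(2)] unfolding rho_def by linarith
  qed
  have mem: "v \<in> (\<Union>i<r. W i)" if "v \<in> W i" "i < r" for v i using that by blast
  have smem: "s i \<in> (\<Union>i<r. W i)" if "i < r" for i using cyclic_family_s(1)[OF C that] that by blast
  have r0: "0 < r" "1 < r" "r - 1 < r" using r by auto
  show thesis
  proof (rule that[of rho])
    show "inj_on rho (\<Union>i<r. W i)"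
    proof (rule inj_onI)
      fix u v assume uv: "u \<in> (\<Union>i<r. W i)" "v \<in> (\<Union>i<r. W i)" "rho u = rho v"
      have "rho x mod M = x" if "x \<in> (\<Union>i<r. W i)" for x using M[OF that] by (simp add: rho_def)
      then show "u = v" using uv by metis
    qed
    show "rho e < rho x" if "e \<in> E" "x \<in> W 0 - E" for e x
      using blkE[OF that(1)] blk0'[of x] that mem[OF E(1)[OF that(1)] r0(1)] by (intro rho) auto
    show "rho e < rho e'" if "e \<in> E" "e' \<in> E" "e < e'" for e e'
      using that by (simp add: rho_def blkE)
    show "rho x < rho (s 0)" if "x \<in> W 0" "x \<noteq> s 0" for x
    proof (rule rho)
      show "blk x < blk (s 0)" using blk0[OF that] blk_s0 blk_sr by (cases "x = s (r - 1)") auto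
    qed (rule mem[OF that(1) r0(1)])
    show "rho x < rho (s (r - 1))" if "x \<in> W 0" "x \<noteq> s 0" "x \<noteq> s (r - 1)" for x
      using blk0[OF that] blk_sr by (intro rho mem[OF that(1) r0(1)]) simp
    show "rho (s 0) < rho x" if "x \<in> W 1" "x \<noteq> s 0" for x
    proof (rule rho)
      show "blk (s 0) < blk x"
        using blki[of 1 x] blk_s[of 1] that r blk_s0 by (cases "x = s 1") auto
    qed (rule smem[OF r0(1)])
    show "rho (s 1) < rho x" if "x \<in> W 1" "x \<noteq> s 0" "x \<noteq> s 1" for x
      using blki[of 1 x] blk_s[of 1] that r by (intro rho smem) auto
    show "rho (s i) < rho x" if i: "2 \<le> i" "i < r" "x \<in> W i" "x \<noteq> s i" for i x
    proof (rule rho)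
      show "blk (s i) < blk x"
        using blki[of i x] blk_s[of i] blk_s[of "i - 1"] i by (cases "x = s (i - 1)") auto
    qed (rule smem[OF i(2)])
    show "rho x < rho (s (i - 1))" if i: "2 \<le> i" "i < r" "x \<in> W i" "x \<noteq> s (i - 1)" for i x
    proof (rule rho)
      show "blk x < blk (s (i - 1))"
        using blki[of i x] blk_s[of i] blk_s[of "i - 1"] i by (cases "x = s i") auto
    qed (rule mem[OF i(3,2)])
  qed
qed

text \<open>A common variable would put a shared column at the same position \<open>k\<close> of
  both chains. But \<open>s 0\<close> must be last in \<open>W 0\<close> and first in
  \<open>W 1\<close>; \<open>s 1\<close> is at position at most 1 in \<open>W 1\<close> and last in
  \<open>W 2\<close>; \<open>s (r - 1)\<close> is first in \<open>W (r - 1)\<close> and at position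
  at least \<open>m - 2\<close> in \<open>W 0\<close>; the others are first in \<open>W i\<close>
  and last in the next clique. The two relaxed positions belong to different columns, so
  \<open>m \<ge> 3\<close> separates all pairs.\<close>

lemma cyclic_chains_disjoint:
  fixes c c' rho s :: "nat \<Rightarrow> nat" and m :: nat
  assumes C: "cyclic_family r W s" and m: "m \<ge> 3" and ab: "a < r" "b < r" "a \<noteq> b"
    and c: "\<And>i. i < m \<Longrightarrow> c i \<in> W a" "\<And>i j. i < j \<Longrightarrow> j < m \<Longrightarrow> rho (c i) < rho (c j)"
    and c': "\<And>i. i < m \<Longrightarrow> c' i \<in> W b" "\<And>i j. i < j \<Longrightarrow> j < m \<Longrightarrow> rho (c' i) < rho (c' j)"
    and k: "k < m" "c k = c' k"
    and order: "\<And>x. x \<in> W 0 \<Longrightarrow> x \<noteq> s 0 \<Longrightarrow> rho x < rho (s 0)"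
    "\<And>x. x \<in> W 0 \<Longrightarrow> x \<noteq> s 0 \<Longrightarrow> x \<noteq> s (r - 1) \<Longrightarrow> rho x < rho (s (r - 1))"
    "\<And>x. x \<in> W 1 \<Longrightarrow> x \<noteq> s 0 \<Longrightarrow> rho (s 0) < rho x"
    "\<And>x. x \<in> W 1 \<Longrightarrow> x \<noteq> s 0 \<Longrightarrow> x \<noteq> s 1 \<Longrightarrow> rho (s 1) < rho x"
    "\<And>i x. 2 \<le> i \<Longrightarrow> i < r \<Longrightarrow> x \<in> W i \<Longrightarrow> x \<noteq> s i \<Longrightarrow> rho (s i) < rho x"
    "\<And>i x. 2 \<le> i \<Longrightarrow> i < r \<Longrightarrow> x \<in> W i \<Longrightarrow> x \<noteq> s (i - 1) \<Longrightarrow> rho x < rho (s (i - 1))"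
  shows False
proof -
  have main: False
    if l: "l < r" and c: "\<And>i. i < m \<Longrightarrow> c i \<in> W l" "\<And>i j. i < j \<Longrightarrow> j < m \<Longrightarrow> rho (c i) < rho (c j)"
      and c': "\<And>i. i < m \<Longrightarrow> c' i \<in> W (Suc l mod r)" "\<And>i j. i < j \<Longrightarrow> j < m \<Longrightarrow> rho (c' i) < rho (c' j)"
      and k: "k < m" "c k = s l" "c' k = s l" for l k and c c' :: "nat \<Rightarrow> nat"
  proof -
    have first: "k = 0" if "\<And>i. i < m \<Longrightarrow> c i \<in> U" "\<And>i j. i < j \<Longrightarrow> j < m \<Longrightarrow> rho (c i) < rho (c j)" "c k = v"
      "\<And>x. x \<in> U \<Longrightarrow> x \<noteq> v \<Longrightarrow> rho v < rho x" for U v and c :: "nat \<Rightarrow> nat"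
    proof (rule ccontr)
      assume "k \<noteq> 0"
      then have "rho (c 0) < rho v" using that(2)[of 0 k] k(1) that(3) by simp
      moreover have "c 0 \<in> U" using that(1) m by simp
      ultimately show False using that(4)[of "c 0"] by force
    qed
    have last: "k = m - 1" if "\<And>i. i < m \<Longrightarrow> c i \<in> U" "\<And>i j. i < j \<Longrightarrow> j < m \<Longrightarrow> rho (c i) < rho (c j)" "c k = v"
      "\<And>x. x \<in> U \<Longrightarrow> x \<noteq> v \<Longrightarrow> rho x < rho v" for U v and c :: "nat \<Rightarrow> nat"
    proof (rule ccontr)
      assume "k \<noteq> m - 1"
      then have "rho v < rho (c (m - 1))" using that(2)[of k "m - 1"] k(1) that(3) by simp
      moreover have "c (m - 1) \<in> U" using that(1) m by simp
      ultimately show False using that(4)[of "c (m - 1)"] by force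
    qed
    have second: "k \<le> 1" if "\<And>i. i < m \<Longrightarrow> c i \<in> U" "\<And>i j. i < j \<Longrightarrow> j < m \<Longrightarrow> rho (c i) < rho (c j)" "c k = v"
      "\<And>x. x \<in> U \<Longrightarrow> x \<noteq> t \<Longrightarrow> x \<noteq> v \<Longrightarrow> rho v < rho x" for U v t and c :: "nat \<Rightarrow> nat"
    proof (rule ccontr)
      assume k2: "\<not> k \<le> 1"
      have lt: "rho (c 0) < rho v" "rho (c 1) < rho v" "rho (c 0) < rho (c 1)"
        using that(2)[of 0 k] that(2)[of 1 k] that(2)[of 0 1] k(1) that(3) k2 by auto
      have U: "c 0 \<in> U" "c 1 \<in> U" using that(1) m by auto
      have "c 0 = t" using that(4)[OF U(1)] lt by force
      moreover have "c 1 = t" using that(4)[OF U(2)] lt by force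
      ultimately show False using lt by simp
    qed
    have second_last: "m - 2 \<le> k" if "\<And>i. i < m \<Longrightarrow> c i \<in> U" "\<And>i j. i < j \<Longrightarrow> j < m \<Longrightarrow> rho (c i) < rho (c j)" "c k = v"
      "\<And>x. x \<in> U \<Longrightarrow> x \<noteq> t \<Longrightarrow> x \<noteq> v \<Longrightarrow> rho x < rho v" for U v t and c :: "nat \<Rightarrow> nat"
    proof (rule ccontr)
      assume k2: "\<not> m - 2 \<le> k"
      have lt: "rho v < rho (c (m - 1))" "rho v < rho (c (m - 2))" "rho (c (m - 2)) < rho (c (m - 1))"
        using that(2)[of k "m - 1"] that(2)[of k "m - 2"] that(2)[of "m - 2" "m - 1"] m that(3) k2 by auto
      have U: "c (m - 1) \<in> U" "c (m - 2) \<in> U" using that(1) m by auto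
      have "c (m - 1) = t" using that(4)[OF U(1)] lt by force
      moreover have "c (m - 2) = t" using that(4)[OF U(2)] lt by force
      ultimately show False using lt by simp
    qed
    have r: "r \<ge> 3" using C by (simp add: cyclic_family_def)
    consider "l = 0" | "l = 1" | "2 \<le> l" "l < r - 1" | "l = r - 1" using l by linarith
    then show False
    proof cases
      case 1
      have "k = m - 1" by (rule last[where c = c, OF c k(2)]) (use 1 order(1) in auto)
      moreover have "k = 0" by (rule first[where c = c', OF c' k(3)]) (use 1 order(3) r in auto)
      ultimately show False using m by simp
    next
      case 2
      have "k \<le> 1" by (rule second[where c = c and t = "s 0", OF c k(2)]) (use 2 order(4) in auto)
      moreover have "k = m - 1" by (rule last[where c = c', OF c' k(3)]) (use 2 order(6)[of "Suc (Suc 0)"] r in auto)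
      ultimately show False using m by simp
    next
      case 3
      have "k = 0" by (rule first[where c = c, OF c k(2)]) (use 3 order(5)[of l] l in auto)
      moreover have "k = m - 1" by (rule last[where c = c', OF c' k(3)]) (use 3 order(6)[of "Suc l"] in auto)
      ultimately show False using m by simp
    next
      case 4
      have "k = 0" by (rule first[where c = c, OF c k(2)]) (use 4 order(5)[of l] l r in auto)
      moreover have "m - 2 \<le> k" by (rule second_last[where c = c' and t = "s 0", OF c' k(3)]) (use 4 order(2) r in auto)
      ultimately show False using m by simp
    qed
  qed
  have "c k \<in> W a" "c k \<in> W b" using c(1)[OF k(1)] c'(1)[OF k(1)] k(2) by auto
  from cyclic_family_shared[OF C ab this] show False
  proof
    assume "c k = s a \<and> b = Suc a mod r"
    then show False using main[where l = a and c = c and c' = c' and k = k] ab c c' k by auto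
  next
    assume "c k = s b \<and> a = Suc b mod r"
    then show False using main[where l = b and c = c' and c' = c and k = k] ab c c' k by auto
  qed
qed

section \<open>Basis minors as nonzerodivisors\<close>

lemma bb_mult_less:
  fixes b :: "'v \<Rightarrow> nat"
  assumes sq: "\<forall>c\<in>C. \<forall>d\<in>C. ord c < ord d \<longrightarrow> b c * b c < b d"
    and "c \<in> C" "d \<in> C" "t \<in> C" "(ord c :: nat) < ord t" "ord d < ord t"
  shows "b c * b d < b t"
proof (cases "b c \<le> b d")
  case True
  then have "b c * b d \<le> b d * b d" by (rule mult_right_mono) simp
  then show ?thesis using assms by (meson le_less_trans)
next
  case False
  then have "b c * b d \<le> b c * b c" by (intro mult_left_mono) simp_all
  then show ?thesis using assms by (meson le_less_trans)
qed

text \<open>The leading monomial of the basis minor consists of the entries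
  \<open>(Suc q, e q)\<close>. A diagonal containing such an entry belongs to a chain in
  \<open>W 0\<close> with \<open>q + 1\<close> columns before \<open>e q\<close>. As the columns of
  \<open>e\<close> open the order of \<open>W 0\<close>, only \<open>e 0, \<dots>, e (q - 1)\<close>
  precede it, which is one too few.\<close>

lemma nonzerodiv_first_clique:
  assumes C: "cyclic_family r W s" and m: "m \<ge> 3"
    and e: "\<And>i j. i < j \<Longrightarrow> j < m - 1 \<Longrightarrow> e i < e j" "\<And>q. q < m - 1 \<Longrightarrow> e q \<in> W 0"
    and priv: "\<And>q j. q < m - 1 \<Longrightarrow> 0 < j \<Longrightarrow> j < r \<Longrightarrow> e q \<notin> W j"
  shows "nonzerodiv_mod (gen_det (m - 1) Suc e) (idl (\<Union>i<r. minors m (W i)) :: 'a::field mpoly set)"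
proof -
  let ?E = "e ` {..<m - 1}"
  have r: "r \<ge> 3" using C by (simp add: cyclic_family_def)
  have E: "x \<in> W 0" "0 < j \<Longrightarrow> j < r \<Longrightarrow> x \<notin> W j" if "x \<in> ?E" for x j using that e priv by auto
  obtain rho :: "nat \<Rightarrow> nat" where inj: "inj_on rho (\<Union>i<r. W i)"
    and rho_E: "\<And>e x. e \<in> ?E \<Longrightarrow> x \<in> W 0 - ?E \<Longrightarrow> rho e < rho x"
    "\<And>e e'. e \<in> ?E \<Longrightarrow> e' \<in> ?E \<Longrightarrow> e < e' \<Longrightarrow> rho e < rho e'"
    and order: "\<And>x. x \<in> W 0 \<Longrightarrow> x \<noteq> s 0 \<Longrightarrow> rho x < rho (s 0)"
    "\<And>x. x \<in> W 0 \<Longrightarrow> x \<noteq> s 0 \<Longrightarrow> x \<noteq> s (r - 1) \<Longrightarrow> rho x < rho (s (r - 1))"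
    "\<And>x. x \<in> W 1 \<Longrightarrow> x \<noteq> s 0 \<Longrightarrow> rho (s 0) < rho x"
    "\<And>x. x \<in> W 1 \<Longrightarrow> x \<noteq> s 0 \<Longrightarrow> x \<noteq> s 1 \<Longrightarrow> rho (s 1) < rho x"
    "\<And>i x. 2 \<le> i \<Longrightarrow> i < r \<Longrightarrow> x \<in> W i \<Longrightarrow> x \<noteq> s i \<Longrightarrow> rho (s i) < rho x"
    "\<And>i x. 2 \<le> i \<Longrightarrow> i < r \<Longrightarrow> x \<in> W i \<Longrightarrow> x \<noteq> s (i - 1) \<Longrightarrow> rho x < rho (s (i - 1))"
    using cyclic_column_order[OF C E] by blast
  let ?U = "\<Union>i<r. W i"
  let ?C = "{..<m} \<times> ?U"
  \<comment> \<open>Entries compare by column first, then by row. In a 2 by 2 square the entry in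
    the later column and the later row is thus the largest, and by the choice of weights it alone
    outweighs the antidiagonal product.\<close>
  define ord where "ord x = m * rho (snd x) + fst x" for x :: "nat \<times> nat"
  have finC: "finite ?C" using C by (auto simp: cyclic_family_def)
  obtain bb where bb: "prime_weights bb" and sq: "\<forall>c\<in>?C. \<forall>d\<in>?C. ord c < ord d \<longrightarrow> bb c * bb c < bb d"
    using exists_prime_weights[OF finC inj_prod_encode[of UNIV], of ord] by blast
  interpret prime_weights bb by (rule bb)
  have monge: "bb (k, j') * bb (k', j) < bb (k, j) * bb (k', j')"
    if k: "k < k'" "k' < m" and j: "j \<in> ?U" "j' \<in> ?U" "rho j < rho j'" for k k' j j'
  proof -
    have "m * rho j + m \<le> m * rho j'" using mult_le_mono2[of "Suc (rho j)" "rho j'" m] j(3) by simp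
    then have "ord (k, j') < ord (k', j')" "ord (k', j) < ord (k', j')" using k j(3) by (auto simp: ord_def)
    then have "bb (k, j') * bb (k', j) < bb (k', j')"
      using bb_mult_less[OF sq, of "(k, j')" "(k', j)" "(k', j')"] k j by auto
    also have "\<dots> \<le> bb (k, j) * bb (k', j')" using bb_pos[of "(k, j)"] by (simp add: Suc_le_eq)
    finally show ?thesis .
  qed
  define chain where "chain i c \<longleftrightarrow> (\<forall>k<m. c k \<in> W i) \<and> (\<forall>k l. k < l \<longrightarrow> l < m \<longrightarrow> rho (c k) < rho (c l))" for i and c :: "nat \<Rightarrow> nat"
  define M where "M i = {diag m id c | c. chain i c}" for i
  have gb: "\<exists>v\<in>M i. \<exists>w. u = v + w" if i: "i \<in> {..<r}" and p: "p \<in> idl (minors m (W i))" "Lead p u" for i u and p :: "'a mpoly"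
  proof -
    have Wi: "W i \<subseteq> ?U" using i by auto
    then have inj: "inj_on rho (W i)" using inj inj_on_subset by blast
    then obtain c where "(\<forall>k<m. c k \<in> W i)" "(\<forall>k l. k < l \<longrightarrow> l < m \<longrightarrow> rho (c k) < rho (c l))" "\<exists>v. u = diag m id c + v"
      using Lead_minors[OF bb _ inj monge[OF _ _ subsetD[OF Wi] subsetD[OF Wi]] p] m by auto
    then show ?thesis unfolding M_def chain_def by blast
  qed
  have gen: "\<exists>g\<in>idl (minors m (W i)). Lead g v \<and> lookup g v = (1::'a)" if i: "i \<in> {..<r}" and v: "v \<in> M i" for i v
  proof -
    obtain c where c: "chain i c" "v = diag m id c" using v by (auto simp: M_def)
    have mg: "bb (id k, c j') * bb (id k', c j) < bb (id k, c j) * bb (id k', c j')"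
      if "k < k'" "k' < m" "j < j'" "j' < m" for k k' j j'
    proof -
      have "c j \<in> W i" "c j' \<in> W i" "rho (c j) < rho (c j')" using c(1) that by (auto simp: chain_def)
      then show ?thesis using monge[of k k' "c j" "c j'"] that i by auto
    qed
    have "Lead (gen_det m id c :: 'a mpoly) v" "lookup (gen_det m id c) v = (1::'a)"
      unfolding c(2) by (rule Lead_gen_det[OF bb], rule mg, assumption+)+
    moreover have "gen_det m id c \<in> (idl (minors m (W i)) :: 'a mpoly set)"
      by (rule gen_det_in_minors) (use c(1) in \<open>auto simp: chain_def\<close>)
    ultimately show ?thesis by blast
  qed
  have cop: "keys v \<inter> keys w = {}" if ij: "i \<in> {..<r}" "j \<in> {..<r}" "i \<noteq> j" and vw: "v \<in> M i" "w \<in> M j" for i j v w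
  proof (rule ccontr)
    assume "keys v \<inter> keys w \<noteq> {}"
    then obtain c c' k where c: "chain i c" "chain j c'" and k: "k < m" "c k = c' k"
      using vw by (auto simp: M_def keys_diag)
    show False
      by (rule cyclic_chains_disjoint[where c = c and c' = c' and k = k, OF C m _ _ ij(3) _ _ _ _ k order])
        (use c ij in \<open>auto simp: chain_def\<close>)
  qed
  have Lg: "Lead (gen_det (m - 1) Suc e :: 'a mpoly) (diag (m - 1) Suc e)"
  proof (rule Lead_gen_det(1)[OF bb])
    fix k k' j j' assume *: "k < k'" "k' < m - 1" "j < j'" "j' < m - 1"
    have "e j \<in> ?U" "e j' \<in> ?U" using e(2) * r by (auto intro!: bexI[of _ 0])
    moreover have "rho (e j) < rho (e j')" using rho_E(2)[of "e j" "e j'"] e(1) * by auto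
    ultimately show "bb (Suc k, e j') * bb (Suc k', e j) < bb (Suc k, e j) * bb (Suc k', e j')"
      using * by (intro monge) auto
  qed
  have free: "keys v \<inter> keys (diag (m - 1) Suc e) = {}" if v: "v \<in> (\<Union>i<r. M i)" for v
  proof (rule ccontr)
    assume "keys v \<inter> keys (diag (m - 1) Suc e) \<noteq> {}"
    then obtain i c q where c: "i < r" "chain i c" and q: "q < m - 1" "e q = c (Suc q)"
      using v by (auto simp: M_def keys_diag)
    have Sq: "Suc q < m" using q(1) by simp
    then have "e q \<in> W i" using c(2) unfolding chain_def q(2) by blast
    then have i0: "i = 0" using priv[of q i] c q by (cases "i = 0") auto
    have eqE: "e q \<in> ?E" using q(1) by auto
    have "c ` {..q} \<subseteq> e ` {..<q}"
    proof
      fix x assume "x \<in> c ` {..q}"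
      then obtain k where k: "k \<le> q" "x = c k" by auto
      have xW: "x \<in> W 0" using c k q i0 by (auto simp: chain_def)
      have lt: "rho x < rho (e q)" using c k q unfolding chain_def q(2) by auto
      have "x \<in> ?E"
      proof (rule ccontr)
        assume "x \<notin> ?E"
        then show False using rho_E(1)[OF eqE, of x] xW lt by auto
      qed
      then obtain l where l: "l < m - 1" "x = e l" by auto
      have "l < q"
      proof (rule ccontr)
        assume "\<not> l < q"
        then have "rho (e q) \<le> rho x"
          using rho_E(2)[OF eqE, of "e l"] e(1)[of q l] l by (cases "l = q") auto
        then show False using lt by simp
      qed
      then show "x \<in> e ` {..<q}" using l by auto
    qed
    then have "card (c ` {..q}) \<le> card (e ` {..<q})" by (intro card_mono) auto
    also have "\<dots> \<le> q" using card_image_le[of "{..<q}" e] by simp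
    finally have "card (c ` {..q}) \<le> q" .
    moreover have "inj_on c {..q}"
    proof (rule inj_onI)
      fix k l assume kl: "k \<in> {..q}" "l \<in> {..q}" "c k = c l"
      have "rho (c x) < rho (c y)" if "x < y" "y \<le> q" for x y
        using c(2) that Sq unfolding chain_def by auto
      from this[of k l] this[of l k] show "k = l" using kl by (cases k l rule: linorder_cases) auto
    qed
    ultimately show False by (simp add: card_image)
  qed
  show ?thesis
  proof (rule nonzerodiv_mod_of_Lead[OF is_ideal_idl, where M = "\<Union>i<r. M i"])
    show "\<exists>v\<in>\<Union>i<r. M i. \<exists>w. u = v + w" if "p \<in> idl (\<Union>i<r. minors m (W i))" "Lead p u" for u and p :: "'a mpoly"
      using Lead_sum_ideals[OF _ gb gen cop that] by auto
    show "\<exists>g\<in>idl (\<Union>i<r. minors m (W i)). Lead g v \<and> lookup g v = (1::'a)" if v: "v \<in> (\<Union>i<r. M i)" for v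
    proof -
      obtain i where i: "i < r" "v \<in> M i" using v by auto
      then obtain g where "g \<in> idl (minors m (W i))" "Lead g v" "lookup g v = (1::'a)" using gen by blast
      moreover have "idl (minors m (W i)) \<subseteq> (idl (\<Union>i<r. minors m (W i)) :: 'a mpoly set)"
        by (rule idl_mono) (use i in auto)
      ultimately show ?thesis by blast
    qed
  qed (use Lg free in auto)
qed

lemma nonzerodiv_clique:
  assumes C: "cyclic_family r W s" and m: "m \<ge> 3" and a: "a < r"
    and e: "\<And>i j. i < j \<Longrightarrow> j < m - 1 \<Longrightarrow> e i < e j" "\<And>q. q < m - 1 \<Longrightarrow> e q \<in> W a"
    and priv: "\<And>q j. q < m - 1 \<Longrightarrow> j \<noteq> a \<Longrightarrow> j < r \<Longrightarrow> e q \<notin> W j"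
  shows "nonzerodiv_mod (gen_det (m - 1) Suc e) (idl (\<Union>i<r. minors m (W i)) :: 'a::field mpoly set)"
proof -
  let ?f = "\<lambda>l. (a + l) mod r"
  have inj: "?f l = ?f l' \<longleftrightarrow> l = l'" if "l < r" "l' < r" for l l'
  proof -
    have "?f l = ?f l' \<longleftrightarrow> [l = l'] (mod r)"
      using cong_add_lcancel_nat[of a l l' r] by (simp add: cong_def)
    also have "\<dots> \<longleftrightarrow> l = l'" using that by (simp add: cong_def)
    finally show ?thesis .
  qed
  have "?f ` {..<r} = {..<r}"
    by (rule endo_inj_surj) (use a inj in \<open>auto simp: inj_on_def\<close>)
  then have eq: "(\<Union>l<r. minors m (W (?f l))) = (\<Union>i<r. minors m (W i) :: 'a mpoly set)"
    by (metis (no_types, lifting) SUP_cong image_image)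
  have "nonzerodiv_mod (gen_det (m - 1) Suc e) (idl (\<Union>l<r. minors m (W (?f l))) :: 'a mpoly set)"
  proof (rule nonzerodiv_first_clique[OF cyclic_family_rotate[OF C] m e(1)])
    show "e q \<in> W (?f 0)" if "q < m - 1" for q using e(2)[OF that] a by simp
    show "e q \<notin> W (?f j)" if "q < m - 1" "0 < j" "j < r" for q j
      by (rule priv[OF that(1)]) (use inj[of j 0] that a in auto)
  qed
  then show ?thesis unfolding eq .
qed

subsection \<open>Localization\<close>

text \<open>The localization of \<open>I\<close> at the powers of \<open>g\<close>, realized inside
  the fraction field; \<open>loc UNIV g\<close> is the localized ring.\<close>

definition loc :: "'a::idom set \<Rightarrow> 'a \<Rightarrow> 'a fract set" where
  "loc I g = {z. \<exists>k. \<exists>a\<in>I. z * to_fract g ^ k = to_fract a}"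

lemma to_fract_power: "to_fract (x ^ k) = to_fract x ^ k"
  by (induction k) auto

lemma to_fract_sum: "to_fract (sum f A) = (\<Sum>i\<in>A. to_fract (f i))"
  by (induction A rule: infinite_finite_induct) auto

lemma is_ideal_UNIV: "is_ideal UNIV"
  by (simp add: is_ideal_def)

lemma to_fract_in_loc: "a \<in> I \<Longrightarrow> to_fract a \<in> loc I g"
  unfolding loc_def by (auto intro!: exI[of _ 0])

lemma loc_mono: "I \<subseteq> J \<Longrightarrow> loc I g \<subseteq> loc J g"
  unfolding loc_def by blast

lemma loc_add:
  assumes I: "is_ideal I" and "x \<in> loc I g" "y \<in> loc I g"
  shows "x + y \<in> loc I g"
proof -
  obtain k a where a: "a \<in> I" "x * to_fract g ^ k = to_fract a" using assms by (auto simp: loc_def)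
  obtain l b where b: "b \<in> I" "y * to_fract g ^ l = to_fract b" using assms by (auto simp: loc_def)
  have "(x + y) * to_fract g ^ (k + l) =
      x * to_fract g ^ k * to_fract g ^ l + y * to_fract g ^ l * to_fract g ^ k"
    by (simp add: algebra_simps power_add)
  also have "\<dots> = to_fract (a * g ^ l + b * g ^ k)" by (simp add: a b to_fract_power)
  finally have "(x + y) * to_fract g ^ (k + l) = to_fract (a * g ^ l + b * g ^ k)" .
  moreover have "a * g ^ l + b * g ^ k \<in> I"
    by (intro is_idealD(2)[OF I] is_idealD(4)[OF I] a b)
  ultimately show ?thesis unfolding loc_def by blast
qed

lemma loc_mult:
  assumes I: "is_ideal I" and "x \<in> loc UNIV g" "y \<in> loc I g"
  shows "x * y \<in> loc I g"
proof -
  obtain k a where a: "x * to_fract g ^ k = to_fract a" using assms by (auto simp: loc_def)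
  obtain l b where b: "b \<in> I" "y * to_fract g ^ l = to_fract b" using assms by (auto simp: loc_def)
  have "x * y * to_fract g ^ (k + l) = (x * to_fract g ^ k) * (y * to_fract g ^ l)"
    by (simp add: algebra_simps power_add)
  also have "\<dots> = to_fract (a * b)" by (simp add: a b)
  finally show ?thesis using is_idealD(3)[OF I b(1)] unfolding loc_def by blast
qed

lemma loc_uminus: "is_ideal I \<Longrightarrow> x \<in> loc I g \<Longrightarrow> - x \<in> loc I g"
  using loc_mult[of I "to_fract (- 1)" g x] to_fract_in_loc[of "- 1" UNIV g] by simp

lemma loc_diff: "is_ideal I \<Longrightarrow> x \<in> loc I g \<Longrightarrow> y \<in> loc I g \<Longrightarrow> x - y \<in> loc I g"
  using loc_add[of I x g "- y"] loc_uminus[of I y g] by simp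

lemma loc_0: "is_ideal I \<Longrightarrow> 0 \<in> loc I g"
  using to_fract_in_loc[OF is_idealD(1)] by fastforce

lemma loc_sum: "is_ideal I \<Longrightarrow> (\<And>i. i \<in> A \<Longrightarrow> f i \<in> loc I g) \<Longrightarrow> sum f A \<in> loc I g"
  by (induction A rule: infinite_finite_induct) (auto intro: loc_add loc_0)

text \<open>Division by the factor \<open>a\<close> of \<open>g\<close> is multiplication by
  \<open>b / g\<close>.\<close>

lemma loc_divide:
  assumes I: "is_ideal I" and g: "g = a * b" "g \<noteq> 0" and x: "x \<in> loc I g"
  shows "x / to_fract a \<in> loc I g"
proof -
  have a: "to_fract a \<noteq> 0" using g by auto
  obtain k c where c: "c \<in> I" "x * to_fract g ^ k = to_fract c" using x by (auto simp: loc_def)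
  have "x / to_fract a * to_fract g ^ Suc k = x * to_fract g ^ k * (to_fract g / to_fract a)"
    by simp
  also have "to_fract g / to_fract a = to_fract b" using a g by simp
  finally have "x / to_fract a * to_fract g ^ Suc k = to_fract (c * b)" using c by simp
  then show ?thesis using is_idealD(4)[OF I c(1)] unfolding loc_def by blast
qed

text \<open>The point at which nonzerodivisors are used: inverting \<open>g\<close> does not enlarge
  the ideal after contraction.\<close>

lemma loc_contract:
  assumes nz: "nonzerodiv_mod g I" and f: "to_fract f \<in> loc I g"
  shows "f \<in> I"
proof -
  obtain k a where a: "a \<in> I" "to_fract f * to_fract g ^ k = to_fract a" using f by (auto simp: loc_def)
  then have "to_fract (g ^ k * f) = to_fract a" by (simp add: to_fract_power mult.commute)
  then have "g ^ k * f = a" by (simp only: to_fract_eq_iff)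
  then have "g ^ k * f \<in> I" using a by simp
  then show ?thesis using nonzerodiv_mod_power[OF nz] by (auto simp: nonzerodiv_mod_def)
qed

text \<open>A homomorphism that moves each variable by an element of the localized ideal moves every
  polynomial by such an element. In particular a polynomial whose image lies in the localized ideal
  lies there itself.\<close>

lemma loc_congruent:
  fixes p :: "('v::linorder \<Rightarrow>\<^sub>0 nat) \<Rightarrow>\<^sub>0 'a::field"
  assumes hom: "comm_ring_hom Phi" and const: "\<And>a. Phi (single 0 a) = to_fract (single 0 a)"
    and I: "is_ideal I" and vars: "\<And>c. c \<in> S \<Longrightarrow> to_fract (X c) - Phi (X c) \<in> loc I g"
    and p: "\<forall>u\<in>keys p. keys u \<subseteq> S"
  shows "to_fract p - Phi p \<in> loc I g"
proof -
  interpret comm_ring_hom Phi by (rule hom)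
  show ?thesis using p
  proof (induction rule: poly_vars_induct)
    case (const a)
    then show ?case using assms(2) loc_0[OF I] by simp
  next
    case (var c)
    then show ?case by (rule vars)
  next
    case (add p q)
    have eq: "to_fract (p + q) - Phi (p + q) = (to_fract p - Phi p) + (to_fract q - Phi q)"
      by (simp add: hom_add)
    show ?case unfolding eq by (rule loc_add[OF I add])
  next
    case (mult p q)
    \<comment> \<open>In this form \<open>Phi\<close> occurs only inside differences; a bare value
      \<open>Phi p\<close> is not known beforehand to lie in \<open>loc UNIV g\<close>.\<close>
    have eq: "to_fract (p * q) - Phi (p * q) =
        to_fract p * (to_fract q - Phi q) + to_fract q * (to_fract p - Phi p)
        - (to_fract p - Phi p) * (to_fract q - Phi q)"
      by (simp add: hom_mult algebra_simps)
    have U: "to_fract p \<in> loc UNIV g" "to_fract q \<in> loc UNIV g" by (simp_all add: to_fract_in_loc)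
    have V: "to_fract p - Phi p \<in> loc UNIV g" using mult(1) loc_mono[of I UNIV] by blast
    show ?case unfolding eq
      by (rule loc_diff[OF I loc_add[OF I loc_mult[OF I U(1) mult(2)] loc_mult[OF I U(2) mult(1)]]
            loc_mult[OF I V mult(2)]])
  qed
qed

lemma comm_ring_hom_to_fract_const:
  "comm_ring_hom (\<lambda>a::'a::field. to_fract (single (0 :: 'v::linorder \<Rightarrow>\<^sub>0 nat) a))"
  by standard (simp_all add: single_add mult_single to_fract_mult[symmetric] del: to_fract_mult)

lemma idl_singleton: "p \<in> idl {g} \<Longrightarrow> \<exists>q. p = q * g"
proof (induction rule: idl.induct)
  case zero
  show ?case by (rule exI[of _ 0]) simp
next
  case (step a h c)
  then obtain q where "a = q * g" by blast
  then have "a + c * h = (q + c) * g" using step by (simp add: algebra_simps)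
  then show ?case by blast
qed

subsection \<open>The quadrics of the shared columns\<close>

locale cycle_quadrics =
  fixes r m :: nat and s :: "nat \<Rightarrow> nat"
  assumes r3: "r \<ge> 3" and m3: "m \<ge> 3" and inj_s: "inj_on s {..<r}"
begin

text \<open>The indeterminate \<open>X (m + i, k)\<close> plays the role of the coefficient \<open>k\<close> of the linear
  form, normalized at row \<open>0\<close>, that vanishes on the columns of the clique \<open>i\<close>.\<close>

definition quad :: "nat \<Rightarrow> 'a::field mpoly" where
  "quad i = (\<Sum>k\<in>{1..<m}. (X (m + i, k) - X (m + Suc i mod r, k)) * X (k, s i))"

text \<open>Up to sign, the determinant of \<open>quad 0\<close> and \<open>quad (r - 1)\<close> as
  linear equations in the unknowns \<open>(0, 1)\<close> and \<open>(0, 2)\<close>.\<close>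

definition shared_minor :: "'a::field mpoly" where
  "shared_minor = X (2, s 0) * X (1, s (r - 1)) - X (1, s 0) * X (2, s (r - 1))"

definition quad_ideal :: "'a::field mpoly set" where
  "quad_ideal = idl (\<Union>i<r. {quad i})"

lemma s_eq: "i < r \<Longrightarrow> j < r \<Longrightarrow> s i = s j \<longleftrightarrow> i = j"
  using inj_s by (auto simp: inj_on_def)

text \<open>The unknowns \<open>(i, 1)\<close> can decrease with \<open>i\<close>, but the last
  quadric leads back from \<open>r - 1\<close> to 0, so there the index 2 takes over. This choice
  also avoids the entries \<open>(2, s 0)\<close> and \<open>(1, s (r - 1))\<close> and the entries
  \<open>(2, s i)\<close> of the middle quadrics, which have to be prime to all leading
  monomials.\<close>

definition qlead :: "nat \<Rightarrow> nat \<times> nat \<Rightarrow>\<^sub>0 nat" where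
  "qlead i = (let k = (if i = r - 1 then 2 else 1) in single (m + i, k) 1 + single (k, s i) 1)"

lemma keys_two: "keys (single x (1::nat) + single y 1) = {x, y}"
  by (auto simp: in_keys_iff lookup_add lookup_single when_def split: if_splits)

lemma qlead_order:
  obtains bb where "prime_weights bb"
    "\<And>i. i < r \<Longrightarrow> prime_weights.Lead bb (quad i :: 'a::field mpoly) (qlead i)"
    "\<And>i. i < r \<Longrightarrow> lookup (quad i :: 'a mpoly) (qlead i) = 1"
    "prime_weights.Lead bb (shared_minor :: 'a mpoly) (single (2, s 0) 1 + single (1, s (r - 1)) 1)"
proof -
  let ?C = "{..<m} \<times> s ` {..<r} \<union> {m..<m + r} \<times> {..<m}"
  \<comment> \<open>The unknowns \<open>(i, 1)\<close> get the decreasing values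
    \<open>r + 2 - i\<close>, and \<open>(r - 1, 2)\<close> lies above them. The entries
    \<open>(1, s i)\<close> of the middle quadrics must be higher still, since otherwise
    \<open>(r - 1, 2)\<close> would lead \<open>quad (r - 2)\<close>. The value 1 is below every
    leading unknown and only decides the leading term of \<open>shared_minor\<close>.\<close>
  define ord where "ord c = (if fst c < m then
      (if fst c = 1 \<and> snd c \<in> s ` {1..<r - 1} then r + 10
       else if (fst c = 2 \<and> snd c = s 0) \<or> (fst c = 1 \<and> snd c = s (r - 1)) then 1 else 0)
     else if fst c = m + (r - 1) \<and> snd c = 2 then r + 5
     else if snd c = 1 then r + 2 - (fst c - m) else (0::nat))" for c
  have finC: "finite ?C" by simp
  obtain bb where bb: "prime_weights bb" and sq: "\<forall>c\<in>?C. \<forall>d\<in>?C. ord c < ord d \<longrightarrow> bb c * bb c < bb d"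
    using exists_prime_weights[OF finC inj_prod_encode[of UNIV], of ord] by blast
  interpret prime_weights bb by (rule bb)
  have A: "bb x * bb y < bb x0 * bb y0" "bb x * bb y < bb y0 * bb x0"
    if "x \<in> ?C" "y \<in> ?C" "x0 \<in> ?C" "ord x < ord x0" "ord y < ord x0" for x y x0 y0
  proof -
    have "bb x * bb y < bb x0" by (rule bb_mult_less[OF sq]) (use that in auto)
    also have "\<dots> \<le> bb x0 * bb y0" using bb_pos[of y0] by (simp add: Suc_le_eq)
    finally show "bb x * bb y < bb x0 * bb y0" .
    then show "bb x * bb y < bb y0 * bb x0" by (simp add: mult.commute)
  qed
  have B: "bb x * bb y < bb x0 * bb y" if "x \<in> ?C" "x0 \<in> ?C" "ord x < ord x0" for x y x0
  proof -
    have "bb x \<le> bb x * bb x" using bb_pos[of x] by (simp add: Suc_le_eq)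
    also have "\<dots> < bb x0" using sq that by blast
    finally show ?thesis by simp
  qed
  have lam_C: "(m + i, k) \<in> ?C" if "i < r" "k < m" for i k using that by auto
  have x_C: "(k, s i) \<in> ?C" if "i < r" "k < m" for i k using that by auto
  have ord_lam: "ord (m + i, k) = (if i = r - 1 \<and> k = 2 then r + 5 else if k = 1 then r + 2 - i else 0)"
    if "i < r" for i k using that by (auto simp: ord_def)
  have s_in: "s i \<in> s ` {1..<r - 1} \<longleftrightarrow> 1 \<le> i \<and> i < r - 1" if "i < r" for i
  proof
    assume "s i \<in> s ` {1..<r - 1}"
    then obtain j where "1 \<le> j" "j < r - 1" "s i = s j" by auto
    then show "1 \<le> i \<and> i < r - 1" using s_eq[of i j] that by auto
  qed auto
  have ord_x: "ord (k, s i) = (if k = 1 \<and> 1 \<le> i \<and> i < r - 1 then r + 10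
      else if (k = 2 \<and> i = 0) \<or> (k = 1 \<and> i = r - 1) then 1 else 0)" if "i < r" "k < m" for i k
    using that s_in[OF that(1)] s_eq[of i 0] s_eq[of i "r - 1"] r3 by (auto simp: ord_def)
  have quad_lead: "Lead (quad i :: 'a mpoly) (qlead i) \<and> lookup (quad i :: 'a mpoly) (qlead i) = 1"
    if i: "i < r" for i
  proof -
    let ?T = "{1..<m} \<times> (UNIV :: bool set)"
    let ?n = "\<lambda>b. if b then i else Suc i mod r"
    let ?u = "\<lambda>t. single (m + ?n (snd t), fst t) (1::nat) + single (fst t, s i) 1"
    let ?a = "\<lambda>t :: nat \<times> bool. if snd t then 1 else - 1 :: 'a"
    let ?k = "if i = r - 1 then 2 else 1 :: nat"
    have q: "quad i = (\<Sum>t\<in>?T. single (?u t) (?a t))"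
    proof -
      have "(quad i :: 'a mpoly) = (\<Sum>k\<in>{1..<m}. \<Sum>b\<in>UNIV. single (?u (k, b)) (?a (k, b)))"
        unfolding quad_def
        by (rule sum.cong[OF refl])
          (simp add: UNIV_bool left_diff_distrib mult_single single_uminus)
      then show ?thesis by (simp add: sum.cartesian_product case_prod_unfold)
    qed
    have N: "N (?u (k, b)) = bb (m + ?n b, k) * bb (k, s i)" for k b
      by (simp add: mono_val_add)
    have t0: "(?k, True) \<in> ?T" using m3 by auto
    have nb: "?n b < r" for b using i by auto
    have less: "N (?u t) < N (?u (?k, True))" if t: "t \<in> ?T" "t \<noteq> (?k, True)" for t
    proof -
      obtain k b where kb: "t = (k, b)" by (cases t)
      have k: "1 \<le> k" "k < m" "k \<noteq> ?k \<or> \<not> b" using t kb by auto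
      have k0: "?k < m" using m3 by auto
      note mem = lam_C[OF nb k(2)] x_C[OF i k(2)] lam_C[OF i k0] x_C[OF i k0]
      have ords: "ord (m + ?n b, k) = (if ?n b = r - 1 \<and> k = 2 then r + 5 else if k = 1 then r + 2 - ?n b else 0)"
        "ord (m + i, ?k) = (if i = r - 1 then r + 5 else r + 2 - i)"
        using ord_lam[OF nb[of b], of k] ord_lam[OF i, of ?k] by auto
      show ?thesis unfolding kb N if_True
      proof (cases "k = ?k")
        case True
        then have b: "\<not> b" using k by simp
        have "ord (m + ?n b, k) < ord (m + i, ?k)"
        proof (cases "i = r - 1")
          case True
          then have "Suc i mod r = 0" using r3 by simp
          then show ?thesis using ords True b \<open>k = ?k\<close> r3 by auto
        next
          case False
          then have "Suc i mod r = Suc i" using i by simp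
          then show ?thesis using ords False b \<open>k = ?k\<close> i by auto
        qed
        then show "bb (m + ?n b, k) * bb (k, s i) < bb (m + i, ?k) * bb (?k, s i)"
          using B[OF mem(1,3)] True by simp
      next
        case False
        show "bb (m + ?n b, k) * bb (k, s i) < bb (m + i, ?k) * bb (?k, s i)"
        proof (cases "1 \<le> i \<and> i < r - 1")
          case True
          then have "k \<noteq> 1" "?k = 1" using False by auto
          moreover have "ord (1, s i) = r + 10" using ord_x[OF i, of 1] True m3 by simp
          moreover have "ord (k, s i) < r + 10" using ord_x[OF i k(2)] \<open>k \<noteq> 1\<close> by auto
          moreover have "ord (m + ?n b, k) < r + 10" using ords(1) by auto
          ultimately show ?thesis using A(2)[OF mem(1,2,4)] by simp
        next
          case F2: False
          have "ord (k, s i) < ord (m + i, ?k)"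
          proof -
            have "ord (k, s i) \<le> 1" using ord_x[OF i k(2)] F2 by auto
            moreover have "ord (m + i, ?k) \<ge> 2" using ords(2) i by auto
            ultimately show ?thesis by linarith
          qed
          moreover have "ord (m + ?n b, k) < ord (m + i, ?k)"
          proof (cases "i = r - 1")
            case True
            then have "k \<noteq> 2" using False by auto
            then show ?thesis using ords True by auto
          next
            case F3: False
            then have i0: "i = 0" using F2 i by auto
            then have "Suc i mod r \<noteq> r - 1" "k \<noteq> 1" using r3 False by auto
            then show ?thesis using ords i0 r3 by auto
          qed
          ultimately show ?thesis using A(1)[OF mem(1,2,3)] by blast
        qed
      qed
    qed
    have a0: "?a (?k, True) \<noteq> 0" by simp
    have u0: "?u (?k, True) = qlead i" by (simp add: qlead_def Let_def)
    have fT: "finite ?T" by simp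
    show ?thesis
      using Lead_sum_single[of ?T "(?k, True)" ?a ?u, OF fT t0 a0 less q] unfolding u0 by simp
  qed
  have "Lead (shared_minor :: 'a mpoly) (single (2, s 0) 1 + single (1, s (r - 1)) 1)"
  proof -
    let ?u = "\<lambda>b. if b then single (2, s 0) (1::nat) + single (1, s (r - 1)) 1
       else single (1, s 0) 1 + single (2, s (r - 1)) 1"
    let ?a = "\<lambda>b. if b then 1 else - 1 :: 'a"
    have q: "shared_minor = (\<Sum>t\<in>UNIV. single (?u t) (?a t))"
      by (simp add: shared_minor_def UNIV_bool mult_single single_uminus)
    have "bb (1, s 0) * bb (2, s (r - 1)) < bb (2, s 0) * bb (1, s (r - 1))"
      by (rule A(1)) (use ord_x[of 0 1] ord_x[of "r - 1" 2] ord_x[of 0 2] x_C[of 0] x_C[of "r - 1"] m3 r3 in auto)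
    then have less: "N (?u t) < N (?u True)" if "t \<in> UNIV" "t \<noteq> True" for t
      using that by (simp add: mono_val_add)
    show ?thesis using Lead_sum_single(1)[of UNIV True ?a ?u, OF _ _ _ less q] by simp
  qed
  with bb quad_lead show thesis by (intro that[of bb]) auto
qed

text \<open>One quadric is a Groebner basis of its principal ideal, and the leading monomials of
  different quadrics are coprime, so together they form a Groebner basis. The elements in question
  have leading monomials prime to all of these.\<close>

lemma nonzerodiv_quads:
  shows "nonzerodiv_mod (shared_minor :: 'a::field mpoly) quad_ideal" "(shared_minor :: 'a mpoly) \<noteq> 0"
    and "\<And>i. 1 \<le> i \<Longrightarrow> i < r - 1 \<Longrightarrow> nonzerodiv_mod (X (2, s i) :: 'a mpoly) quad_ideal"
proof -
  obtain bb where bb: "prime_weights bb"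
    and Q: "\<And>i. i < r \<Longrightarrow> prime_weights.Lead bb (quad i :: 'a::field mpoly) (qlead i)"
      "\<And>i. i < r \<Longrightarrow> lookup (quad i :: 'a mpoly) (qlead i) = 1"
    and H: "prime_weights.Lead bb (shared_minor :: 'a mpoly) (single (2, s 0) 1 + single (1, s (r - 1)) 1)"
    using qlead_order[where ?'a = 'a] by metis
  interpret prime_weights bb by (rule bb)
  have keysq: "keys (qlead i) = {(m + i, if i = r - 1 then 2 else 1), (if i = r - 1 then 2 else 1, s i)}" for i
    unfolding qlead_def Let_def by (rule keys_two)
  have gb: "\<exists>v\<in>{qlead i}. \<exists>w. u = v + w" if i: "i \<in> {..<r}" and p: "p \<in> idl {quad i}" "Lead p u" for i u and p :: "'a mpoly"
  proof -
    obtain q where q: "p = q * quad i" using idl_singleton[OF p(1)] by blast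
    then have "q \<noteq> 0" using p(2) by (auto simp: Lead_def)
    then obtain w where "Lead q w" using Lead_exists by blast
    then have "Lead p (w + qlead i)" unfolding q by (rule Lead_mult(1)) (use Q i in auto)
    then have "u = w + qlead i" using p(2) Lead_unique by blast
    then show ?thesis by (auto simp: add.commute)
  qed
  have gen: "\<exists>g\<in>idl {quad i}. Lead g v \<and> lookup g v = (1::'a)" if "i \<in> {..<r}" "v \<in> {qlead i}" for i v
    using Q that by (intro bexI[of _ "quad i"] idl_gen) auto
  have cop: "keys v \<inter> keys w = {}" if "i \<in> {..<r}" "j \<in> {..<r}" "i \<noteq> j" "v \<in> {qlead i}" "w \<in> {qlead j}" for i j v w
    using that s_eq[of i j] m3 by (auto simp: keysq split: if_splits)
  have LP: "\<exists>v\<in>(\<Union>i<r. {qlead i}). \<exists>w. u = v + w" if "p \<in> quad_ideal" "Lead p u" for u and p :: "'a mpoly"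
    using Lead_sum_ideals[where I = "{..<r}" and G = "\<lambda>i. {quad i}" and M = "\<lambda>i. {qlead i}"
        and p = p and u = u, OF _ gb gen cop] that
    by (simp add: quad_ideal_def)
  have LG: "\<exists>g\<in>quad_ideal. Lead g v \<and> lookup g v = (1::'a)" if v: "v \<in> (\<Union>i<r. {qlead i})" for v
  proof -
    obtain i where "i < r" "v = qlead i" using v by blast
    then show ?thesis using Q unfolding quad_ideal_def by (intro bexI[of _ "quad i"] idl_gen) auto
  qed
  have I: "is_ideal (quad_ideal :: 'a mpoly set)" unfolding quad_ideal_def by (rule is_ideal_idl)
  show "nonzerodiv_mod (shared_minor :: 'a mpoly) quad_ideal"
  proof (rule nonzerodiv_mod_of_Lead[OF I LP LG H])
    fix v assume "v \<in> (\<Union>i<r. {qlead i})"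
    then obtain i where i: "i < r" "v = qlead i" by blast
    show "keys v \<inter> keys (single (2, s 0) (1::nat) + single (1, s (r - 1)) 1) = {}"
      unfolding i(2) keysq keys_two using i(1) s_eq[of i 0] s_eq[of i "r - 1"] r3 m3 by auto
  qed
  show "(shared_minor :: 'a mpoly) \<noteq> 0" using H by (auto simp: Lead_def)
  fix i assume i0: "1 \<le> i" "i < r - 1"
  then have i: "1 \<le> i" "i < r - 1" "i < r" by auto
  have L: "Lead (X (2, s i) :: 'a mpoly) (single (2, s i) 1)" by simp
  show "nonzerodiv_mod (X (2, s i) :: 'a mpoly) quad_ideal"
  proof (rule nonzerodiv_mod_of_Lead[OF I LP LG L])
    fix v assume "v \<in> (\<Union>i<r. {qlead i})"
    then obtain j where j: "j < r" "v = qlead j" by blast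
    show "keys v \<inter> keys (single (2, s i) (1::nat)) = {}"
      unfolding j(2) keysq using j(1) s_eq[of i j] i m3 by auto
  qed
qed

end

lemma single_1_neq_0 [simp]: "single u (1::'a::zero_neq_one) \<noteq> 0"
  by (metis lookup_single_eq lookup_zero zero_neq_one)

section \<open>Rational solution of the quadrics\<close>

context cycle_quadrics
begin

abbreviation (input) T :: "'a::field mpoly \<Rightarrow> 'a mpoly fract" where "T \<equiv> to_fract"

definition entry :: "nat \<Rightarrow> nat \<Rightarrow> 'a::field mpoly fract" where "entry k i = T (X (k, s i))"

definition coef :: "nat \<Rightarrow> nat \<Rightarrow> 'a::field mpoly fract" where "coef i k = T (X (m + i, k))"

lemma entry_nonzero: "entry k i \<noteq> 0"
  by (simp add: entry_def)

text \<open>Collects the denominators of the solution: \<open>X (2, s i)\<close> from the recursion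
  and \<open>shared_minor\<close> from Cramer's rule.\<close>

definition quad_denom :: "'a::field mpoly" where
  "quad_denom = shared_minor * (\<Prod>i\<in>{1..<r - 1}. X (2, s i))"

lemma quad_denom_nonzero: "(quad_denom :: 'a::field mpoly) \<noteq> 0"
  using nonzerodiv_quads(2) by (auto simp: quad_denom_def)

lemma nonzerodiv_quad_denom: "nonzerodiv_mod (quad_denom :: 'a::field mpoly) quad_ideal"
  unfolding quad_denom_def
proof (rule nonzerodiv_mod_mult[OF nonzerodiv_quads(1) nonzerodiv_mod_prod])
  show "nonzerodiv_mod (X (2, s i) :: 'a mpoly) quad_ideal" if "i \<in> {1..<r - 1}" for i
    by (rule nonzerodiv_quads(3)) (use that in auto)
qed

lemma is_ideal_quad_ideal: "is_ideal quad_ideal"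
  unfolding quad_ideal_def by (rule is_ideal_idl)

lemma quad_in_loc: "i < r \<Longrightarrow> T (quad i) \<in> loc quad_ideal g"
  by (rule to_fract_in_loc) (auto simp: quad_ideal_def intro: idl_gen)

text \<open>The equations for \<open>i = r - 2, \<dots>, 1\<close> are solved one after the other for the unknown
  with index \<open>(i, 2)\<close>; the remaining two are linear in the unknowns \<open>(0, 1)\<close> and \<open>(0, 2)\<close>.\<close>

primrec chain_sol :: "nat \<Rightarrow> 'a::field mpoly fract" where
  "chain_sol 0 = coef (r - 1) 2"
| "chain_sol (Suc t) = chain_sol t + (\<Sum>k\<in>{1..<m} - {2}. (coef (r - 1 - t) k - coef (r - 2 - t) k) * entry k (r - 2 - t)) / entry 2 (r - 2 - t)"

text \<open>The argument of \<open>chain_sol\<close> counts down from the last clique, whose unknown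
  \<open>(r - 1, 2)\<close> stays a free parameter.\<close>

definition sol :: "nat \<Rightarrow> nat \<Rightarrow> 'a::field mpoly fract" where
  "sol i k = (if k = 2 then chain_sol (r - 1 - i) else coef i k)"

text \<open>Right-hand side of \<open>quad 0\<close> once the terms with the unknowns
  \<open>(0, 1)\<close> and \<open>(0, 2)\<close> stand alone on the left, with the values
  \<open>sol 1\<close> already inserted; \<open>rhs1\<close> is the analogue for
  \<open>quad (r - 1)\<close>.\<close>

definition rhs0 :: "'a::field mpoly fract" where
  "rhs0 = (\<Sum>k\<in>{1..<m}. sol 1 k * entry k 0) - (\<Sum>k\<in>{3..<m}. coef 0 k * entry k 0)"

definition rhs1 :: "'a::field mpoly fract" where
  "rhs1 = (\<Sum>k\<in>{1..<m}. coef (r - 1) k * entry k (r - 1)) - (\<Sum>k\<in>{3..<m}. coef 0 k * entry k (r - 1))"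

definition sol01 :: "'a::field mpoly fract" where
  "sol01 = (entry 2 0 * rhs1 - entry 2 (r - 1) * rhs0) / T shared_minor"

definition sol02 :: "'a::field mpoly fract" where
  "sol02 = (entry 1 (r - 1) * rhs0 - entry 1 0 * rhs1) / T shared_minor"

definition theta_var :: "nat \<times> nat \<Rightarrow> 'a::field mpoly fract" where
  "theta_var c = (if m \<le> fst c \<and> fst c < m + r \<and> snd c < m
     then if fst c = m then if snd c = 1 then sol01 else if snd c = 2 then sol02 else T (X c)
       else sol (fst c - m) (snd c)
     else T (X c))"

definition theta :: "'a::field mpoly \<Rightarrow> 'a mpoly fract" where
  "theta = subst_poly (\<lambda>a. to_fract (single 0 a)) theta_var"

lemma comm_ring_hom_theta: "comm_ring_hom (theta :: 'a::field mpoly \<Rightarrow> _)"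
proof -
  interpret comm_ring_hom "\<lambda>a::'a. to_fract (single (0 :: nat \<times> nat \<Rightarrow>\<^sub>0 nat) a)"
    by (rule comm_ring_hom_to_fract_const)
  show ?thesis unfolding theta_def by (rule comm_ring_hom_subst_poly)
qed

lemma theta_const: "theta (single 0 (a::'a::field)) = to_fract (single 0 a)"
  and theta_X: "theta (X c :: 'a mpoly) = theta_var c"
proof -
  interpret comm_ring_hom "\<lambda>a::'a. to_fract (single (0 :: nat \<times> nat \<Rightarrow>\<^sub>0 nat) a)"
    by (rule comm_ring_hom_to_fract_const)
  show "theta (single 0 a) = to_fract (single 0 a)" "theta (X c :: 'a mpoly) = theta_var c"
    unfolding theta_def by (simp_all del: single_one)
qed

lemma to_fract_quad: "T (quad i) = (\<Sum>k\<in>{1..<m}. (coef i k - coef (Suc i mod r) k) * entry k i)"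
  by (simp add: quad_def to_fract_sum entry_def coef_def)

lemma sum_rows_split2: "(\<Sum>k\<in>{1..<m}. f k) = f 2 + (\<Sum>k\<in>{1..<m} - {2}. f k)" for f :: "nat \<Rightarrow> 'b::comm_ring_1"
  by (rule sum.remove) (use m3 in auto)

lemma sum_rows_split12: "(\<Sum>k\<in>{1..<m}. f k) = f 1 + f 2 + (\<Sum>k\<in>{3..<m}. f k)" for f :: "nat \<Rightarrow> 'b::comm_ring_1"
proof -
  have "{1..<m} = insert 1 (insert 2 {3..<m})" using m3 by auto
  then show ?thesis by (simp add: add.assoc)
qed

lemma sol_quad:
  assumes "1 \<le> i" "i < r - 1"
  shows "(\<Sum>k\<in>{1..<m}. (sol i k - sol (Suc i) k) * entry k i) = (0 :: 'a::field mpoly fract)"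
proof -
  define t where "t = r - 2 - i"
  have t: "r - 2 - t = i" "r - 1 - t = Suc i" "r - 1 - i = Suc t" "r - 1 - Suc i = t" using assms by (auto simp: t_def)
  let ?S = "\<Sum>k\<in>{1..<m} - {2}. (coef (Suc i) k - coef i k) * entry k i :: 'a mpoly fract"
  have "(\<Sum>k\<in>{1..<m}. (sol i k - sol (Suc i) k) * entry k i) =
      (chain_sol (Suc t) - chain_sol t) * entry 2 i + (\<Sum>k\<in>{1..<m} - {2}. (coef i k - coef (Suc i) k) * entry k i :: 'a mpoly fract)"
    unfolding sum_rows_split2 sol_def t by (auto intro!: sum.cong)
  also have "(\<Sum>k\<in>{1..<m} - {2}. (coef i k - coef (Suc i) k) * entry k i) = - ?S"
    by (simp add: sum_negf[symmetric] algebra_simps)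
  also have "(chain_sol (Suc t) - chain_sol t) * entry 2 i = ?S"
    unfolding chain_sol.simps t using entry_nonzero[of 2 i, where ?'a = 'a] by simp
  finally show ?thesis by simp
qed

lemma sol_last: "sol (r - 1) k = coef (r - 1) k"
  by (simp add: sol_def)

lemma to_fract_shared_minor: "T shared_minor = entry 2 0 * entry 1 (r - 1) - entry 1 0 * entry 2 (r - 1)"
  by (simp add: shared_minor_def entry_def)

lemma cramer:
  "sol01 * entry 1 0 + sol02 * entry 2 0 = (rhs0 :: 'a::field mpoly fract)"
  "sol01 * entry 1 (r - 1) + sol02 * entry 2 (r - 1) = (rhs1 :: 'a mpoly fract)"
proof -
  have nz: "T shared_minor \<noteq> (0 :: 'a mpoly fract)" using nonzerodiv_quads(2) by simp
  have k: "sol01 * T shared_minor = entry 2 0 * rhs1 - entry 2 (r - 1) * (rhs0 :: 'a mpoly fract)"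
    "sol02 * T shared_minor = entry 1 (r - 1) * rhs0 - entry 1 0 * (rhs1 :: 'a mpoly fract)"
    using nz by (simp_all add: sol01_def sol02_def)
  have "(sol01 * entry 1 0 + sol02 * entry 2 0) * T shared_minor =
      (sol01 * T shared_minor) * entry 1 0 + (sol02 * T shared_minor) * (entry 2 0 :: 'a mpoly fract)"
    by (simp add: algebra_simps)
  also have "\<dots> = (rhs0 :: 'a mpoly fract) * T shared_minor"
    unfolding k unfolding to_fract_shared_minor by (simp add: algebra_simps)
  finally have "(sol01 * entry 1 0 + sol02 * entry 2 0) * T shared_minor = (rhs0 :: 'a mpoly fract) * T shared_minor" .
  then show "sol01 * entry 1 0 + sol02 * entry 2 0 = (rhs0 :: 'a mpoly fract)" using nz by simp
  have "(sol01 * entry 1 (r - 1) + sol02 * entry 2 (r - 1)) * T shared_minor =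
      (sol01 * T shared_minor) * entry 1 (r - 1) + (sol02 * T shared_minor) * (entry 2 (r - 1) :: 'a mpoly fract)"
    by (simp add: algebra_simps)
  also have "\<dots> = (rhs1 :: 'a mpoly fract) * T shared_minor"
    unfolding k unfolding to_fract_shared_minor by (simp add: algebra_simps)
  finally have "(sol01 * entry 1 (r - 1) + sol02 * entry 2 (r - 1)) * T shared_minor = (rhs1 :: 'a mpoly fract) * T shared_minor" .
  then show "sol01 * entry 1 (r - 1) + sol02 * entry 2 (r - 1) = (rhs1 :: 'a mpoly fract)" using nz by simp
qed

lemma theta_var_entry: "k < m \<Longrightarrow> theta_var (k, j) = T (X (k, j))"
  by (simp add: theta_var_def)

lemma theta_var_coef: "1 \<le> i \<Longrightarrow> i < r \<Longrightarrow> k < m \<Longrightarrow> theta_var (m + i, k) = sol i k"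
  by (simp add: theta_var_def)

lemma theta_var_0: "theta_var (m, 1) = sol01" "theta_var (m, 2) = sol02"
  "3 \<le> k \<Longrightarrow> theta_var (m, k) = coef 0 k"
  using r3 m3 by (auto simp: theta_var_def coef_def)

text \<open>The middle quadrics hold by the recursion for \<open>chain_sol\<close>, the first and
  the last by Cramer's rule.\<close>

lemma theta_quad:
  assumes i: "i < r"
  shows "(\<Sum>k\<in>{1..<m}. (theta_var (m + i, k) - theta_var (m + Suc i mod r, k)) * entry k i) = (0 :: 'a::field mpoly fract)"
proof -
  consider "i = 0" | "1 \<le> i" "i < r - 1" | "i = r - 1" using i by linarith
  then show ?thesis
  proof cases
    case 2
    then have "Suc i mod r = Suc i" "Suc i < r" by auto
    then have "theta_var (m + i, k) = (sol i k :: 'a mpoly fract)"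
      "theta_var (m + Suc i mod r, k) = (sol (Suc i) k :: 'a mpoly fract)" if "k < m" for k
      using 2 theta_var_coef[of i k] theta_var_coef[of "Suc i" k] that by auto
    then have "(\<Sum>k\<in>{1..<m}. (theta_var (m + i, k) - theta_var (m + Suc i mod r, k)) * entry k i) =
        (\<Sum>k\<in>{1..<m}. (sol i k - sol (Suc i) k) * entry k i :: 'a mpoly fract)"
      by (intro sum.cong) simp_all
    then show ?thesis using sol_quad[OF 2] by simp
  next
    case 1
    then have 1: "i = 0" "Suc 0 mod r = 1" using r3 by auto
    have l0: "(\<Sum>k\<in>{1..<m}. theta_var (m, k) * entry k 0) =
        sol01 * entry 1 0 + sol02 * entry 2 0 + (\<Sum>k\<in>{3..<m}. coef 0 k * entry k 0 :: 'a mpoly fract)"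
      unfolding sum_rows_split12 theta_var_0(1,2) by (auto simp: theta_var_0(3) intro!: sum.cong)
    have l1: "(\<Sum>k\<in>{1..<m}. theta_var (m + 1, k) * entry k 0) = (\<Sum>k\<in>{1..<m}. sol 1 k * entry k 0 :: 'a mpoly fract)"
      by (intro sum.cong) (use theta_var_coef[of 1, where ?'a = 'a] r3 in simp_all)
    have "(\<Sum>k\<in>{1..<m}. (theta_var (m + i, k) - theta_var (m + Suc i mod r, k)) * entry k i) =
       (\<Sum>k\<in>{1..<m}. theta_var (m, k) * entry k 0) - (\<Sum>k\<in>{1..<m}. theta_var (m + 1, k) * entry k 0 :: 'a mpoly fract)"
      unfolding 1 by (simp only: left_diff_distrib sum_subtractf add_0_right)
    then show ?thesis unfolding l0 l1 cramer(1) rhs0_def by simp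
  next
    case 3
    then have 3: "i = r - 1" "Suc (r - 1) mod r = 0" using r3 by auto
    have l0: "(\<Sum>k\<in>{1..<m}. theta_var (m, k) * entry k (r - 1)) =
        sol01 * entry 1 (r - 1) + sol02 * entry 2 (r - 1) + (\<Sum>k\<in>{3..<m}. coef 0 k * entry k (r - 1) :: 'a mpoly fract)"
      unfolding sum_rows_split12 theta_var_0(1,2) by (auto simp: theta_var_0(3) intro!: sum.cong)
    have l1: "(\<Sum>k\<in>{1..<m}. theta_var (m + (r - 1), k) * entry k (r - 1)) =
        (\<Sum>k\<in>{1..<m}. coef (r - 1) k * entry k (r - 1) :: 'a mpoly fract)"
      by (intro sum.cong) (use theta_var_coef[of "r - 1", where ?'a = 'a] r3 sol_last[where ?'a = 'a] in simp_all)
    have "(\<Sum>k\<in>{1..<m}. (theta_var (m + i, k) - theta_var (m + Suc i mod r, k)) * entry k i) =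
       (\<Sum>k\<in>{1..<m}. theta_var (m + (r - 1), k) * entry k (r - 1)) - (\<Sum>k\<in>{1..<m}. theta_var (m, k) * entry k (r - 1) :: 'a mpoly fract)"
      unfolding 3 by (simp only: left_diff_distrib sum_subtractf add_0_right)
    then show ?thesis unfolding l0 l1 cramer(2) rhs1_def by simp
  qed
qed

text \<open>Dividing \<open>quad i\<close> by the coefficient \<open>X (2, s i)\<close>, a factor of
  \<open>quad_denom\<close>, shows that modulo the localized ideal the unknown \<open>(i, 2)\<close>
  satisfies the recursion that defines \<open>chain_sol\<close>.\<close>

lemma chain_sol_congruent:
  "t \<le> r - 2 \<Longrightarrow> coef (r - 1 - t) 2 - chain_sol t \<in> loc quad_ideal (quad_denom :: 'a::field mpoly)"
proof (induction t)
  case 0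
  show ?case using loc_0[OF is_ideal_quad_ideal] by simp
next
  case (Suc t)
  define i where "i = r - 2 - t"
  have i: "1 \<le> i" "i < r - 1" "i < r" "r - 1 - t = Suc i" "r - 1 - Suc t = i" "Suc i mod r = Suc i"
    using Suc.prems r3 by (auto simp: i_def)
  have nz: "entry 2 i \<noteq> (0 :: 'a mpoly fract)" by (rule entry_nonzero)
  let ?S = "\<Sum>k\<in>{1..<m} - {2}. (coef (Suc i) k - coef i k) * entry k i :: 'a mpoly fract"
  have "T (quad i) = (coef i 2 - coef (Suc i) 2) * entry 2 i + (\<Sum>k\<in>{1..<m} - {2}. (coef i k - coef (Suc i) k) * entry k i :: 'a mpoly fract)"
    unfolding to_fract_quad sum_rows_split2 i(6) ..
  also have "(\<Sum>k\<in>{1..<m} - {2}. (coef i k - coef (Suc i) k) * entry k i :: 'a mpoly fract) = - ?S"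
    by (simp add: sum_negf[symmetric] algebra_simps)
  finally have q: "T (quad i) = (coef i 2 - coef (Suc i) 2) * entry 2 i + - ?S" .
  define S where "S = ?S / entry 2 i"
  have q: "T (quad i) / entry 2 i = coef i 2 - coef (Suc i) 2 - S"
    unfolding q S_def using nz by (simp add: diff_divide_distrib)
  have t: "chain_sol (Suc t) = chain_sol t + S"
    unfolding chain_sol.simps S_def i(4) i_def[symmetric] ..
  have eq: "coef i 2 - chain_sol (Suc t) = (coef (Suc i) 2 - chain_sol t) + T (quad i) / (entry 2 i :: 'a mpoly fract)"
    unfolding q t by simp
  have "(quad_denom :: 'a mpoly) = X (2, s i) * (shared_minor * (\<Prod>i\<in>{1..<r - 1} - {i}. X (2, s i)))"
    unfolding quad_denom_def using i by (subst prod.remove[of _ i]) (auto simp: mult_ac)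
  then have "T (quad i) / entry 2 i \<in> loc quad_ideal (quad_denom :: 'a mpoly)"
    unfolding entry_def by (rule loc_divide[OF is_ideal_quad_ideal _ quad_denom_nonzero quad_in_loc[OF i(3)]])
  moreover have "coef (Suc i) 2 - chain_sol t \<in> loc quad_ideal (quad_denom :: 'a mpoly)" using Suc i by simp
  ultimately show ?case unfolding i(5) eq by (intro loc_add is_ideal_quad_ideal)
qed

lemma sol_congruent:
  "1 \<le> i \<Longrightarrow> i < r \<Longrightarrow> coef i k - sol i k \<in> loc quad_ideal (quad_denom :: 'a::field mpoly)"
proof -
  assume i: "1 \<le> i" "i < r"
  then have "r - 1 - i \<le> r - 2" "r - 1 - (r - 1 - i) = i" by linarith+
  then show ?thesis
    using chain_sol_congruent[of "r - 1 - i", where ?'a = 'a] loc_0[OF is_ideal_quad_ideal, of "quad_denom :: 'a mpoly"]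
    by (cases "k = 2") (simp_all add: sol_def)
qed

lemma sol0_congruent:
  "coef 0 1 - sol01 \<in> loc quad_ideal (quad_denom :: 'a::field mpoly)" "coef 0 2 - sol02 \<in> loc quad_ideal (quad_denom :: 'a mpoly)"
proof -
  note I = is_ideal_quad_ideal
  let ?L = "loc quad_ideal (quad_denom :: 'a mpoly)"
  have r0: "0 < r" "r - 1 < r" "1 < r" using r3 by auto
  \<comment> \<open>\<open>d0\<close> and \<open>d1\<close> are the errors of the original unknowns
    \<open>(0, 1)\<close> and \<open>(0, 2)\<close> in the two equations solved by
    \<open>sol01\<close> and \<open>sol02\<close>. Cramer's rule for the differences expresses these
    by the errors.\<close>
  define d0 where "d0 = (\<Sum>k\<in>{1..<m}. (coef 1 k - sol 1 k) * entry k 0) + T (quad 0 :: 'a mpoly)"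
  define d1 where "d1 = - T (quad (r - 1) :: 'a mpoly)"
  have d0L: "d0 \<in> ?L" unfolding d0_def
  proof (intro loc_add loc_sum I quad_in_loc r0)
    show "(coef 1 k - sol 1 k) * entry k 0 \<in> ?L" for k
      using loc_mult[OF I _ sol_congruent[of 1 k, where ?'a = 'a], of "entry k 0"] r0
      by (simp add: mult.commute to_fract_in_loc entry_def)
  qed
  have d1L: "d1 \<in> ?L" unfolding d1_def by (intro loc_uminus quad_in_loc I r0)
  have e0: "coef 0 1 * entry 1 0 + coef 0 2 * entry 2 0 = rhs0 + d0"
  proof -
    have "T (quad 0 :: 'a mpoly) = (\<Sum>k\<in>{1..<m}. coef 0 k * entry k 0) - (\<Sum>k\<in>{1..<m}. coef 1 k * entry k 0)"
      using r3 by (simp add: to_fract_quad left_diff_distrib sum_subtractf)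
    moreover have "(\<Sum>k\<in>{1..<m}. coef 0 k * entry k 0) = coef 0 1 * entry 1 0 + coef 0 2 * entry 2 0 + (\<Sum>k\<in>{3..<m}. coef 0 k * entry k 0 :: 'a mpoly fract)"
      by (rule sum_rows_split12)
    moreover have "(\<Sum>k\<in>{1..<m}. (coef 1 k - sol 1 k) * entry k 0) = (\<Sum>k\<in>{1..<m}. coef 1 k * entry k 0) - (\<Sum>k\<in>{1..<m}. sol 1 k * entry k 0 :: 'a mpoly fract)"
      by (simp add: left_diff_distrib sum_subtractf)
    ultimately show ?thesis unfolding d0_def rhs0_def by simp
  qed
  have e1: "coef 0 1 * entry 1 (r - 1) + coef 0 2 * entry 2 (r - 1) = rhs1 + d1"
  proof -
    have "Suc (r - 1) mod r = 0" using r3 by simp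
    then have "T (quad (r - 1) :: 'a mpoly) = (\<Sum>k\<in>{1..<m}. coef (r - 1) k * entry k (r - 1)) - (\<Sum>k\<in>{1..<m}. coef 0 k * entry k (r - 1))"
      unfolding to_fract_quad by (simp only: left_diff_distrib sum_subtractf)
    moreover have "(\<Sum>k\<in>{1..<m}. coef 0 k * entry k (r - 1)) = coef 0 1 * entry 1 (r - 1) + coef 0 2 * entry 2 (r - 1) + (\<Sum>k\<in>{3..<m}. coef 0 k * entry k (r - 1) :: 'a mpoly fract)"
      by (rule sum_rows_split12)
    ultimately show ?thesis unfolding d1_def rhs1_def by simp
  qed
  have xU: "entry k i \<in> loc UNIV (quad_denom :: 'a mpoly)" for k i by (simp add: entry_def to_fract_in_loc)
  have nz: "T shared_minor \<noteq> (0 :: 'a mpoly fract)" using nonzerodiv_quads(2) by simp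
  have quad_denom: "(quad_denom :: 'a mpoly) = shared_minor * (\<Prod>i\<in>{1..<r - 1}. X (2, s i))" by (simp add: quad_denom_def)
  have c0: "sol01 * entry 1 0 + sol02 * entry 2 0 = (rhs0 :: 'a mpoly fract)"
    and c1: "sol01 * entry 1 (r - 1) + sol02 * entry 2 (r - 1) = (rhs1 :: 'a mpoly fract)" by (rule cramer)+
  have d: "d0 = (coef 0 1 - sol01) * entry 1 0 + (coef 0 2 - sol02) * entry 2 0"
    using e0 c0 by (simp add: algebra_simps)
  have d': "d1 = (coef 0 1 - sol01) * entry 1 (r - 1) + (coef 0 2 - sol02) * entry 2 (r - 1)"
    using e1 c1 by (simp add: algebra_simps)
  have "(coef 0 1 - sol01) * T shared_minor = entry 2 0 * d1 - entry 2 (r - 1) * d0"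
    unfolding to_fract_shared_minor d d' by (simp add: algebra_simps)
  then have s1: "coef 0 1 - sol01 = (entry 2 0 * d1 - entry 2 (r - 1) * d0) / T shared_minor"
    using nz by (simp add: nonzero_eq_divide_eq)
  have "(coef 0 2 - sol02) * T shared_minor = entry 1 (r - 1) * d0 - entry 1 0 * d1"
    unfolding to_fract_shared_minor d d' by (simp add: algebra_simps)
  then have s2: "coef 0 2 - sol02 = (entry 1 (r - 1) * d0 - entry 1 0 * d1) / T shared_minor"
    using nz by (simp add: nonzero_eq_divide_eq)
  show "coef 0 1 - sol01 \<in> ?L" unfolding s1
    by (rule loc_divide[OF I quad_denom quad_denom_nonzero]) (simp_all add: loc_diff loc_mult I d0L d1L xU)
  show "coef 0 2 - sol02 \<in> ?L" unfolding s2
    by (rule loc_divide[OF I quad_denom quad_denom_nonzero]) (simp_all add: loc_diff loc_mult I d0L d1L xU)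
qed

lemma theta_var_congruent: "T (X c) - theta_var c \<in> loc quad_ideal (quad_denom :: 'a::field mpoly)"
proof (cases "m \<le> fst c \<and> fst c < m + r \<and> snd c < m")
  case False
  then have "theta_var c = T (X c :: 'a mpoly)" unfolding theta_var_def by (rule if_not_P)
  then show ?thesis using loc_0[OF is_ideal_quad_ideal, where ?g = "quad_denom :: 'a mpoly"] by simp
next
  case True
  then obtain i k where c: "c = (m + i, k)" "i < r" "k < m"
    by (cases c) (auto simp: le_iff_add)
  show ?thesis
  proof (cases "i = 0")
    case False
    then show ?thesis
      using sol_congruent[of i k, where ?'a = 'a] theta_var_coef[of i k, where ?'a = 'a] c by (simp add: coef_def)
  next
    case True
    then show ?thesis
      using sol0_congruent[where ?'a = 'a] c loc_0[OF is_ideal_quad_ideal, where ?g = "quad_denom :: 'a mpoly"]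
      by (auto simp: theta_var_def coef_def)
  qed
qed

text \<open>\<open>theta\<close> changes each variable only by an element of the localized ideal of
  the quadrics, so a polynomial killed by \<open>theta\<close> lies in that ideal, and
  \<open>quad_denom\<close> can be cancelled.\<close>

lemma theta_kernel:
  fixes p :: "'a::field mpoly"
  assumes "theta p = 0"
  shows "p \<in> quad_ideal"
proof -
  have "T p - theta p \<in> loc quad_ideal quad_denom"
    by (rule loc_congruent[OF comm_ring_hom_theta theta_const is_ideal_quad_ideal, where S = UNIV])
      (simp_all add: theta_var_congruent theta_X del: One_nat_def)
  then show ?thesis using loc_contract[OF nonzerodiv_quad_denom] assms by simp
qed

end

subsection \<open>The chart given by one basis of columns in each clique\<close>

text \<open>\<open>e i\<close> lists \<open>m - 1\<close> private columns of clique
  \<open>i\<close>, the basis used to express row 0. The list is increasing because the column order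
  keeps the numbering inside this block.\<close>

locale cycle_columns =
  fixes r m :: nat and W :: "nat \<Rightarrow> nat set" and s :: "nat \<Rightarrow> nat" and e :: "nat \<Rightarrow> nat \<Rightarrow> nat"
  assumes cyclic: "cyclic_family r W s" and m_ge_3: "m \<ge> 3"
    and e_mono: "\<And>i p q. i < r \<Longrightarrow> p < q \<Longrightarrow> q < m - 1 \<Longrightarrow> e i p < e i q"
    and e_mem: "\<And>i q. i < r \<Longrightarrow> q < m - 1 \<Longrightarrow> e i q \<in> W i"
    and e_priv: "\<And>i q j. i < r \<Longrightarrow> q < m - 1 \<Longrightarrow> j \<noteq> i \<Longrightarrow> j < r \<Longrightarrow> e i q \<notin> W j"

sublocale cycle_columns \<subseteq> cycle_quadrics r m s
proof
  show "r \<ge> 3" "inj_on s {..<r}" using cyclic unfolding cyclic_family_def by blast+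
qed (rule m_ge_3)

context cycle_columns
begin

definition clique_ideal :: "'a::field mpoly set" where
  "clique_ideal = idl (\<Union>i<r. minors m (W i))"

lemma is_ideal_clique_ideal: "is_ideal clique_ideal"
  unfolding clique_ideal_def by (rule is_ideal_idl)

definition basis_minor :: "nat \<Rightarrow> 'a::field mpoly" where
  "basis_minor i = gen_det (m - 1) Suc (e i)"

definition basis_minor_prod :: "'a::field mpoly" where
  "basis_minor_prod = (\<Prod>i<r. basis_minor i)"

text \<open>Signed so that \<open>basis_cofactor i k\<close> divided by \<open>basis_minor i\<close>
  is the coefficient of row \<open>k\<close> in the expression of row 0 on clique
  \<open>i\<close>.\<close>

definition basis_cofactor :: "nat \<Rightarrow> nat \<Rightarrow> 'a::field mpoly" where
  "basis_cofactor i k = - ((- 1) ^ k * gen_det (m - 1) (\<lambda>q. if q < k then q else Suc q) (e i))"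

lemma nonzerodiv_basis_minor:
  assumes "i < r"
  shows "nonzerodiv_mod (basis_minor i :: 'a::field mpoly) clique_ideal"
  unfolding basis_minor_def clique_ideal_def
  by (rule nonzerodiv_clique[OF cyclic m_ge_3 assms e_mono[OF assms] e_mem[OF assms] e_priv[OF assms]])

text \<open>All the minors vanish at the origin.\<close>

lemma one_notin_clique_ideal: "(1 :: 'a::field mpoly) \<notin> clique_ideal"
proof
  assume one: "(1 :: 'a mpoly) \<in> clique_ideal"
  interpret h: comm_ring_hom "\<lambda>a::'a. [:a:]" by standard (simp_all add: one_pCons[symmetric] mult.commute)
  let ?z = "subst_poly (\<lambda>a::'a. [:a:]) (\<lambda>_. 0)"
  interpret z: comm_ring_hom ?z by (rule h.comm_ring_hom_subst_poly)
  have I: "is_ideal {p. ?z p = 0}" by (auto simp: is_ideal_def z.hom_add z.hom_mult)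
  have "(\<Union>i<r. minors m (W i)) \<subseteq> {p. ?z p = 0}"
  proof
    fix p :: "'a mpoly" assume "p \<in> (\<Union>i<r. minors m (W i))"
    then obtain F where p: "p = minor m F" by (auto simp: minors_def)
    let ?c = "\<lambda>j. sorted_list_of_set F ! j"
    have "?z p = det (map_mat ?z (mat m m (\<lambda>(i, j). X (id i, ?c j))))"
      by (simp only: p minor_eq_gen_det gen_det_def z.hom_det)
    also have "map_mat ?z (mat m m (\<lambda>(i, j). X (id i, ?c j))) = 0\<^sub>m m m"
      by (rule eq_matI) (simp_all add: h.subst_poly_single)
    also have "det \<dots> = 0" using m_ge_3 by simp
    finally show "p \<in> {p. ?z p = 0}" by simp
  qed
  from subsetD[OF idl_least[OF I this] one[unfolded clique_ideal_def]] have "?z 1 = 0" by simp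
  then show False by (simp add: z.hom_one)
qed

text \<open>Zero is a nonzerodivisor only modulo the unit ideal.\<close>

lemma basis_minor_nonzero: "i < r \<Longrightarrow> (basis_minor i :: 'a::field mpoly) \<noteq> 0"
proof
  assume i: "i < r" and "basis_minor i = (0 :: 'a mpoly)"
  then have "basis_minor i * 1 \<in> (clique_ideal :: 'a mpoly set)" using is_idealD(1)[OF is_ideal_clique_ideal] by simp
  then show False using nonzerodiv_basis_minor[OF i] one_notin_clique_ideal unfolding nonzerodiv_mod_def by blast
qed

lemma basis_minor_prod_nonzero: "(basis_minor_prod :: 'a::field mpoly) \<noteq> 0"
  unfolding basis_minor_prod_def using basis_minor_nonzero[where ?'a = 'a] by simp

lemma nonzerodiv_basis_minor_prod: "nonzerodiv_mod (basis_minor_prod :: 'a::field mpoly) clique_ideal"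
  unfolding basis_minor_prod_def by (rule nonzerodiv_mod_prod) (use nonzerodiv_basis_minor in auto)

lemma basis_minor_prod_factor: "i < r \<Longrightarrow> basis_minor_prod = basis_minor i * (\<Prod>j\<in>{..<r} - {i}. basis_minor j)"
  unfolding basis_minor_prod_def by (rule prod.remove) auto

lemma gen_det_expand:
  "gen_det m id (\<lambda>q. if q = 0 then j else e i (q - 1)) =
     basis_minor i * X (0, j) - (\<Sum>k\<in>{1..<m}. basis_cofactor i k * X (k, j) :: 'a::field mpoly)"
proof -
  let ?A = "mat m m (\<lambda>(k, q). X (id k, if q = 0 then j else e i (q - 1))) :: 'a mpoly mat"
  have cofactor: "cofactor ?A k 0 = (- 1) ^ k * gen_det (m - 1) (\<lambda>q. if q < k then q else Suc q) (e i)"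
    if "k < m" for k
  proof -
    have "mat_delete ?A k 0 = mat (m - 1) (m - 1) (\<lambda>(i', j'). X (if i' < k then i' else Suc i', e i j'))"
      unfolding mat_delete_def by (rule eq_matI) auto
    then show ?thesis by (simp add: cofactor_def gen_det_def)
  qed
  have "gen_det m id (\<lambda>q. if q = 0 then j else e i (q - 1)) = det ?A" by (simp only: gen_det_def)
  also have "\<dots> = (\<Sum>k<m. ?A $$ (k, 0) * cofactor ?A k 0)"
    by (rule laplace_expansion_column) (use m_ge_3 in auto)
  also have "\<dots> = (\<Sum>k<m. X (k, j) * ((- 1) ^ k * gen_det (m - 1) (\<lambda>q. if q < k then q else Suc q) (e i)))"
    using m_ge_3 cofactor by (intro sum.cong) auto
  also have "{..<m} = insert 0 {1..<m}" using m_ge_3 by auto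
  also have "(\<Sum>k\<in>insert 0 {1..<m}. X (k, j) * ((- 1) ^ k * gen_det (m - 1) (\<lambda>q. if q < k then q else Suc q) (e i))) =
      basis_minor i * X (0, j) - (\<Sum>k\<in>{1..<m}. basis_cofactor i k * X (k, j) :: 'a mpoly)"
    by (simp add: basis_minor_def basis_cofactor_def sum_negf[symmetric] mult_ac)
  finally show ?thesis .
qed

lemma expand_in_clique_ideal:
  assumes "i < r" "j \<in> W i"
  shows "basis_minor i * X (0, j) - (\<Sum>k\<in>{1..<m}. basis_cofactor i k * X (k, j)) \<in> (clique_ideal :: 'a::field mpoly set)"
proof -
  have "gen_det m id (\<lambda>q. if q = 0 then j else e i (q - 1)) \<in> (idl (minors m (W i)) :: 'a mpoly set)"
    by (rule gen_det_in_minors) (use assms e_mem in auto)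
  moreover have "idl (minors m (W i)) \<subseteq> (clique_ideal :: 'a mpoly set)"
    unfolding clique_ideal_def by (rule idl_mono) (use assms in auto)
  ultimately show ?thesis unfolding gen_det_expand by blast
qed

text \<open>Inserts the actual values of the coefficients for the unknowns. After the elimination of
  row 0 this gives back every polynomial in the rows below \<open>m\<close>, up to the localized
  clique ideal.\<close>

definition chart_var :: "nat \<times> nat \<Rightarrow> 'a::field mpoly fract" where
  "chart_var c = (if m \<le> fst c \<and> fst c < m + r \<and> snd c < m
     then T (basis_cofactor (fst c - m) (snd c)) / T (basis_minor (fst c - m)) else T (X c))"

definition chart :: "'a::field mpoly \<Rightarrow> 'a mpoly fract" where
  "chart = subst_poly (\<lambda>a. to_fract (single 0 a)) chart_var"

lemma comm_ring_hom_chart: "comm_ring_hom (chart :: 'a::field mpoly \<Rightarrow> _)"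
  and chart_const: "chart (single 0 (a::'a)) = to_fract (single 0 a)"
  and chart_X: "chart (X c :: 'a mpoly) = chart_var c"
proof -
  interpret comm_ring_hom "\<lambda>a::'a. to_fract (single (0 :: nat \<times> nat \<Rightarrow>\<^sub>0 nat) a)"
    by (rule comm_ring_hom_to_fract_const)
  show "comm_ring_hom (chart :: 'a mpoly \<Rightarrow> _)" unfolding chart_def by (rule comm_ring_hom_subst_poly)
  show "chart (single 0 a) = to_fract (single 0 a)" "chart (X c :: 'a mpoly) = chart_var c"
    unfolding chart_def by (simp_all del: single_one)
qed

lemma column_congruent:
  assumes i: "i < r" "j \<in> W i"
  shows "T (X (0, j)) - (\<Sum>k\<in>{1..<m}. chart_var (m + i, k) * T (X (k, j))) \<in> loc clique_ideal (basis_minor_prod :: 'a::field mpoly)"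
proof -
  have g: "T (basis_minor i) \<noteq> (0 :: 'a mpoly fract)" using basis_minor_nonzero i by simp
  have lv: "chart_var (m + i, k) = T (basis_cofactor i k) / (T (basis_minor i) :: 'a mpoly fract)" if "k < m" for k
    using i that by (simp add: chart_var_def)
  have "(\<Sum>k\<in>{1..<m}. chart_var (m + i, k) * T (X (k, j))) =
      (\<Sum>k\<in>{1..<m}. T (basis_cofactor i k * X (k, j)) / (T (basis_minor i) :: 'a mpoly fract))"
    by (rule sum.cong) (simp_all add: lv)
  also have "\<dots> = T (\<Sum>k\<in>{1..<m}. basis_cofactor i k * X (k, j)) / T (basis_minor i)"
    by (simp add: to_fract_sum sum_divide_distrib)
  finally have "T (X (0, j)) - (\<Sum>k\<in>{1..<m}. chart_var (m + i, k) * T (X (k, j))) =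
      T (basis_minor i * X (0, j) - (\<Sum>k\<in>{1..<m}. basis_cofactor i k * X (k, j))) / (T (basis_minor i) :: 'a mpoly fract)"
    using g by (simp add: diff_divide_distrib)
  also have "\<dots> \<in> loc clique_ideal basis_minor_prod"
    by (rule loc_divide[OF is_ideal_clique_ideal basis_minor_prod_factor[OF i(1)] basis_minor_prod_nonzero])
      (rule to_fract_in_loc[OF expand_in_clique_ideal[OF i]])
  finally show ?thesis .
qed

lemma chart_var_entry: "k < m \<Longrightarrow> chart_var (k, j) = T (X (k, j))"
  by (simp add: chart_var_def)

text \<open>The column \<open>s i\<close> satisfies the row relations of both of its cliques, and
  the quadric is their difference.\<close>

lemma chart_quad:
  assumes i: "i < r"
  shows "chart (quad i) \<in> loc clique_ideal (basis_minor_prod :: 'a::field mpoly)"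
proof -
  interpret comm_ring_hom "chart :: 'a mpoly \<Rightarrow> _" by (rule comm_ring_hom_chart)
  let ?j = "Suc i mod r"
  let ?S = "\<lambda>i' :: nat. \<Sum>k\<in>{1..<m}. chart_var (m + i', k) * T (X (k, s i)) :: 'a mpoly fract"
  have "chart (quad i :: 'a mpoly) = (\<Sum>k\<in>{1..<m}. (chart_var (m + i, k) - chart_var (m + ?j, k)) * chart_var (k, s i))"
    unfolding quad_def hom_sum hom_mult hom_minus chart_X ..
  also have "\<dots> = (\<Sum>k\<in>{1..<m}. (chart_var (m + i, k) - chart_var (m + ?j, k)) * T (X (k, s i)))"
    by (rule sum.cong) (simp_all add: chart_var_entry)
  also have "\<dots> = ?S i - ?S ?j" by (simp only: left_diff_distrib sum_subtractf)
  also have "\<dots> = (T (X (0, s i)) - ?S ?j) - (T (X (0, s i)) - ?S i)" by simp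
  also have "\<dots> \<in> loc clique_ideal basis_minor_prod"
    by (intro loc_diff is_ideal_clique_ideal column_congruent cyclic_family_s[OF cyclic] i) (use r3 in auto)
  finally show ?thesis .
qed

lemma chart_in_loc: "chart p \<in> loc UNIV (basis_minor_prod :: 'a::field mpoly)"
proof -
  interpret comm_ring_hom "chart :: 'a mpoly \<Rightarrow> _" by (rule comm_ring_hom_chart)
  note U = is_ideal_UNIV
  have "\<forall>u\<in>keys p. keys u \<subseteq> UNIV" by simp
  then show ?thesis
  proof (induction rule: poly_vars_induct)
    case (const a)
    show ?case unfolding chart_const by (simp add: to_fract_in_loc)
  next
    case (var c)
    show ?case
    proof (cases "m \<le> fst c \<and> fst c < m + r \<and> snd c < m")
      case True
      have i: "fst c - m < r" using True by auto
      show ?thesis unfolding chart_X chart_var_def if_P[OF True]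
        by (rule loc_divide[OF U basis_minor_prod_factor[OF i] basis_minor_prod_nonzero]) (simp add: to_fract_in_loc)
    next
      case False
      show ?thesis unfolding chart_X chart_var_def if_not_P[OF False] by (simp add: to_fract_in_loc)
    qed
  next
    case (add p q)
    then show ?case unfolding hom_add by (rule loc_add[OF U])
  next
    case (mult p q)
    then show ?case unfolding hom_mult by (rule loc_mult[OF U])
  qed
qed

lemma chart_quad_ideal:
  assumes "p \<in> quad_ideal"
  shows "chart p \<in> loc clique_ideal (basis_minor_prod :: 'a::field mpoly)"
proof -
  interpret comm_ring_hom "chart :: 'a mpoly \<Rightarrow> _" by (rule comm_ring_hom_chart)
  let ?K = "{p. chart p \<in> loc clique_ideal (basis_minor_prod :: 'a mpoly)}"
  have I: "is_ideal ?K"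
    unfolding is_ideal_def
    by (auto simp: hom_add hom_mult loc_0 loc_add loc_mult is_ideal_clique_ideal chart_in_loc)
  have "(\<Union>i<r. {quad i}) \<subseteq> ?K" using chart_quad by auto
  from subsetD[OF idl_least[OF I this] assms[unfolded quad_ideal_def]] show ?thesis by simp
qed

section \<open>Elimination of row 0 and the homomorphism to a field\<close>

definition clique_of :: "nat \<Rightarrow> nat" where
  "clique_of j = (SOME i. i < r \<and> j \<in> W i)"

lemma clique_of: "i < r \<Longrightarrow> j \<in> W i \<Longrightarrow> clique_of j < r \<and> j \<in> W (clique_of j)"
  unfolding clique_of_def by (rule someI[of _ i]) simp

definition elim_var :: "nat \<times> nat \<Rightarrow> 'a::field mpoly" where
  "elim_var c = (if fst c = 0 \<and> (\<exists>i<r. snd c \<in> W i)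
     then \<Sum>k\<in>{1..<m}. X (m + clique_of (snd c), k) * X (k, snd c) else X c)"

definition elim :: "'a::field mpoly \<Rightarrow> 'a mpoly" where
  "elim = subst_poly (\<lambda>a. single 0 a) elim_var"

lemma comm_ring_hom_elim: "comm_ring_hom (elim :: 'a::field mpoly \<Rightarrow> _)"
  and elim_const: "elim (single 0 (a::'a)) = single 0 a"
  and elim_X: "elim (X c :: 'a mpoly) = elim_var c"
proof -
  interpret comm_ring_hom "\<lambda>a::'a. single (0 :: nat \<times> nat \<Rightarrow>\<^sub>0 nat) a"
    by standard (simp_all add: single_add mult_single)
  show "comm_ring_hom (elim :: 'a mpoly \<Rightarrow> _)" unfolding elim_def by (rule comm_ring_hom_subst_poly)
  show "elim (single 0 a) = single 0 a" "elim (X c :: 'a mpoly) = elim_var c"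
    unfolding elim_def by (simp_all del: single_one)
qed

definition param :: "'a::field mpoly \<Rightarrow> 'a mpoly fract" where
  "param p = theta (elim p)"

lemma comm_ring_hom_param: "comm_ring_hom (param :: 'a::field mpoly \<Rightarrow> _)"
proof -
  interpret e: comm_ring_hom "elim :: 'a mpoly \<Rightarrow> _" by (rule comm_ring_hom_elim)
  interpret t: comm_ring_hom "theta :: 'a mpoly \<Rightarrow> _" by (rule comm_ring_hom_theta)
  show ?thesis by standard (simp_all add: param_def e.hom_add e.hom_mult t.hom_add t.hom_mult)
qed

text \<open>The two localizations combine: \<open>elim p\<close> lies in \<open>quad_ideal\<close>,
  \<open>chart\<close> carries it into the localized clique ideal, and there it is congruent to
  \<open>p\<close>. The assumption on the variables keeps \<open>p\<close> away from the rows that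
  hold the unknowns.\<close>

lemma param_kernel:
  fixes p :: "'a::field mpoly"
  assumes vars: "\<forall>u\<in>keys p. keys u \<subseteq> {..<m} \<times> UNIV" and p: "param p = 0"
  shows "p \<in> clique_ideal"
proof -
  interpret e: comm_ring_hom "elim :: 'a mpoly \<Rightarrow> _" by (rule comm_ring_hom_elim)
  interpret l: comm_ring_hom "chart :: 'a mpoly \<Rightarrow> _" by (rule comm_ring_hom_chart)
  let ?Phi = "\<lambda>p. chart (elim p :: 'a mpoly)"
  have hom: "comm_ring_hom ?Phi"
    by standard (simp_all add: e.hom_add e.hom_mult l.hom_add l.hom_mult)
  have const: "?Phi (single 0 a) = to_fract (single 0 a)" for a
    by (simp only: elim_const chart_const)
  have var: "T (X c) - ?Phi (X c) \<in> loc clique_ideal basis_minor_prod" if c: "c \<in> {..<m} \<times> UNIV" for c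
  proof (cases "fst c = 0 \<and> (\<exists>i<r. snd c \<in> W i)")
    case False
    have "?Phi (X c) = T (X c)"
      unfolding elim_X elim_var_def if_not_P[OF False] chart_X using c chart_var_entry[of "fst c" "snd c", where ?'a = 'a] by auto
    then show ?thesis using loc_0[OF is_ideal_clique_ideal, where ?g = "basis_minor_prod :: 'a mpoly"] by simp
  next
    case True
    then obtain j where j: "c = (0, j)" and "\<exists>i<r. j \<in> W i" by (cases c) auto
    then have i: "clique_of j < r" "j \<in> W (clique_of j)" using clique_of by blast+
    have "?Phi (X c) = (\<Sum>k\<in>{1..<m}. chart_var (m + clique_of j, k) * chart_var (k, j))"
      unfolding elim_X elim_var_def if_P[OF True] l.hom_sum l.hom_mult chart_X by (simp add: j)
    also have "\<dots> = (\<Sum>k\<in>{1..<m}. chart_var (m + clique_of j, k) * T (X (k, j)))"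
      by (rule sum.cong) (simp_all add: chart_var_entry)
    finally show ?thesis unfolding j using column_congruent[OF i, where ?'a = 'a] by simp
  qed
  have "elim p \<in> quad_ideal" using p theta_kernel unfolding param_def by blast
  then have "?Phi p \<in> loc clique_ideal basis_minor_prod" by (rule chart_quad_ideal)
  moreover have "T p - ?Phi p \<in> loc clique_ideal basis_minor_prod"
    by (rule loc_congruent[OF hom const is_ideal_clique_ideal var vars])
  ultimately have "(T p - ?Phi p) + ?Phi p \<in> loc clique_ideal basis_minor_prod" by (intro loc_add is_ideal_clique_ideal)
  then have "T p \<in> loc clique_ideal basis_minor_prod" by simp
  then show ?thesis by (rule loc_contract[OF nonzerodiv_basis_minor_prod])
qed

text \<open>For a shared column \<open>clique_of\<close> makes an arbitrary choice. It does not
  matter after \<open>theta\<close>, because the quadric of that column has been solved.\<close>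

lemma param_column:
  assumes i: "i < r" "j \<in> W i"
  shows "param (X (0, j)) = (\<Sum>k\<in>{1..<m}. theta_var (m + i, k) * T (X (k, j)) :: 'a::field mpoly fract)"
proof -
  interpret t: comm_ring_hom "theta :: 'a mpoly \<Rightarrow> _" by (rule comm_ring_hom_theta)
  let ?S = "\<lambda>i. \<Sum>k\<in>{1..<m}. theta_var (m + i, k) * T (X (k, j)) :: 'a mpoly fract"
  have ex: "fst (0 :: nat, j) = 0 \<and> (\<exists>i<r. snd (0 :: nat, j) \<in> W i)" using i by auto
  let ?c = "clique_of j"
  have c: "?c < r" "j \<in> W ?c" using clique_of[OF i] by auto
  have "param (X (0, j) :: 'a mpoly) = (\<Sum>k\<in>{1..<m}. theta_var (m + ?c, k) * theta_var (k, j))"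
    unfolding param_def elim_X elim_var_def if_P[OF ex] t.hom_sum t.hom_mult theta_X by simp
  also have "\<dots> = ?S ?c"
    by (rule sum.cong) (simp_all add: theta_var_entry)
  also have "?S ?c = ?S i"
  proof (cases "?c = i")
    case False
    have eq: "?S l = ?S (Suc l mod r)" if l: "l < r" "j = s l" for l
    proof -
      have "?S l - ?S (Suc l mod r) = (\<Sum>k\<in>{1..<m}. (theta_var (m + l, k) - theta_var (m + Suc l mod r, k)) * entry k l)"
        unfolding entry_def l(2) by (simp only: left_diff_distrib sum_subtractf)
      then show ?thesis using theta_quad[OF l(1), where ?'a = 'a] by simp
    qed
    from cyclic_family_shared[OF cyclic c(1) i(1) False c(2) i(2)] show ?thesis
      using eq[of ?c] eq[of i] c(1) i(1) by auto
  qed simp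
  finally show ?thesis .
qed

lemma param_entry: "0 < k \<Longrightarrow> k < m \<Longrightarrow> param (X (k, j) :: 'a::field mpoly) = T (X (k, j))"
  using theta_var_entry[of k j, where ?'a = 'a] theta_X[of "(k, j)", where ?'a = 'a]
  by (simp add: param_def elim_X[unfolded One_nat_def] elim_var_def)

text \<open>On the columns of one clique the image of row 0 is a fixed linear combination of the
  other rows, so the image of the matrix factors through dimension \<open>m - 1\<close>.\<close>

lemma param_clique_ideal:
  fixes p :: "'a::field mpoly"
  assumes "p \<in> clique_ideal"
  shows "param p = 0"
proof -
  interpret p: comm_ring_hom "param :: 'a mpoly \<Rightarrow> _" by (rule comm_ring_hom_param)
  have I: "is_ideal {p :: 'a mpoly. param p = 0}" by (auto simp: is_ideal_def p.hom_add p.hom_mult)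
  have "(\<Union>i<r. minors m (W i)) \<subseteq> {p :: 'a mpoly. param p = 0}"
  proof
    fix q :: "'a mpoly" assume "q \<in> (\<Union>i<r. minors m (W i))"
    then obtain i F where i: "i < r" and F: "F \<subseteq> W i" "card F = m" "q = minor m F" by (auto simp: minors_def)
    have finF: "finite F" by (rule card_ge_0_finite) (use F m_ge_3 in simp)
    let ?c = "\<lambda>j. sorted_list_of_set F ! j"
    have c: "?c j \<in> W i" if "j < m" for j
      using F finF that by (metis length_sorted_list_of_set nth_mem set_sorted_list_of_set subsetD)
    let ?Y = "\<lambda>k q. if k = 0 then theta_var (m + i, Suc q) else if k = Suc q then 1 else (0 :: 'a mpoly fract)"
    let ?Z = "\<lambda>q j. T (X (Suc q, ?c j)) :: 'a mpoly fract"
    have "param q = det (map_mat param (mat m m (\<lambda>(i, j). X (id i, ?c j) :: 'a mpoly)))"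
      by (simp only: F(3) minor_eq_gen_det gen_det_def p.hom_det)
    also have "map_mat param (mat m m (\<lambda>(i, j). X (id i, ?c j) :: 'a mpoly)) =
        mat m m (\<lambda>(k, j). \<Sum>q<m - 1. ?Y k q * ?Z q j)"
    proof (rule eq_matI)
      fix k j assume "k < dim_row (mat m m (\<lambda>(k, j). \<Sum>q<m - 1. ?Y k q * ?Z q j))"
        "j < dim_col (mat m m (\<lambda>(k, j). \<Sum>q<m - 1. ?Y k q * ?Z q j))"
      then have kj: "k < m" "j < m" by auto
      have "param (X (k, ?c j) :: 'a mpoly) = (\<Sum>q<m - 1. ?Y k q * ?Z q j)"
      proof (cases "k = 0")
        case True
        have "param (X (k, ?c j) :: 'a mpoly) = (\<Sum>k\<in>{1..<m}. theta_var (m + i, k) * T (X (k, ?c j)))"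
          unfolding True by (rule param_column[OF i c[OF kj(2)]])
        also have "\<dots> = (\<Sum>q<m - 1. theta_var (m + i, Suc q) * T (X (Suc q, ?c j)))"
          by (rule sum.reindex_bij_witness[of _ Suc "\<lambda>k. k - 1"]) auto
        finally show ?thesis unfolding True by simp
      next
        case False
        have "(\<Sum>q<m - 1. ?Y k q * ?Z q j) = (\<Sum>q<m - 1. if q = k - 1 then ?Z q j else 0)"
          by (rule sum.cong) (use False in auto)
        also have "\<dots> = T (X (k, ?c j))" using False kj by auto
        finally show ?thesis using param_entry[of k "?c j", where ?'a = 'a] False kj by simp
      qed
      then show "map_mat param (mat m m (\<lambda>(i, j). X (id i, ?c j) :: 'a mpoly)) $$ (k, j) =
          mat m m (\<lambda>(k, j). \<Sum>q<m - 1. ?Y k q * ?Z q j) $$ (k, j)"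
        using kj by simp
    qed auto
    also have "det \<dots> = 0" by (rule det_low_rank) (use m_ge_3 in simp)
    finally show "q \<in> {p :: 'a mpoly. param p = 0}" by simp
  qed
  from subsetD[OF idl_least[OF I this] assms[unfolded clique_ideal_def]] show ?thesis by simp
qed

end

subsection \<open>Restriction to the given columns\<close>

lemma polyring_single: "keys u \<subseteq> {0..<m} \<times> {1..n} \<Longrightarrow> single u a \<in> polyring m n"
  by (auto simp: polyring_def split: if_splits)

lemma polyring_0: "0 \<in> polyring m n"
  by (simp add: polyring_def)

lemma polyring_add: "p \<in> polyring m n \<Longrightarrow> q \<in> polyring m n \<Longrightarrow> p + q \<in> polyring m n"
  using Poly_Mapping.keys_add[of p q] unfolding polyring_def by blast

lemma polyring_mult:
  assumes "p \<in> polyring m n" "q \<in> polyring m n"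
  shows "p * q \<in> polyring m n"
  unfolding polyring_def
proof (intro CollectI ballI)
  fix u assume "u \<in> keys (p * q)"
  then obtain v w where "u = v + w" "v \<in> keys p" "w \<in> keys q" using Poly_Mapping.keys_mult[of p q] by blast
  then show "keys u \<subseteq> {0..<m} \<times> {1..n}"
    using assms Poly_Mapping.keys_add[of v w] unfolding polyring_def by blast
qed

lemma polyring_sum: "(\<And>i. i \<in> A \<Longrightarrow> f i \<in> polyring m n) \<Longrightarrow> sum f A \<in> polyring m n"
  by (induction A rule: infinite_finite_induct) (auto intro: polyring_0 polyring_add)

definition retract :: "nat \<Rightarrow> nat \<Rightarrow> 'a::comm_ring_1 mpoly \<Rightarrow> 'a mpoly" where
  "retract m n = subst_poly (\<lambda>a. single 0 a) (\<lambda>c. if c \<in> {0..<m} \<times> {1..n} then X c else 0)"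

lemma comm_ring_hom_retract: "comm_ring_hom (retract m n :: 'a::comm_ring_1 mpoly \<Rightarrow> _)"
  and retract_const: "retract m n (single 0 (a::'a)) = single 0 a"
  and retract_X: "retract m n (X c :: 'a mpoly) = (if c \<in> {0..<m} \<times> {1..n} then X c else 0)"
proof -
  interpret comm_ring_hom "\<lambda>a::'a. single (0 :: nat \<times> nat \<Rightarrow>\<^sub>0 nat) a"
    by standard (simp_all add: single_add mult_single)
  show "comm_ring_hom (retract m n :: 'a mpoly \<Rightarrow> _)" unfolding retract_def by (rule comm_ring_hom_subst_poly)
  show "retract m n (single 0 a) = single 0 a"
    "retract m n (X c :: 'a mpoly) = (if c \<in> {0..<m} \<times> {1..n} then X c else 0)"
    unfolding retract_def by (simp_all del: single_one)
qed

lemma retract_in_polyring: "retract m n (p :: 'a::comm_ring_1 mpoly) \<in> polyring m n"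
proof -
  interpret comm_ring_hom "retract m n :: 'a mpoly \<Rightarrow> _" by (rule comm_ring_hom_retract)
  have "\<forall>u\<in>keys p. keys u \<subseteq> UNIV" by simp
  then show ?thesis
  proof (induction rule: poly_vars_induct)
    case (const a)
    show ?case unfolding retract_const by (rule polyring_single) simp
  next
    case (var c)
    show ?case unfolding retract_X by (auto intro!: polyring_single polyring_0)
  next
    case (add p q)
    then show ?case unfolding hom_add by (rule polyring_add)
  next
    case (mult p q)
    then show ?case unfolding hom_mult by (rule polyring_mult)
  qed
qed

lemma retract_id:
  assumes "p \<in> polyring m n"
  shows "retract m n (p :: 'a::comm_ring_1 mpoly) = p"
proof -
  interpret comm_ring_hom "retract m n :: 'a mpoly \<Rightarrow> _" by (rule comm_ring_hom_retract)
  have "\<forall>u\<in>keys p. keys u \<subseteq> {0..<m} \<times> {1..n}" using assms by (simp add: polyring_def)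
  then show ?thesis
  proof (induction rule: poly_vars_induct)
    case (const a)
    show ?case by (rule retract_const)
  next
    case (var c)
    then show ?case unfolding retract_X by (simp only: if_True)
  next
    case (add p q)
    then show ?case by (simp only: hom_add)
  next
    case (mult p q)
    then show ?case by (simp only: hom_mult)
  qed
qed

lemma retract_minor:
  assumes F: "card F = m" "m > 0"
  shows "retract m n (minor m F) = (if F \<subseteq> {1..n} then minor m F else (0 :: 'a::comm_ring_1 mpoly))"
proof -
  interpret comm_ring_hom "retract m n :: 'a mpoly \<Rightarrow> _" by (rule comm_ring_hom_retract)
  have finF: "finite F" by (rule card_ge_0_finite) (simp add: F)
  let ?c = "\<lambda>j. sorted_list_of_set F ! j"
  let ?A = "mat m m (\<lambda>(i, j). X (id i, ?c j)) :: 'a mpoly mat"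
  have c: "?c j \<in> F" if "j < m" for j
    using F finF that by (metis length_sorted_list_of_set nth_mem set_sorted_list_of_set)
  have det: "retract m n (minor m F :: 'a mpoly) = det (map_mat (retract m n) ?A)"
    by (simp only: minor_eq_gen_det gen_det_def hom_det)
  show ?thesis
  proof (cases "F \<subseteq> {1..n}")
    case True
    have "map_mat (retract m n) ?A = ?A"
    proof (rule eq_matI)
      fix i j assume "i < dim_row ?A" "j < dim_col ?A"
      then have ij: "i < m" "j < m" by auto
      then have "(id i, ?c j) \<in> {0..<m} \<times> {1..n}" using c[OF ij(2)] True by auto
      then show "map_mat (retract m n) ?A $$ (i, j) = ?A $$ (i, j)" using ij retract_X[of m n "(id i, ?c j)", where ?'a = 'a] by simp
    qed auto
    then show ?thesis unfolding det using True by (simp only: minor_eq_gen_det gen_det_def if_True)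
  next
    case False
    then obtain x where x: "x \<in> F" "x \<notin> {1..n}" by blast
    then obtain j where j: "j < m" "?c j = x"
      using finF F by (metis in_set_conv_nth length_sorted_list_of_set set_sorted_list_of_set)
    have zero: "map_mat (retract m n) ?A $$ (i, j) = 0" if "i < m" for i
      using retract_X[of m n "(id i, ?c j)", where ?'a = 'a] x j that by simp
    have "det (map_mat (retract m n) ?A) = (\<Sum>i<m. map_mat (retract m n) ?A $$ (i, j) * cofactor (map_mat (retract m n) ?A) i j)"
      by (rule laplace_expansion_column) (use j in auto)
    also have "\<dots> = 0"
    proof (rule sum.neutral, rule ballI)
      fix i assume "i \<in> {..<m}"
      then have "map_mat (retract m n) ?A $$ (i, j) = 0" by (intro zero) simp
      then show "map_mat (retract m n) ?A $$ (i, j) * cofactor (map_mat (retract m n) ?A) i j = 0"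
        by (simp only: mult_zero_left)
    qed
    finally show ?thesis unfolding det using False by (simp only: if_False)
  qed
qed

lemma ideal_gen_step:
  assumes p: "p \<in> ideal_gen R G" and g: "g \<in> G" and c: "c \<in> R"
    and R: "\<And>a b. a \<in> R \<Longrightarrow> b \<in> R \<Longrightarrow> a + b \<in> R"
  shows "p + c * g \<in> ideal_gen R G"
proof -
  obtain G' d where G': "finite G'" "G' \<subseteq> G" "\<forall>g\<in>G'. d g \<in> R" "p = (\<Sum>g\<in>G'. d g * g)"
    using p by (auto simp: ideal_gen_def)
  \<comment> \<open>In \<open>ideal_gen\<close> each generator carries a single coefficient, so a
    multiple of a generator already present is merged into its coefficient.\<close>
  define d' where "d' h = (if h = g then (if g \<in> G' then d g + c else c) else d h)" for h
  have "(\<Sum>h\<in>insert g G'. d' h * h) = d' g * g + (\<Sum>h\<in>G' - {g}. d' h * h)"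
    using G'(1) by (simp add: sum.insert_remove)
  also have "(\<Sum>h\<in>G' - {g}. d' h * h) = (\<Sum>h\<in>G' - {g}. d h * h)"
    by (rule sum.cong) (auto simp: d'_def)
  also have "d' g * g + (\<Sum>h\<in>G' - {g}. d h * h) = p + c * g"
  proof (cases "g \<in> G'")
    case True
    then have "p = d g * g + (\<Sum>h\<in>G' - {g}. d h * h)" using G' by (simp add: sum.remove)
    then show ?thesis using True by (simp add: d'_def algebra_simps)
  next
    case False
    then show ?thesis using G' by (simp add: d'_def)
  qed
  finally have "p + c * g = (\<Sum>h\<in>insert g G'. d' h * h)" ..
  moreover have "\<forall>h\<in>insert g G'. d' h \<in> R" using G' c R by (auto simp: d'_def)
  ultimately show ?thesis unfolding ideal_gen_def using G'(1,2) g
    by (intro CollectI exI[of _ "insert g G'"] exI[of _ d']) auto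
qed

text \<open>Setting the new columns to zero kills every minor that uses one of them and fixes the
  others, so it maps the large ideal into \<open>J_Delta\<close>; on \<open>polyring m n\<close> it
  is the identity.\<close>

lemma J_Delta_eq:
  assumes m: "m > 0" and FF: "\<And>F. F \<in> Fs \<Longrightarrow> F \<subseteq> {1..n} \<and> card F = m"
    and up: "\<And>F. F \<in> Fs \<Longrightarrow> \<exists>i<r. F \<subseteq> W i"
    and down: "\<And>F i. i < r \<Longrightarrow> F \<subseteq> W i \<Longrightarrow> F \<subseteq> {1..n} \<Longrightarrow> card F = m \<Longrightarrow> F \<in> Fs"
  shows "J_Delta m n Fs = idl (\<Union>i<r. minors m (W i)) \<inter> (polyring m n :: 'a::comm_ring_1 mpoly set)"
proof (intro subset_antisym subsetI)
  let ?I = "idl (\<Union>i<r. minors m (W i)) :: 'a mpoly set"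
  fix p :: "'a mpoly" assume "p \<in> J_Delta m n Fs"
  then obtain G' c where G': "finite G'" "G' \<subseteq> minor m ` Fs" "\<forall>g\<in>G'. c g \<in> polyring m n" "p = (\<Sum>g\<in>G'. c g * g)"
    by (auto simp: J_Delta_def ideal_gen_def)
  have g: "g \<in> ?I" "g \<in> polyring m n" if gG: "g \<in> G'" for g
  proof -
    obtain F where F: "F \<in> Fs" "g = minor m F" using gG G'(2) by auto
    then show "g \<in> ?I" using up[OF F(1)] FF[OF F(1)] by (auto intro!: idl_gen simp: minors_def)
    have "retract m n g = g" unfolding F(2) using retract_minor[of F m n, where ?'a = 'a] FF[OF F(1)] m by simp
    then show "g \<in> polyring m n" using retract_in_polyring by metis
  qed
  have "p \<in> ?I" unfolding G'(4)
    by (intro is_ideal_sum is_ideal_idl is_idealD(3)[OF is_ideal_idl] g(1))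
  moreover have "p \<in> polyring m n" unfolding G'(4)
    by (intro polyring_sum polyring_mult) (use G'(3) g in auto)
  ultimately show "p \<in> ?I \<inter> polyring m n" by blast
next
  let ?I = "idl (\<Union>i<r. minors m (W i)) :: 'a mpoly set"
  interpret comm_ring_hom "retract m n :: 'a mpoly \<Rightarrow> _" by (rule comm_ring_hom_retract)
  have ret: "retract m n p \<in> J_Delta m n Fs" if "p \<in> ?I" for p
    using that
  proof (induction rule: idl.induct)
    case zero
    show ?case by (auto simp: J_Delta_def ideal_gen_def intro!: exI[of _ "{}"])
  next
    case (step a g c)
    obtain i F where F: "i < r" "F \<subseteq> W i" "card F = m" "g = minor m F" using step(2) by (auto simp: minors_def)
    show ?case
    proof (cases "F \<subseteq> {1..n}")
      case True
      then have "F \<in> Fs" using down F by blast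
      then have "retract m n a + retract m n c * minor m F \<in> J_Delta m n Fs"
        using step(3) unfolding J_Delta_def
        by (intro ideal_gen_step retract_in_polyring polyring_add) auto
      then show ?thesis using F True retract_minor[OF F(3) m, of n, where ?'a = 'a] by (simp add: hom_add hom_mult)
    next
      case False
      then show ?thesis using F step(3) retract_minor[OF F(3) m, of n, where ?'a = 'a] by (simp add: hom_add hom_mult)
    qed
  qed
  fix p :: "'a mpoly" assume "p \<in> ?I \<inter> polyring m n"
  then show "p \<in> J_Delta m n Fs" using ret[of p] retract_id[of p m n] by simp
qed

section \<open>From the clique decomposition to a cyclic family\<close>

lemma facets_iff_cliques:
  assumes "pure_complex m n Fs"
  shows "F \<in> Fs \<longleftrightarrow> card F = m \<and> F \<subseteq> {1..n} \<and> (\<exists>V\<in>cliques m n Fs. F \<subseteq> V)"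
proof
  assume F: "F \<in> Fs"
  then have Fm: "F \<subseteq> {1..n}" "card F = m" using assms by (auto simp: pure_complex_def)
  have "F \<in> clique_simplices m n Fs" using F Fm by (auto simp: clique_simplices_def faces_def)
  moreover have "finite (clique_simplices m n Fs)"
    by (rule finite_subset[of _ "Pow {1..n}"]) (auto simp: clique_simplices_def)
  ultimately obtain V where "V \<in> clique_simplices m n Fs" "F \<subseteq> V"
    "\<forall>V'\<in>clique_simplices m n Fs. V \<subseteq> V' \<longrightarrow> V = V'"
    using finite_has_maximal2 by metis
  then have "V \<in> cliques m n Fs" by (auto simp: cliques_def)
  then show "card F = m \<and> F \<subseteq> {1..n} \<and> (\<exists>V\<in>cliques m n Fs. F \<subseteq> V)" using Fm \<open>F \<subseteq> V\<close> by blast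
next
  assume F: "card F = m \<and> F \<subseteq> {1..n} \<and> (\<exists>V\<in>cliques m n Fs. F \<subseteq> V)"
  then have "F \<in> faces Fs" by (auto simp: cliques_def clique_simplices_def)
  then obtain F' where F': "F' \<in> Fs" "F \<subseteq> F'" by (auto simp: faces_def)
  then have "card F' = m" "finite F'" using assms finite_subset by (auto simp: pure_complex_def)
  then have "F = F'" using F F' by (metis card_subset_eq)
  then show "F \<in> Fs" using F' by simp
qed

lemma cycle_of_cliques:
  assumes i: "cond_i C" and ii: "cond_ii C" and fin: "\<And>V. V \<in> C \<Longrightarrow> finite V"
    and cyc: "is_cycle_graph C (G_edge C)"
  obtains r V s where "cyclic_family r V s" "V ` {..<r} = C"
proof -
  define r where "r = card C"
  from cyc obtain f where r: "r \<ge> 3" and f: "bij_betw f {0..<r} C"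
    and E: "\<And>i j. i < r \<Longrightarrow> j < r \<Longrightarrow> G_edge C (f i) (f j) \<longleftrightarrow> (j = Suc i mod r \<or> i = Suc j mod r)"
    unfolding is_cycle_graph_def r_def by blast
  have fC: "f i \<in> C" if "i < r" for i using f that by (auto simp: bij_betw_def)
  have f_eq: "f i = f j \<longleftrightarrow> i = j" if "i < r" "j < r" for i j
    using f that by (auto simp: bij_betw_def inj_on_def)
  have succ: "Suc i mod r < r" "Suc i mod r \<noteq> i" "Suc (Suc i mod r) mod r \<noteq> i" if "i < r" for i
    using r that by (auto simp: mod_Suc)
  have "\<exists>v. f i \<inter> f (Suc i mod r) = {v}" if ir: "i < r" for i
  proof -
    have "G_edge C (f i) (f (Suc i mod r))" using E[OF ir succ(1)[OF ir]] by simp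
    then have "f i \<inter> f (Suc i mod r) \<noteq> {}" by (simp add: G_edge_def)
    moreover have "card (f i \<inter> f (Suc i mod r)) \<le> 1"
      using i fC[OF ir] fC[OF succ(1)[OF ir]] f_eq[OF ir succ(1)[OF ir]] succ(2)[OF ir] by (simp add: cond_i_def)
    moreover have "finite (f i \<inter> f (Suc i mod r))" using fin fC[OF ir] by blast
    ultimately have "card (f i \<inter> f (Suc i mod r)) = 1"
      by (metis One_nat_def card_0_eq le_Suc_eq le_zero_eq)
    then show ?thesis by (simp add: card_1_singleton_iff)
  qed
  then have "\<forall>i. \<exists>v. i < r \<longrightarrow> f i \<inter> f (Suc i mod r) = {v}" by blast
  then obtain s where s: "\<And>i. i < r \<Longrightarrow> f i \<inter> f (Suc i mod r) = {s i}" by metis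
  have triple: "f i \<inter> f j \<inter> f k = {}" if "i < r" "j < r" "k < r" "i \<noteq> j" "j \<noteq> k" "i \<noteq> k" for i j k
    using ii fC[OF that(1)] fC[OF that(2)] fC[OF that(3)] f_eq[OF that(1,2)] f_eq[OF that(2,3)] f_eq[OF that(1,3)] that(4-6)
    unfolding cond_ii_def by simp
  \<comment> \<open>If \<open>s i = s j\<close>, this column lies in the cliques \<open>i\<close>
    and \<open>j\<close> and in their successors, among which there are three distinct ones; this
    contradicts condition (ii).\<close>
  have "inj_on s {..<r}"
  proof (rule inj_onI, rule ccontr)
    fix i j assume ij: "i \<in> {..<r}" "j \<in> {..<r}" "s i = s j" "i \<noteq> j"
    then have lt: "i < r" "j < r" by auto
    have v: "s i \<in> f i" "s i \<in> f (Suc i mod r)" "s i \<in> f j" "s i \<in> f (Suc j mod r)"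
      using s[OF lt(1)] s[OF lt(2)] ij(3) by auto
    show False
    proof (cases "j = Suc i mod r")
      case True
      have "f i \<inter> f j \<inter> f (Suc j mod r) = {}"
        using triple[OF lt succ(1)[OF lt(2)]] succ(2)[OF lt(2)] succ(3)[OF lt(1)] ij(4) True by simp
      then show False using v by blast
    next
      case False
      have "f i \<inter> f (Suc i mod r) \<inter> f j = {}"
        using triple[OF lt(1) succ(1)[OF lt(1)] lt(2)] succ(2)[OF lt(1)] ij(4) False by simp
      then show False using v by blast
    qed
  qed
  moreover have "f i \<inter> f j = {}" if "i < r" "j < r" "i \<noteq> j" "j \<noteq> Suc i mod r" "i \<noteq> Suc j mod r" for i j
    using E[OF that(1,2)] that fC[OF that(1)] fC[OF that(2)] f_eq[OF that(1,2)] by (simp add: G_edge_def)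
  ultimately have "cyclic_family r f s"
    unfolding cyclic_family_def using r s fin fC by blast
  moreover have "f ` {..<r} = C" using f by (simp add: bij_betw_def lessThan_atLeast0)
  ultimately show thesis by (rule that)
qed

text \<open>The numbers above \<open>n\<close> are cut into blocks of length \<open>m - 1\<close>,
  one for each clique.\<close>

lemma cyclic_family_extend:
  assumes C: "cyclic_family r V s" and V: "\<And>i. i < r \<Longrightarrow> V i \<subseteq> {1..n}" and m: "m \<ge> 3"
  defines "e \<equiv> \<lambda>i q. Suc n + (i * (m - 1) + q)"
  shows "cycle_columns r m (\<lambda>i. V i \<union> e i ` {..<m - 1}) s e"
proof -
  have r: "r \<ge> 3" using C by (simp add: cyclic_family_def)
  have e_n: "e i q \<notin> {1..n}" for i q by (simp add: e_def)
  have e_inj: "i = j" if "e i q = e j q'" "q < m - 1" "q' < m - 1" for i j q q'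
  proof -
    have eq: "i * (m - 1) + q = j * (m - 1) + q'" using that(1) by (simp add: e_def)
    have "(i * (m - 1) + q) div (m - 1) = i" "(j * (m - 1) + q') div (m - 1) = j" using that m by auto
    then show ?thesis unfolding eq by simp
  qed
  let ?W = "\<lambda>i. V i \<union> e i ` {..<m - 1}"
  have disj: "?W i \<inter> ?W j = V i \<inter> V j" if "i < r" "j < r" "i \<noteq> j" for i j
  proof -
    have "e i ` {..<m - 1} \<inter> e j ` {..<m - 1} = {}" using e_inj that(3) by blast
    moreover have "V i \<inter> e j ` {..<m - 1} = {}" "e i ` {..<m - 1} \<inter> V j = {}"
      using V[OF that(1)] V[OF that(2)] e_n by blast+
    ultimately show ?thesis by blast
  qed
  have succ: "Suc i mod r < r" "i \<noteq> Suc i mod r" if "i < r" for i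
    using r that by (auto simp: mod_Suc)
  have W: "cyclic_family r ?W s"
    unfolding cyclic_family_def
  proof (intro conjI allI impI)
    show "3 \<le> r" by (rule r)
    show "inj_on s {..<r}" using C unfolding cyclic_family_def by blast
    show "finite (?W i)" if "i < r" for i using C that by (simp add: cyclic_family_def)
    show "?W i \<inter> ?W (Suc i mod r) = {s i}" if "i < r" for i
      unfolding disj[OF that succ[OF that]] using C that unfolding cyclic_family_def by blast
    show "?W i \<inter> ?W j = {}" if "i < r" "j < r" "i \<noteq> j" "j \<noteq> Suc i mod r" "i \<noteq> Suc j mod r" for i j
      unfolding disj[OF that(1-3)] using C that unfolding cyclic_family_def by blast
  qed
  show ?thesis
  proof
    show "e i q \<notin> ?W j" if "i < r" "q < m - 1" "j \<noteq> i" "j < r" for i q j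
      using e_inj[of i q j] that V[OF that(4)] e_n[of i q] by blast
  qed (use W m in \<open>auto simp: e_def\<close>)
qed

theorem theorem3p3:
  fixes m n :: nat and Fs :: "nat set set"
  assumes "m - 1 \<ge> 2"
    and "pure_complex m n Fs"
    and "cond_i (cliques m n Fs)" and "cond_ii (cliques m n Fs)"
    and "is_cycle_graph (cliques m n Fs) (G_edge (cliques m n Fs))"
  shows "prime_ideal_in (polyring m n) (J_Delta m n Fs :: 'a::field mpoly set)"
proof -
  have m: "m \<ge> 3" using assms(1) by linarith
  have sub: "V \<subseteq> {1..n}" if "V \<in> cliques m n Fs" for V
    using that by (simp add: cliques_def clique_simplices_def)
  obtain r V s where C: "cyclic_family r V s" and VC: "V ` {..<r} = cliques m n Fs"
    using cycle_of_cliques[OF assms(3,4) _ assms(5)] sub finite_subset by (metis finite_atLeastAtMost)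
  have Vsub: "V i \<subseteq> {1..n}" if "i < r" for i using sub VC that by blast
  define e where "e = (\<lambda>i q. Suc n + (i * (m - 1) + q))"
  define W where "W i = V i \<union> e i ` {..<m - 1}" for i
  interpret cycle_columns r m W s e
    using cyclic_family_extend[OF C Vsub m] unfolding W_def e_def .
  have J: "J_Delta m n Fs = clique_ideal \<inter> (polyring m n :: 'a mpoly set)"
    unfolding clique_ideal_def
  proof (rule J_Delta_eq)
    show "m > 0" using m by simp
    show "F \<subseteq> {1..n} \<and> card F = m" if "F \<in> Fs" for F
      using facets_iff_cliques[OF assms(2)] that by blast
    show "\<exists>i<r. F \<subseteq> W i" if "F \<in> Fs" for F
      using facets_iff_cliques[OF assms(2), of F] that unfolding VC[symmetric] W_def by blast
    show "F \<in> Fs" if "i < r" "F \<subseteq> W i" "F \<subseteq> {1..n}" "card F = m" for F i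
    proof -
      have "e i q \<notin> {1..n}" for q by (simp add: e_def)
      then have "F \<subseteq> V i" using that(2,3) unfolding W_def by blast
      then show ?thesis using facets_iff_cliques[OF assms(2), of F] that VC by blast
    qed
  qed
  interpret param: comm_ring_hom "param :: 'a mpoly \<Rightarrow> _" by (rule comm_ring_hom_param)
  have vars: "\<forall>u\<in>keys p. keys u \<subseteq> {..<m} \<times> UNIV" if "p \<in> polyring m n" for p :: "'a mpoly"
    using that unfolding polyring_def by fastforce
  show ?thesis
    unfolding prime_ideal_in_def J
  proof (intro conjI ballI impI)
    have "(1 :: 'a mpoly) \<in> polyring m n" unfolding single_one[symmetric] by (rule polyring_single) simp
    then show "clique_ideal \<inter> polyring m n \<noteq> (polyring m n :: 'a mpoly set)" using one_notin_clique_ideal by blast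
  next
    fix a b :: "'a mpoly"
    assume ab: "a \<in> polyring m n" "b \<in> polyring m n" "a * b \<in> clique_ideal \<inter> polyring m n"
    \<comment> \<open>The values of \<open>param\<close> lie in a field, and on
      \<open>polyring m n\<close> its kernel is the part of \<open>clique_ideal\<close> lying
      there.\<close>
    then have "param a * param b = 0" using param_clique_ideal[of "a * b"] by (simp add: param.hom_mult)
    then have "param a = 0 \<or> param b = 0" by simp
    then show "a \<in> clique_ideal \<inter> polyring m n \<or> b \<in> clique_ideal \<inter> polyring m n"
      using param_kernel[OF vars] ab by blast
  qed blast
qed

end
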